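(* Let $p$ be a prime with $p\equiv 3\pmod 4$, let $R=\mathbb{Z}_2[X]/(X^2+p)$, and let $M$ be a finitely generated $R$-module that is free as a $\mathbb{Z}_2$-module. (1) If $p\equiv 3\pmod 8$, then $M$ is isomorphic as an $R$-module to $R^r\oplus O_E^s$ for some non-negative integers $r$ and $s$. Moreover, the integers $r$ and $s$ are uniquely determined by $M$. (2) If $p\equiv 7\pmod 8$, then $M$ is isomorphic as an $R$-module to $$R^r\oplus \left[R/(\omega-2\alpha_1)\right]^s\oplus\left[R/(\omega-2\alpha_2)\right]^t$$ for some non-negative integers $r$, $s$ and $t$. Moreover, the integers $r$, $s$ and $t$ are uniquely determined by $M$.
   Context: Let $p\equiv 3\pmod 4$ be a prime. Write $R=\mathbb{Z}_2[X]/(X^2+p)=\mathbb{Z}_2[\pi]$ with $\pi$ the class of $X$, $E=R\otimes_{\mathbb{Z}_2}\mathbb{Q}_2$, and let $O_E$ be the ring of integers (maximal order) of $E$. Put $\omega=\pi-1\in R$, so that $R=\mathbb{Z}_2[\omega]=\mathbb{Z}_2[X]/(X^2+2X+(p+1))$. One has $O_E=\mathbb{Z}_2[\alpha]=\mathbb{Z}_2[X]/(X^2+X+(p+1)/4)$ with $2\alpha=\omega$, and $O_E$ is viewed as an $R$-module via $R\subset O_E$. If $p\equiv 3\pmod 8$, $E$ is the unramified quadratic extension of $\mathbb{Q}_2$. If $p\equiv 7\pmod 8$, then $E\simeq\mathbb{Q}_2\times\mathbb{Q}_2$, and one writes $X^2+X+(p+1)/4=(X-\alpha_1)(X-\alpha_2)$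 with $\alpha_1,\alpha_2\in\mathbb{Z}_2$, where $\alpha_1$ is a unit and $\alpha_2\in 2\mathbb{Z}_2$; accordingly $X^2+2X+(p+1)=(X-2\alpha_1)(X-2\alpha_2)$. *)

theory Defs
  imports
    "Jordan_Normal_Form.VS_Connect"
    "HOL-Algebra.QuotRing"
    "HOL-Computational_Algebra.Fraction_Field"
begin

section \<open>The ring of 2-adic integers\<close>

text \<open>The inverse limit of the rings of integers modulo \<open>2 ^ n\<close>; each residue class is
  represented by its least nonnegative element.\<close>

typedef zz2 = "{x :: nat \<Rightarrow> int. \<forall>n. 0 \<le> x n \<and> x n < 2 ^ n \<and> x (Suc n) mod 2 ^ n = x n}"
  morphisms res2 Abs_zz2
  by (rule exI[of _ "\<lambda>_. 0"]) simp

lemma res2_mod [simp]: "res2 x n mod 2 ^ n = res2 x n"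
  using res2[of x] by simp

lemma res2_0 [simp]: "res2 x 0 = 0"
  using res2[of x] by (auto dest: spec[of _ 0])

lemma res2_Suc: "res2 x (Suc n) mod 2 ^ n = res2 x n"
  using res2[of x] by simp

lemma res2_le: "m \<le> n \<Longrightarrow> res2 x n mod 2 ^ m = res2 x m"
proof (induction rule: dec_induct)
  case (step n)
  have "res2 x (Suc n) mod 2 ^ m = res2 x (Suc n) mod 2 ^ n mod 2 ^ m"
    using step.hyps by (simp add: mod_mod_cancel le_imp_power_dvd)
  with step.IH show ?case
    by (simp add: res2_Suc)
qed simp

lemma zz2_eqI: "(\<And>n. res2 x n = res2 y n) \<Longrightarrow> x = y"
  by (metis ext res2_inject)

definition lim2 :: "(nat \<Rightarrow> int) \<Rightarrow> zz2" where
  "lim2 f = Abs_zz2 (\<lambda>n. f n mod 2 ^ n)"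

lemma res2_lim2:
  assumes "\<And>n. f (Suc n) mod 2 ^ n = f n mod 2 ^ n"
  shows "res2 (lim2 f) n = f n mod 2 ^ n"
  unfolding lim2_def using assms
  by (subst Abs_zz2_inverse) (auto simp: mod_mod_cancel le_imp_power_dvd)

instantiation zz2 :: comm_ring_1
begin

definition "0 = lim2 (\<lambda>_. 0)"
definition "1 = lim2 (\<lambda>_. 1)"
definition "x + y = lim2 (\<lambda>n. res2 x n + res2 y n)"
definition "x * y = lim2 (\<lambda>n. res2 x n * res2 y n)"
definition "- x = lim2 (\<lambda>n. - res2 x n)"
definition "x - y = lim2 (\<lambda>n. res2 x n - res2 y n)"

lemma res2_zero [simp]: "res2 0 n = 0"
  unfolding zero_zz2_def by (subst res2_lim2) auto

lemma res2_one: "res2 1 n = 1 mod 2 ^ n"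
  unfolding one_zz2_def by (subst res2_lim2) auto

lemma res2_add: "res2 (x + y) n = (res2 x n + res2 y n) mod 2 ^ n"
  unfolding plus_zz2_def
  by (rule res2_lim2) (metis mod_add_eq res2_Suc)

lemma res2_mult: "res2 (x * y) n = (res2 x n * res2 y n) mod 2 ^ n"
  unfolding times_zz2_def
  by (rule res2_lim2) (metis mod_mult_eq res2_Suc)

lemma res2_uminus: "res2 (- x) n = (- res2 x n) mod 2 ^ n"
  unfolding uminus_zz2_def
  by (rule res2_lim2) (metis mod_minus_eq res2_Suc)

lemma res2_minus: "res2 (x - y) n = (res2 x n - res2 y n) mod 2 ^ n"
  unfolding minus_zz2_def
  by (rule res2_lim2) (metis mod_diff_eq res2_Suc)

instance
proof
  show "(0 :: zz2) \<noteq> 1"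
  proof
    assume "(0 :: zz2) = 1"
    then have "res2 0 1 = res2 1 1" by simp
    then show False by (simp add: res2_one)
  qed
qed (rule zz2_eqI; simp add: res2_add res2_mult res2_uminus res2_minus res2_one
      mod_simps algebra_simps)+

end

instance zz2 :: idom
proof
  fix x y :: zz2
  assume "x \<noteq> 0" "y \<noteq> 0"
  then obtain a b where ab: "res2 x a \<noteq> 0" "res2 y b \<noteq> 0"
    by (metis zz2_eqI res2_zero)
  have x: "\<not> 2 ^ a dvd res2 x (a + b)"
    using ab(1) res2_le[of a "a + b" x] by (auto simp: dvd_eq_mod_eq_0)
  have y: "\<not> 2 ^ b dvd res2 y (a + b)"
    using ab(2) res2_le[of b "a + b" y] by (auto simp: dvd_eq_mod_eq_0)
  have nz: "res2 x (a + b) \<noteq> 0" "res2 y (a + b) \<noteq> 0"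
    using x y by auto
  have "multiplicity 2 (res2 x (a + b)) < a" "multiplicity 2 (res2 y (a + b)) < b"
    using x y by (meson multiplicity_dvd' not_le)+
  then have "multiplicity 2 (res2 x (a + b) * res2 y (a + b)) < a + b"
    using nz by (simp add: prime_elem_multiplicity_mult_distrib)
  then have "\<not> 2 ^ (a + b) dvd res2 x (a + b) * res2 y (a + b)"
    using nz by (subst power_dvd_iff_le_multiplicity) auto
  then have "res2 (x * y) (a + b) \<noteq> 0"
    by (simp add: res2_mult dvd_eq_mod_eq_0)
  then show "x * y \<noteq> 0"
    by auto
qed


section \<open>Modules\<close>

text \<open>The \<open>mult\<close> and \<open>one\<close> fields of a module record carry no information.\<close>

definition regular_module :: "'a ring \<Rightarrow> ('a, 'a) module" where
  "regular_module S = \<lparr>carrier = carrier S, mult = mult S, one = one S,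
     zero = zero S, add = add S, smult = mult S\<rparr>"

definition restrict_scalars :: "('a \<Rightarrow> 'b) \<Rightarrow> ('b, 'm) module \<Rightarrow> ('a, 'm) module" where
  "restrict_scalars h M = \<lparr>carrier = carrier M, mult = mult M, one = one M,
     zero = zero M, add = add M, smult = (\<lambda>a. smult M (h a))\<rparr>"

definition quotient_module :: "'a ring \<Rightarrow> 'a \<Rightarrow> ('a, 'a set) module" where
  "quotient_module S a = restrict_scalars (\<lambda>s. (PIdl\<^bsub>S\<^esub> a) +>\<^bsub>S\<^esub> s)
     (regular_module (S Quot (PIdl\<^bsub>S\<^esub> a)))"

definition module_power :: "('a, 'm) module \<Rightarrow> nat \<Rightarrow> ('a, nat \<Rightarrow> 'm) module" where
  "module_power M n = \<lparr>carrier = {..<n} \<rightarrow>\<^sub>E carrier M,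
     mult = (\<lambda>f g. \<lambda>i\<in>{..<n}. \<zero>\<^bsub>M\<^esub>),
     one = (\<lambda>i\<in>{..<n}. \<zero>\<^bsub>M\<^esub>),
     zero = (\<lambda>i\<in>{..<n}. \<zero>\<^bsub>M\<^esub>),
     add = (\<lambda>f g. \<lambda>i\<in>{..<n}. f i \<oplus>\<^bsub>M\<^esub> g i),
     smult = (\<lambda>a f. \<lambda>i\<in>{..<n}. a \<odot>\<^bsub>M\<^esub> f i)\<rparr>"

definition finitely_generated_module :: "'a ring \<Rightarrow> ('a, 'm) module \<Rightarrow> bool" where
  "finitely_generated_module S M \<longleftrightarrow>
     (\<exists>A. finite A \<and> A \<subseteq> carrier M \<and> LinearCombinations.module.span S M A = carrier M)"

definition free_module :: "'a ring \<Rightarrow> ('a, 'm) module \<Rightarrow> bool" where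
  "free_module S M \<longleftrightarrow>
     (\<exists>B. B \<subseteq> carrier M \<and> \<not> LinearCombinations.module.lin_dep S M B \<and>
        LinearCombinations.module.span S M B = carrier M)"

definition module_isomorphic :: "'a ring \<Rightarrow> ('a, 'm) module \<Rightarrow> ('a, 'n) module \<Rightarrow> bool" where
  "module_isomorphic S M N \<longleftrightarrow>
     (\<exists>f \<in> LinearCombinations.module_hom S M N. bij_betw f (carrier M) (carrier N))"


section \<open>The order \<open>R\<close>, the algebra \<open>E\<close> and its ring of integers\<close>

definition quad_ideal :: "nat \<Rightarrow> 'a::comm_ring_1 poly set" where
  "quad_ideal p = PIdl\<^bsub>class_ring\<^esub> [:of_nat p, 0, 1:]"

definition quad_ring :: "nat \<Rightarrow> 'a::comm_ring_1 poly set ring" where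
  "quad_ring p = class_ring Quot quad_ideal p"

definition quad_class :: "nat \<Rightarrow> 'a::comm_ring_1 poly \<Rightarrow> 'a poly set" where
  "quad_class p f = quad_ideal p +>\<^bsub>class_ring\<^esub> f"

abbreviation R_ring :: "nat \<Rightarrow> zz2 poly set ring" where
  "R_ring p \<equiv> quad_ring p"

text \<open>Tensoring \<open>R\<close> with \<open>\<rat>\<^sub>2\<close> over \<open>\<int>\<^sub>2\<close> amounts to extending the coefficients
  to the fraction field.\<close>

abbreviation E_ring :: "nat \<Rightarrow> zz2 fract poly set ring" where
  "E_ring p \<equiv> quad_ring p"

definition zz2_to_R :: "nat \<Rightarrow> zz2 \<Rightarrow> zz2 poly set" where
  "zz2_to_R p z = quad_class p [:z:]"

definition omega :: "nat \<Rightarrow> zz2 poly set" where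
  "omega p = quad_class p [:0, 1:] \<ominus>\<^bsub>R_ring p\<^esub> \<one>\<^bsub>R_ring p\<^esub>"

text \<open>The inclusion of \<open>R\<close> in \<open>E\<close>, which sends the class of a polynomial \<open>f\<close> to the
  class of \<open>f\<close>; the image below is a singleton for every element of \<open>R\<close>.\<close>

definition R_to_E :: "nat \<Rightarrow> zz2 poly set \<Rightarrow> zz2 fract poly set" where
  "R_to_E p x = the_elem ((\<lambda>f. quad_class p (map_poly (\<lambda>z. Fract z 1) f)) ` x)"

definition integral_over_zz2 :: "nat \<Rightarrow> zz2 fract poly set \<Rightarrow> bool" where
  "integral_over_zz2 p x \<longleftrightarrow>
     (\<exists>q :: zz2 poly. lead_coeff q = 1 \<and>
        (\<Oplus>\<^bsub>E_ring p\<^esub> i \<in> {..degree q}.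
           R_to_E p (zz2_to_R p (coeff q i)) \<otimes>\<^bsub>E_ring p\<^esub> (x [^]\<^bsub>E_ring p\<^esub> i)) = \<zero>\<^bsub>E_ring p\<^esub>)"

definition O_E_ring :: "nat \<Rightarrow> zz2 fract poly set ring" where
  "O_E_ring p = (E_ring p)\<lparr>carrier := {x \<in> carrier (E_ring p). integral_over_zz2 p x}\<rparr>"

definition O_E_module :: "nat \<Rightarrow> (zz2 poly set, zz2 fract poly set) module" where
  "O_E_module p = restrict_scalars (R_to_E p) (regular_module (O_E_ring p))"

text \<open>The \<open>R\<close>-module \<open>R / (\<omega> - 2 a)\<close>.\<close>

definition R_mod_omega :: "nat \<Rightarrow> zz2 \<Rightarrow> (zz2 poly set, zz2 poly set set) module" where
  "R_mod_omega p a =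
     quotient_module (R_ring p) (omega p \<ominus>\<^bsub>R_ring p\<^esub> zz2_to_R p (2 * a))"

end

theory Submission
  imports Defs "HOL-Library.Function_Algebras" "HOL-Number_Theory.Cong"
    "HOL-Computational_Algebra.Polynomial_Factorial"
begin

text \<open>Let \<open>L\<close> be the lattice \<open>M\<close> and \<open>q = (p + 1) / 4\<close>, so that \<open>\<omega>\<^sup>2 = - 2 \<omega> - 4 q\<close> on \<open>L\<close>. On
  \<open>K = {x. \<omega> x \<in> 2 L}\<close> the operator \<open>\<alpha> = \<omega> / 2\<close> is defined and satisfies \<open>\<alpha>\<^sup>2 + \<alpha> + q = 0\<close>, and
  \<open>D = 2 L + \<omega> L\<close> is an \<open>\<alpha>\<close>-stable submodule of \<open>K\<close>. Lifting a basis \<open>x\<^sub>i\<close> of \<open>L / K\<close> and a basis of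
  \<open>K / D\<close>, the vectors \<open>x\<^sub>i\<close>, \<open>\<omega> x\<^sub>i\<close> and the lift of the second basis form a basis of \<open>L\<close> modulo 2,
  hence a basis of \<open>L\<close> by Nakayama's lemma. If \<open>q\<close> is odd, \<open>K / D\<close> is a vector space over the field
  \<open>O\<^sub>E / 2\<close> with four elements, and a basis \<open>y\<^sub>j\<close> of it gives the basis \<open>y\<^sub>j\<close>, \<open>\<alpha> y\<^sub>j\<close> over the field
  with two elements. If \<open>q\<close> is even, \<open>\<alpha>\<^sub>1 - \<alpha>\<^sub>2\<close> is a unit, so \<open>K\<close> is the sum of the eigenspaces
  of \<open>\<alpha>\<close>, and the lift can be chosen among eigenvectors. The ranks can be read off from the indices
  in \<open>L\<close> of \<open>K\<close>, \<open>D\<close> and of the sums of \<open>D\<close> with the eigenspaces.\<close>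

section \<open>The ring of 2-adic integers\<close>

text \<open>The ranks of a decomposition are only found inside the proof, so modules are replaced by
  functions supported on an index set: a lattice is \<open>coords J\<close> with an operator for
  \<omega>, and an R-linear isomorphism is a \<open>lattice_iso\<close>. What remains is linear
  algebra over the 2-adic integers. The chain 2 L, D, K, L separates the kinds of summands. On R
  both K and D consist of the a + b \<omega> with a even, so R contributes to L / K and nothing to K
  / D. On O_E and on R / (\<omega> - 2 a) the operator \<omega> is divisible by 2, so K is
  everything and D = 2 L. The obstacle is that \<alpha> exists on K only, so a basis of L has to be
  assembled from the layers of this chain. Dimensions over residue fields are avoided: a basis of a
  quotient is a finite family that generates modulo a submodule and all of whose combinations inside
  that submodule have even coefficients.\<close>

lemma res2_of_int: "res2 (of_int z) n = z mod 2 ^ n"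
proof -
  have nat: "res2 (of_nat k) n = int k mod 2 ^ n" for k
    by (induction k) (simp_all add: res2_add res2_one mod_simps)
  show ?thesis
  proof (cases z rule: int_cases2)
    case (nonneg k)
    then show ?thesis by (simp add: nat)
  next
    case (nonpos k)
    then show ?thesis by (simp add: nat res2_uminus mod_simps)
  qed
qed

lemma res2_power_two: "res2 (2 ^ k) n = 2 ^ k mod 2 ^ n"
  using res2_of_int[of "2 ^ k" n] by simp

text \<open>The quotient by \<open>2 ^ n\<close> is the limit of the residues of x divided by
  \<open>2 ^ n\<close>, read n levels higher because the division loses n binary digits.\<close>

lemma two_power_dvd_zz2_iff: "2 ^ n dvd (x :: zz2) \<longleftrightarrow> res2 x n = 0"
proof
  assume "2 ^ n dvd x"
  then show "res2 x n = 0"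
    by (auto simp: res2_mult res2_power_two)
next
  assume zero: "res2 x n = 0"
  let ?f = "\<lambda>k. res2 x (k + n) div 2 ^ n"
  have dvd: "2 ^ n dvd res2 x (k + n)" for k
    using res2_le[of n "k + n" x] zero by (simp add: dvd_eq_mod_eq_0)
  have f: "2 ^ n * ?f k = res2 x (k + n)" for k
    using dvd[of k] by simp
  have "?f (Suc k) mod 2 ^ k = ?f k mod 2 ^ k" for k
  proof -
    have "2 ^ n * (?f (Suc k) mod 2 ^ k) = 2 ^ n * ?f (Suc k) mod (2 ^ n * 2 ^ k)"
      by (simp only: mult_mod_right)
    also have "\<dots> = 2 ^ n * (?f k mod 2 ^ k)"
      unfolding f by (simp only: mult_mod_right f)
        (simp add: res2_Suc power_add[symmetric] add.commute)
    finally show ?thesis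
      by simp
  qed
  note lim = res2_lim2[of ?f, OF this]
  have "x = 2 ^ n * lim2 ?f"
  proof (rule zz2_eqI)
    fix m
    have "res2 (2 ^ n * lim2 ?f) m = 2 ^ n * ?f m mod 2 ^ m"
      by (simp only: res2_mult lim res2_power_two) (simp add: mod_simps)
    also have "\<dots> = res2 x m"
      unfolding f by (simp add: res2_le)
    finally show "res2 x m = res2 (2 ^ n * lim2 ?f) m"
      by simp
  qed
  then show "2 ^ n dvd x"
    by (metis dvd_triv_left)
qed

lemma two_dvd_zz2_iff: "2 dvd (x :: zz2) \<longleftrightarrow> even (res2 x 1)"
  using two_power_dvd_zz2_iff[of 1 x] res2_mod[of x 1] by (simp add: even_iff_mod_2_eq_zero)

lemma two_dvd_add_zz2: "2 dvd (x + y :: zz2) \<longleftrightarrow> (2 dvd x \<longleftrightarrow> 2 dvd y)"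
  by (simp add: two_dvd_zz2_iff res2_add)

lemma two_dvd_diff_zz2: "2 dvd (x - y :: zz2) \<longleftrightarrow> (2 dvd x \<longleftrightarrow> 2 dvd y)"
  using two_dvd_add_zz2[of "x - y" y] by auto

lemma two_dvd_mult_zz2: "2 dvd (x * y :: zz2) \<longleftrightarrow> 2 dvd x \<or> 2 dvd y"
  by (simp add: two_dvd_zz2_iff res2_mult)

lemma two_dvd_of_nat_zz2 [simp]: "2 dvd (of_nat k :: zz2) \<longleftrightarrow> even k"
  using res2_of_int[of "int k" 1] by (simp add: two_dvd_zz2_iff)

lemma not_two_dvd_one_zz2 [simp]: "\<not> 2 dvd (1 :: zz2)"
  by (simp add: two_dvd_zz2_iff res2_one)

lemma two_neq_zero_zz2 [simp]: "(2 :: zz2) \<noteq> 0"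
proof
  assume "(2 :: zz2) = 0"
  then have "res2 2 2 = 0" by simp
  then show False
    using res2_of_int[of 2 2] by simp
qed

lemma zz2_eq_zeroI:
  assumes "\<And>n. 2 ^ n dvd (x :: zz2)"
  shows "x = 0"
  using assms by (intro zz2_eqI) (simp add: two_power_dvd_zz2_iff)

text \<open>Inverses of the residues modulo \<open>2 ^ n\<close> exist by coprimality, and they form
  a compatible sequence because an inverse modulo \<open>2 ^ n\<close> is unique.\<close>

lemma odd_zz2_unit:
  assumes "\<not> 2 dvd (x :: zz2)"
  shows "x dvd 1"
proof -
  have odd: "odd (res2 x (Suc n))" for n
    using assms res2_le[of 1 "Suc n" x] by (auto simp: two_dvd_zz2_iff)
  have "\<exists>z. [res2 x n * z = 1] (mod 2 ^ n)" for n
  proof (cases n)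
    case (Suc m)
    then show ?thesis
      using odd[of m] by (intro cong_solve_coprime_int) simp
  qed auto
  then obtain f where f: "\<And>n. [res2 x n * f n = 1] (mod 2 ^ n)"
    by metis
  have step: "f (Suc n) mod 2 ^ n = f n mod 2 ^ n" for n
  proof -
    have a: "[res2 x (Suc n) * f (Suc n) = 1] (mod 2 ^ n)"
      by (rule cong_dvd_modulus[OF f]) simp
    have b: "[res2 x (Suc n) = res2 x n] (mod 2 ^ n)"
      by (simp add: cong_def res2_Suc)
    have "[res2 x n * f (Suc n) = 1] (mod 2 ^ n)"
      using a cong_scalar_right[OF b, of "f (Suc n)"] cong_sym cong_trans by blast
    then have "[f n * (res2 x n * f (Suc n)) = f n * 1] (mod 2 ^ n)"
      by (rule cong_scalar_left)
    moreover have "[f (Suc n) * (res2 x n * f n) = f (Suc n) * 1] (mod 2 ^ n)"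
      using f by (rule cong_scalar_left)
    ultimately show ?thesis
      by (simp add: cong_def ac_simps)
  qed
  have "x * lim2 f = 1"
    using f by (intro zz2_eqI) (simp add: res2_mult res2_lim2[OF step] res2_one cong_def mod_simps)
  then show ?thesis
    by (metis dvd_triv_left)
qed

text \<open>Terms from the n-th on do not change the residue modulo \<open>2 ^ n\<close>, so the
  n-th partial sum supplies level n of the limit.\<close>

lemma zz2_complete: "\<exists>s :: zz2. \<forall>n. 2 ^ n dvd s - (\<Sum>k<n. 2 ^ k * a k)"
proof -
  let ?p = "\<lambda>n. \<Sum>k<n. 2 ^ k * a k"
  have "res2 (?p (Suc n)) (Suc n) mod 2 ^ n = res2 (?p n) n mod 2 ^ n" for n
    by (simp add: res2_Suc) (simp add: res2_add res2_mult res2_power_two)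
  note lim = res2_lim2[of "\<lambda>n. res2 (?p n) n", OF this]
  show ?thesis
    by (rule exI[of _ "lim2 (\<lambda>n. res2 (?p n) n)"])
      (simp add: two_power_dvd_zz2_iff res2_minus lim)
qed

section \<open>Lattices in coordinates\<close>

text \<open>The free module on I. The index set is a value and not a type, so it may depend on ranks
  obtained inside a proof, and all submodules live in one function space.\<close>

definition coords :: "'i set \<Rightarrow> ('i \<Rightarrow> zz2) set" where
  "coords I = {x. \<forall>i. i \<notin> I \<longrightarrow> x i = 0}"

definition scale2 :: "zz2 \<Rightarrow> ('i \<Rightarrow> zz2) \<Rightarrow> 'i \<Rightarrow> zz2" (infixr "*\<^sub>2" 75) where
  "a *\<^sub>2 x = (\<lambda>i. a * x i)"

definition even_vec :: "('i \<Rightarrow> zz2) \<Rightarrow> bool" where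
  "even_vec x \<longleftrightarrow> (\<forall>i. 2 dvd x i)"

text \<open>Determined by x when all entries are even, since 2 is not a zero divisor; an odd entry
  yields an arbitrary value.\<close>

definition half_vec :: "('i \<Rightarrow> zz2) \<Rightarrow> 'i \<Rightarrow> zz2" where
  "half_vec x = (\<lambda>i. SOME y. x i = 2 * y)"

lemma sum_fun_apply: "(\<Sum>k\<in>A. f k) i = (\<Sum>k\<in>A. f k i)"
  for f :: "'k \<Rightarrow> 'i \<Rightarrow> 'a::comm_monoid_add"
  by (induction A rule: infinite_finite_induct) auto

lemma scale2_apply [simp]: "(a *\<^sub>2 x) i = a * x i"
  by (simp add: scale2_def)

interpretation z2: Modules.module scale2
  by unfold_locales (auto simp: scale2_def fun_eq_iff algebra_simps)

lemma coords_subspace [simp]: "z2.subspace (coords I)"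
  by (auto simp: z2.subspace_def coords_def)

lemmas coords_zero [simp] = z2.subspace_0[OF coords_subspace]
  and coords_add [intro, simp] = z2.subspace_add[OF coords_subspace]
  and coords_diff [intro, simp] = z2.subspace_diff[OF coords_subspace]
  and coords_scale [intro, simp] = z2.subspace_scale[OF coords_subspace]
  and coords_sum [intro] = z2.subspace_sum[OF coords_subspace]

lemma even_subspace: "z2.subspace (Collect even_vec)"
  by (auto simp: z2.subspace_def even_vec_def)

lemma even_vec_zero [simp]: "even_vec 0"
  by (simp add: even_vec_def)

lemma even_vec_scale2_two [simp]: "even_vec (2 *\<^sub>2 x)"
  by (simp add: even_vec_def)

lemma scale2_half_vec: "even_vec x \<Longrightarrow> 2 *\<^sub>2 half_vec x = x"
  unfolding even_vec_def half_vec_def scale2_def dvd_def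
  by (rule ext) (metis (mono_tags, lifting) someI_ex)

lemma scale2_two_cancel [simp]: "2 *\<^sub>2 x = 2 *\<^sub>2 y \<longleftrightarrow> x = y"
  by (auto simp: scale2_def fun_eq_iff)

lemma half_vec_scale2_two [simp]: "half_vec (2 *\<^sub>2 x) = x"
  using scale2_half_vec[OF even_vec_scale2_two, of x] by simp

lemma half_vec_coords [intro]:
  assumes "even_vec x" "x \<in> coords I"
  shows "half_vec x \<in> coords I"
  unfolding coords_def
proof (intro CollectI allI impI)
  fix i
  assume "i \<notin> I"
  then have "2 * half_vec x i = 0"
    using fun_cong[OF scale2_half_vec[OF assms(1)], of i] assms(2) by (simp add: coords_def)
  then show "half_vec x i = 0"
    by simp
qed

lemma z2_complete_coords:
  assumes "\<And>k. a k \<in> coords I"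
  shows "\<exists>s \<in> coords I. \<forall>n i. 2 ^ n dvd (s - (\<Sum>k<n. 2 ^ k *\<^sub>2 a k)) i"
proof -
  have "\<exists>s :: zz2. \<forall>n. 2 ^ n dvd s - (\<Sum>k<n. 2 ^ k * a k i)" for i
    by (rule zz2_complete)
  then obtain s where s: "\<And>i n. 2 ^ n dvd s i - (\<Sum>k<n. 2 ^ k * a k i)"
    by metis
  have "s i = 0" if "i \<notin> I" for i
    using s[of _ i] assms that by (intro zz2_eq_zeroI) (simp add: coords_def)
  then show ?thesis
    using s by (intro bexI[of _ s]) (auto simp: coords_def sum_fun_apply)
qed

definition comb :: "'k set \<Rightarrow> ('k \<Rightarrow> 'i \<Rightarrow> zz2) \<Rightarrow> ('k \<Rightarrow> zz2) \<Rightarrow> 'i \<Rightarrow> zz2" where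
  "comb I e c = (\<Sum>k\<in>I. c k *\<^sub>2 e k)"

lemma comb_add: "comb I e (c + d) = comb I e c + comb I e d"
  by (simp add: comb_def z2.scale_left_distrib sum.distrib)

lemma comb_scale2: "comb I e (a *\<^sub>2 c) = a *\<^sub>2 comb I e c"
  by (simp add: comb_def z2.scale_sum_right)

lemma comb_diff: "comb I e (c - d) = comb I e c - comb I e d"
  by (simp add: comb_def z2.scale_left_diff_distrib sum_subtractf)

lemma comb_restrict: "comb I e (\<lambda>k. if k \<in> I then c k else 0) = comb I e c"
  by (simp add: comb_def)

lemma comb_in_subspace: "z2.subspace S \<Longrightarrow> (\<And>k. k \<in> I \<Longrightarrow> e k \<in> S) \<Longrightarrow> comb I e c \<in> S"
  unfolding comb_def by (intro z2.subspace_sum z2.subspace_scale) auto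

lemma dvd_comb:
  assumes "\<And>k. d dvd c k"
  shows "d dvd comb I e c i"
  using assms by (auto simp: comb_def sum_fun_apply intro!: dvd_sum)

text \<open>Nakayama's lemma: surjectivity uses that the coordinates converge 2-adically.\<close>

lemma comb_bij_of_basis_mod_two:
  assumes fin: "finite I" and e: "\<And>k. k \<in> I \<Longrightarrow> e k \<in> coords J"
    and gen: "\<And>y. y \<in> coords J \<Longrightarrow> \<exists>c. even_vec (y - comb I e c)"
    and indep: "\<And>c. c \<in> coords I \<Longrightarrow> even_vec (comb I e c) \<Longrightarrow> even_vec c"
  shows "bij_betw (comb I e) (coords I) (coords J)"
proof -
  have closed: "comb I e c \<in> coords J" for c
    using e by (intro comb_in_subspace) auto
  have "c = 0" if "c \<in> coords I" "comb I e c = 0" for c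
  proof -
    \<comment> \<open>A vector of the kernel is even by \<open>indep\<close>, and its half is again
      in the kernel because there is no 2-torsion; hence c is divisible by every power of 2.\<close>
    have "\<exists>d \<in> coords I. comb I e d = 0 \<and> c = 2 ^ n *\<^sub>2 d" for n
    proof (induction n)
      case 0
      then show ?case using that by (intro bexI[of _ c]) auto
    next
      case (Suc n)
      then obtain d where d: "d \<in> coords I" "comb I e d = 0" "c = 2 ^ n *\<^sub>2 d"
        by blast
      have ev: "even_vec d"
        using d by (intro indep) auto
      then have "2 *\<^sub>2 comb I e (half_vec d) = 2 *\<^sub>2 0"
        using d(2) by (simp add: comb_scale2[symmetric] scale2_half_vec)
      then have "comb I e (half_vec d) = 0"
        by (simp only: scale2_two_cancel)
      moreover have "c = 2 ^ n *\<^sub>2 2 *\<^sub>2 half_vec d"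
        using d(3) by (simp only: scale2_half_vec[OF ev])
      then have "c = 2 ^ Suc n *\<^sub>2 half_vec d"
        by (simp only: z2.scale_scale power_Suc2)
      ultimately show ?case
        using half_vec_coords[OF ev d(1)] by blast
    qed
    then have "2 ^ n dvd c i" for n i
    proof -
      from \<open>\<And>n. \<exists>d \<in> coords I. comb I e d = 0 \<and> c = 2 ^ n *\<^sub>2 d\<close>
      obtain d where "c = 2 ^ n *\<^sub>2 d"
        by blast
      then show ?thesis
        by simp
    qed
    then have "c i = 0" for i
      by (intro zz2_eq_zeroI)
    then show "c = 0"
      by (simp add: fun_eq_iff)
  qed
  note ker = this
  have inj: "inj_on (comb I e) (coords I)"
  proof (rule inj_onI)
    fix c d
    assume "c \<in> coords I" "d \<in> coords I" "comb I e c = comb I e d"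
    then show "c = d"
      using ker[of "c - d"] by (simp add: comb_diff)
  qed
  have "y \<in> comb I e ` coords I" if y: "y \<in> coords J" for y
  proof -
    obtain g where g: "\<And>y. y \<in> coords J \<Longrightarrow> even_vec (y - comb I e (g y))"
      using gen by metis
    \<comment> \<open>\<open>cf\<close> is the next 2-adic digit of the preimage, cut off to I, and
      \<open>nx\<close> is the remainder divided by 2; iterating \<open>nx\<close> produces the
      digits \<open>a n\<close>.\<close>
    define cf where "cf y = (\<lambda>k. if k \<in> I then g y k else 0)" for y
    define nx where "nx y = half_vec (y - comb I e (g y))" for y
    have nx: "nx y \<in> coords J" "y = comb I e (cf y) + 2 *\<^sub>2 nx y" if "y \<in> coords J" for y
      using g[OF that] closed that scale2_half_vec[OF g[OF that]]
      by (auto simp: nx_def cf_def comb_restrict intro!: half_vec_coords)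
    define z where "z n = (nx ^^ n) y" for n
    define a where "a n = cf (z n)" for n
    have z: "z n \<in> coords J" for n
      by (induction n) (auto simp: z_def y nx)
    have step: "z n = comb I e (a n) + 2 *\<^sub>2 z (Suc n)" for n
      using nx(2)[OF z[of n]] by (simp add: a_def z_def)
    have z0: "z 0 = y"
      by (simp add: z_def)
    have "y = comb I e (\<Sum>k<n. 2 ^ k *\<^sub>2 a k) + 2 ^ n *\<^sub>2 z n" for n
    proof (induction n)
      case 0
      show ?case by (simp add: comb_def z0)
    next
      case (Suc n)
      have "y = comb I e (\<Sum>k<n. 2 ^ k *\<^sub>2 a k) + 2 ^ n *\<^sub>2 (comb I e (a n) + 2 *\<^sub>2 z (Suc n))"
        by (subst step[symmetric]) (rule Suc.IH)
      also have "\<dots> = (comb I e (\<Sum>k<n. 2 ^ k *\<^sub>2 a k) + 2 ^ n *\<^sub>2 comb I e (a n)) + 2 ^ Suc n *\<^sub>2 z (Suc n)"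
        by (simp only: z2.scale_right_distrib z2.scale_scale power_Suc2 add.assoc)
      finally show ?case
        by (simp only: comb_add comb_scale2 sum.lessThan_Suc)
    qed
    note partial = this
    obtain s where s: "s \<in> coords I" "\<And>n i. 2 ^ n dvd (s - (\<Sum>k<n. 2 ^ k *\<^sub>2 a k)) i"
      using z2_complete_coords[of a I] by (auto simp: a_def cf_def coords_def)
    have "2 ^ n dvd (y - comb I e s) i" for n i
    proof -
      have "y - comb I e s = 2 ^ n *\<^sub>2 z n - comb I e (s - (\<Sum>k<n. 2 ^ k *\<^sub>2 a k))"
        using partial[of n] by (simp add: comb_diff)
      moreover have "2 ^ n dvd comb I e (s - (\<Sum>k<n. 2 ^ k *\<^sub>2 a k)) i"
        by (intro dvd_comb s(2))
      ultimately show ?thesis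
        by (simp only: minus_apply scale2_apply) (simp add: dvd_diff)
    qed
    then have "(y - comb I e s) i = 0" for i
      by (intro zz2_eq_zeroI)
    then have "y = comb I e s"
      by (auto simp: fun_eq_iff)
    then show ?thesis
      using s(1) by blast
  qed
  then show ?thesis
    using inj closed by (auto simp: bij_betw_def)
qed

section \<open>Bases modulo a submodule\<close>

no_notation set_add (infixl \<open><+>\<index>\<close> 60)

lemma comb_Plus:
  assumes "finite A" "finite B"
  shows "comb (A <+> B) e c = comb A (e \<circ> Inl) (c \<circ> Inl) + comb B (e \<circ> Inr) (c \<circ> Inr)"
  using assms by (simp add: comb_def sum.Plus)

lemma comb_Times:
  assumes "finite B"
  shows "comb ({..<n} \<times> B) e c = (\<Sum>i<n. comb B (\<lambda>k. e (i, k)) (\<lambda>k. c (i, k)))"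
  by (simp add: comb_def sum.cartesian_product)

lemma comb_bool: "comb UNIV e c = c False *\<^sub>2 e False + c True *\<^sub>2 e True"
  by (simp add: comb_def UNIV_bool add.commute)

lemma span_comb:
  assumes "finite X" "z2.subspace U" "y \<in> z2.span (X \<union> U)"
  shows "\<exists>c. y - (\<Sum>x\<in>X. c x *\<^sub>2 x) \<in> U"
proof -
  obtain s u where "y = s + u" "s \<in> z2.span X" "u \<in> U"
    using assms(2,3) by (auto simp: z2.span_Un z2.span_eq_iff[THEN iffD2])
  moreover obtain c where "s = (\<Sum>x\<in>X. c x *\<^sub>2 x)"
    using \<open>s \<in> z2.span X\<close> assms(1) by (auto simp: z2.span_finite)
  ultimately show ?thesis
    by (intro exI[of _ c]) simp
qed

text \<open>A vector of \<open>coords J\<close> is determined modulo 2 by the set of its odd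
  coordinates, and the finite set J has finitely many subsets. The representatives are chosen inside
  T, so that they generate T modulo its even vectors.\<close>

lemma parity_representatives:
  assumes "finite J" "T \<subseteq> coords J"
  shows "\<exists>X\<subseteq>T. finite X \<and> (\<forall>t\<in>T. \<exists>x\<in>X. even_vec (t - x))"
proof -
  let ?odd = "\<lambda>t :: 'a \<Rightarrow> zz2. {i \<in> J. \<not> 2 dvd t i}"
  let ?g = "inv_into T ?odd"
  have "finite (?odd ` T)"
    by (rule finite_subset[of _ "Pow J"]) (auto simp: assms(1))
  moreover have "even_vec (t - ?g (?odd t))" if t: "t \<in> T" for t
  proof -
    have im: "?odd t \<in> ?odd ` T"
      using t by (rule imageI)
    have g: "?g (?odd t) \<in> T" "?odd (?g (?odd t)) = ?odd t"
      by (rule inv_into_into[OF im], rule f_inv_into_f[OF im])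
    have "2 dvd t i \<longleftrightarrow> 2 dvd ?g (?odd t) i" for i
    proof (cases "i \<in> J")
      case True
      then show ?thesis using g(2) by blast
    next
      case False
      then have "t i = 0" "?g (?odd t) i = 0"
        using assms(2) t g(1) unfolding coords_def by blast+
      then show ?thesis by simp
    qed
    then show ?thesis
      unfolding even_vec_def minus_apply two_dvd_diff_zz2 by blast
  qed
  moreover have "?g ` (?odd ` T) \<subseteq> T"
    by (auto intro!: inv_into_into)
  ultimately show ?thesis
    by (intro exI[of _ "?g ` (?odd ` T)"]) blast
qed

text \<open>Replaces the choice of a basis in a quotient: a subset of least cardinality with P loses
  P when any element is removed.\<close>

lemma minimal_subset:
  assumes "finite X\<^sub>0" "P X\<^sub>0"
  shows "\<exists>X\<subseteq>X\<^sub>0. P X \<and> (\<forall>x\<in>X. \<not> P (X - {x}))"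
proof -
  obtain X where X: "X \<subseteq> X\<^sub>0" "P X" and min: "\<And>Y. Y \<subseteq> X\<^sub>0 \<Longrightarrow> P Y \<Longrightarrow> card X \<le> card Y"
    using ex_has_least_nat[of "\<lambda>X. X \<subseteq> X\<^sub>0 \<and> P X" X\<^sub>0 card] assms(2) by auto
  have "\<not> P (X - {x})" if "x \<in> X" for x
  proof
    assume "P (X - {x})"
    then have "card X \<le> card (X - {x})"
      using X(1) by (intro min) auto
    moreover have "finite X"
      using X(1) assms(1) finite_subset by blast
    ultimately show False
      using card_Diff1_less[OF _ that] by simp
  qed
  then show ?thesis
    using X by blast
qed

text \<open>A minimal generating set modulo \<open>U\<close> is independent modulo 2, because odd coefficients
  are units.\<close>

lemma basis_mod_subspace:
  assumes "finite J" "T \<subseteq> coords J" and T: "z2.subspace T" and U: "z2.subspace U"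
    and even: "T \<inter> {x. even_vec x} \<subseteq> U"
  shows "\<exists>n (x :: nat \<Rightarrow> 'i \<Rightarrow> zz2). (\<forall>i<n. x i \<in> T) \<and>
    (\<forall>y\<in>T. \<exists>c. y - comb {..<n} x c \<in> U) \<and>
    (\<forall>c. comb {..<n} x c \<in> U \<longrightarrow> (\<forall>i<n. 2 dvd c i))"
proof -
  obtain X\<^sub>0 where X\<^sub>0: "X\<^sub>0 \<subseteq> T" "finite X\<^sub>0" "\<And>t. t \<in> T \<Longrightarrow> \<exists>x\<in>X\<^sub>0. even_vec (t - x)"
    using parity_representatives[OF assms(1,2)] by blast
  have "T \<subseteq> z2.span (X\<^sub>0 \<union> U)"
  proof
    fix t assume t: "t \<in> T"
    then obtain x where x: "x \<in> X\<^sub>0" "even_vec (t - x)"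
      using X\<^sub>0(3) by blast
    then have "t - x \<in> U"
      using X\<^sub>0(1) t even by (auto intro: z2.subspace_diff[OF T])
    then have "x + (t - x) \<in> z2.span (X\<^sub>0 \<union> U)"
      using x(1) by (intro z2.span_add) (auto intro: z2.span_base)
    then show "t \<in> z2.span (X\<^sub>0 \<union> U)"
      by simp
  qed
  then obtain X where X: "X \<subseteq> X\<^sub>0" "T \<subseteq> z2.span (X \<union> U)"
    and min: "\<And>x. x \<in> X \<Longrightarrow> \<not> T \<subseteq> z2.span ((X - {x}) \<union> U)"
    using minimal_subset[OF X\<^sub>0(2), of "\<lambda>X. T \<subseteq> z2.span (X \<union> U)"] by blast
  have fin: "finite X"
    using X(1) X\<^sub>0(2) finite_subset by blast
  have indep: "2 dvd c x" if "(\<Sum>x\<in>X. c x *\<^sub>2 x) \<in> U" "x \<in> X" for c x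
  proof (rule ccontr)
    assume "\<not> 2 dvd c x"
    then obtain b where b: "b * c x = 1"
      using odd_zz2_unit by (metis dvdE mult.commute)
    let ?S = "z2.span ((X - {x}) \<union> U)"
    have "(\<Sum>x\<in>X. c x *\<^sub>2 x) \<in> ?S"
      using that(1) by (auto intro: z2.span_base)
    moreover have "(\<Sum>x\<in>X - {x}. c x *\<^sub>2 x) \<in> ?S"
      by (intro z2.span_sum z2.span_scale) (auto intro: z2.span_base)
    ultimately have "(\<Sum>x\<in>X. c x *\<^sub>2 x) - (\<Sum>x\<in>X - {x}. c x *\<^sub>2 x) \<in> ?S"
      by (rule z2.span_diff)
    then have "b *\<^sub>2 c x *\<^sub>2 x \<in> ?S"
      using that(2) fin by (intro z2.span_scale[of "c x *\<^sub>2 x"]) (simp add: sum.remove)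
    then have "x \<in> ?S"
      using b by (simp only: z2.scale_scale z2.scale_one)
    then have "X \<union> U \<subseteq> ?S"
      by (auto intro: z2.span_base)
    then have "z2.span (X \<union> U) \<subseteq> ?S"
      by (intro z2.span_minimal) auto
    then show False
      using X(2) min[OF that(2)] by blast
  qed
  obtain h where h: "bij_betw h {..<card X} X"
    using fin by (metis bij_betw_iff_card card_lessThan finite_lessThan)
  show ?thesis
  proof (intro exI[of _ "card X"] exI[of _ h] conjI allI impI ballI)
    show "h i \<in> T" if "i < card X" for i
      using h that X(1) X\<^sub>0(1) bij_betwE by fastforce
    show "\<exists>c. y - comb {..<card X} h c \<in> U" if "y \<in> T" for y
    proof -
      obtain c where "y - (\<Sum>x\<in>X. c x *\<^sub>2 x) \<in> U"
        using span_comb[OF fin U, of y] X(2) \<open>y \<in> T\<close> by blast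
      then show ?thesis
        using sum.reindex_bij_betw[OF h, of "\<lambda>x. c x *\<^sub>2 x"]
        by (intro exI[of _ "c \<circ> h"]) (simp add: comb_def)
    qed
    show "2 dvd c i" if c: "comb {..<card X} h c \<in> U" and i: "i < card X" for c i
    proof -
      let ?c = "\<lambda>x. c (inv_into {..<card X} h x)"
      have inv: "inv_into {..<card X} h (h k) = k" if "k < card X" for k
        using h that by (simp add: bij_betw_def)
      have "comb {..<card X} h c = (\<Sum>k<card X. ?c (h k) *\<^sub>2 h k)"
        unfolding comb_def by (intro sum.cong) (auto simp: inv)
      also have "\<dots> = (\<Sum>x\<in>X. ?c x *\<^sub>2 x)"
        by (rule sum.reindex_bij_betw[OF h])
      finally have "(\<Sum>x\<in>X. ?c x *\<^sub>2 x) \<in> U"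
        using c by simp
      from indep[OF this, of "h i"] show "2 dvd c i"
        using i h by (auto simp: inv dest: bij_betwE)
    qed
  qed
qed

text \<open>The same over \<open>\<int>\<^sub>2[a]\<close> with \<open>a\<^sup>2 + a + q = 0\<close> and \<open>q\<close> odd: \<open>c + d a\<close> is a unit unless
  \<open>c\<close> and \<open>d\<close> are both even, since its norm \<open>c\<^sup>2 - c d + q d\<^sup>2\<close> is odd.\<close>

lemma basis_mod_subspace_quadratic:
  fixes a :: "('i \<Rightarrow> zz2) \<Rightarrow> 'i \<Rightarrow> zz2"
  assumes "finite J" "T \<subseteq> coords J" and T: "z2.subspace T" and U: "z2.subspace U"
    and even: "T \<inter> {x. even_vec x} \<subseteq> U" and "U \<subseteq> T"
    and a_T: "\<And>x. x \<in> T \<Longrightarrow> a x \<in> T" and a_U: "\<And>x. x \<in> U \<Longrightarrow> a x \<in> U"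
    and a_add: "\<And>x y. x \<in> T \<Longrightarrow> y \<in> T \<Longrightarrow> a (x + y) = a x + a y"
    and a_scale: "\<And>c x. x \<in> T \<Longrightarrow> a (c *\<^sub>2 x) = c *\<^sub>2 a x"
    and a_a: "\<And>x. x \<in> T \<Longrightarrow> a (a x) = - a x - q *\<^sub>2 x"
    and q: "\<not> 2 dvd q"
  shows "\<exists>n (x :: nat \<Rightarrow> 'i \<Rightarrow> zz2). (\<forall>i<n. x i \<in> T) \<and>
    (\<forall>y\<in>T. \<exists>c. y - comb ({..<n} \<times> UNIV) (\<lambda>(i, b). if b then a (x i) else x i) c \<in> U) \<and>
    (\<forall>c. comb ({..<n} \<times> UNIV) (\<lambda>(i, b). if b then a (x i) else x i) c \<in> U \<longrightarrow>
      (\<forall>k\<in>{..<n} \<times> UNIV. 2 dvd c k))"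
proof -
  \<comment> \<open>For X inside T this is U plus the Z_2[a]-submodule generated by X: higher powers
    of a reduce to the first by the quadratic relation.\<close>
  define gs where "gs X = z2.span ((X \<union> a ` X) \<union> U)" for X
  obtain X\<^sub>0 where X\<^sub>0: "X\<^sub>0 \<subseteq> T" "finite X\<^sub>0" "\<And>t. t \<in> T \<Longrightarrow> \<exists>x\<in>X\<^sub>0. even_vec (t - x)"
    using parity_representatives[OF assms(1,2)] by blast
  have "T \<subseteq> gs X\<^sub>0"
  proof
    fix t assume t: "t \<in> T"
    then obtain x where x: "x \<in> X\<^sub>0" "even_vec (t - x)"
      using X\<^sub>0(3) by blast
    then have "t - x \<in> U"
      using X\<^sub>0(1) t even by (auto intro: z2.subspace_diff[OF T])
    then have "x + (t - x) \<in> gs X\<^sub>0"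
      using x(1) unfolding gs_def by (intro z2.span_add) (auto intro: z2.span_base)
    then show "t \<in> gs X\<^sub>0"
      by simp
  qed
  then obtain X where X: "X \<subseteq> X\<^sub>0" "T \<subseteq> gs X"
    and min: "\<And>x. x \<in> X \<Longrightarrow> \<not> T \<subseteq> gs (X - {x})"
    using minimal_subset[OF X\<^sub>0(2), of "\<lambda>X. T \<subseteq> gs X"] by blast
  have fin: "finite X" and XT: "X \<subseteq> T"
    using X(1) X\<^sub>0(1,2) finite_subset by blast+
  have indep: "2 dvd c x \<and> 2 dvd d x"
    if sum: "(\<Sum>x\<in>X. c x *\<^sub>2 x + d x *\<^sub>2 a x) \<in> U" and x: "x \<in> X" for c d x
  proof (rule ccontr)
    assume odd: "\<not> (2 dvd c x \<and> 2 dvd d x)"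
    define N where "N = c x * c x - c x * d x + q * (d x * d x)"
    \<comment> \<open>Modulo 2 the norm is c^2 + c d + d^2, which has no nontrivial zero over the
      field with two elements.\<close>
    have "\<not> 2 dvd N"
      using odd q by (auto simp: N_def two_dvd_add_zz2 two_dvd_diff_zz2 two_dvd_mult_zz2)
    then obtain b where b: "b * N = 1"
      using odd_zz2_unit by (metis dvdE mult.commute)
    let ?S = "gs (X - {x})"
    have S: "z2.subspace ?S"
      by (simp add: gs_def)
    have base: "(X - {x}) \<union> a ` (X - {x}) \<union> U \<subseteq> ?S"
      unfolding gs_def by (rule z2.span_superset)
    have ST: "?S \<subseteq> T"
      unfolding gs_def using XT \<open>U \<subseteq> T\<close> T by (intro z2.span_minimal) (auto intro: a_T)
    have "?S \<subseteq> {y \<in> T. a y \<in> ?S}"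
      unfolding gs_def[of "X - {x}"]
    proof (rule z2.span_minimal, unfold gs_def[symmetric])
      show "(X - {x}) \<union> a ` (X - {x}) \<union> U \<subseteq> {y \<in> T. a y \<in> ?S}"
      proof
        fix y assume "y \<in> (X - {x}) \<union> a ` (X - {x}) \<union> U"
        then consider "y \<in> X - {x}" | z where "z \<in> X - {x}" "y = a z" | "y \<in> U"
          by blast
        then show "y \<in> {y \<in> T. a y \<in> ?S}"
        proof cases
          case 1
          then show ?thesis using base XT by auto
        next
          case 2
          then have "- a z \<in> ?S" "q *\<^sub>2 z \<in> ?S"
            using base S by (auto intro!: z2.subspace_neg z2.subspace_scale)
          then have "- a z - q *\<^sub>2 z \<in> ?S"
            by (rule z2.subspace_diff[OF S])
          then show ?thesis using 2 XT a_a[of z] a_T[of z] by auto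
        next
          case 3
          then show ?thesis using base \<open>U \<subseteq> T\<close> a_U by auto
        qed
      qed
      have "a 0 = 0"
        using a_scale[of 0 0] z2.subspace_0[OF T] by simp
      then show "z2.subspace {y \<in> T. a y \<in> ?S}"
        using T S by (auto simp: z2.subspace_def a_add a_scale)
    qed
    then have aS: "a y \<in> ?S" if "y \<in> ?S" for y
      using that by blast
    define w where "w = c x *\<^sub>2 x + d x *\<^sub>2 a x"
    have "w = (\<Sum>x\<in>X. c x *\<^sub>2 x + d x *\<^sub>2 a x) - (\<Sum>x\<in>X - {x}. c x *\<^sub>2 x + d x *\<^sub>2 a x)"
      using fin x by (simp add: w_def sum.remove)
    moreover have "(\<Sum>x\<in>X - {x}. c x *\<^sub>2 x + d x *\<^sub>2 a x) \<in> ?S"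
      using base S by (intro z2.subspace_sum z2.subspace_add z2.subspace_scale) auto
    ultimately have w: "w \<in> ?S"
      using sum base S by (auto intro!: z2.subspace_diff)
    \<comment> \<open>Here w = (c + d a) x is multiplied by the conjugate c - d - d a, where - 1 - a
      is the conjugate of a; the result is the norm times x.\<close>
    have "(c x - d x) *\<^sub>2 w - d x *\<^sub>2 a w \<in> ?S"
      using S w aS by (intro z2.subspace_diff z2.subspace_scale) auto
    moreover have "(c x - d x) *\<^sub>2 w - d x *\<^sub>2 a w = N *\<^sub>2 x"
    proof -
      have aw: "a w = c x *\<^sub>2 a x + d x *\<^sub>2 (- a x - q *\<^sub>2 x)"
        using x XT T by (auto simp: w_def a_add a_scale a_a a_T z2.subspace_scale)
      show ?thesis
        unfolding aw by (simp add: w_def N_def fun_eq_iff algebra_simps)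
    qed
    ultimately have "b *\<^sub>2 N *\<^sub>2 x \<in> ?S"
      using S z2.subspace_scale by metis
    then have xS: "x \<in> ?S"
      using b by (simp only: z2.scale_scale z2.scale_one)
    then have "X \<union> a ` X \<union> U \<subseteq> ?S"
      using base aS by auto
    then have "gs X \<subseteq> ?S"
      unfolding gs_def[of X] using S by (intro z2.span_minimal)
    then show False
      using X(2) min[OF x] by blast
  qed
  obtain h where h: "bij_betw h {..<card X} X"
    using fin by (metis bij_betw_iff_card card_lessThan finite_lessThan)
  let ?e = "\<lambda>(i, b). if b then a (h i) else h i"
  have comb: "comb ({..<card X} \<times> UNIV) ?e c =
    (\<Sum>i<card X. c (i, False) *\<^sub>2 h i + c (i, True) *\<^sub>2 a (h i))" for c
    by (simp add: comb_Times comb_bool)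
  have hX: "h i \<in> X" if "i < card X" for i
    using h that bij_betwE by fastforce
  show ?thesis
  proof (intro exI[of _ "card X"] exI[of _ h] conjI allI impI ballI)
    show "h i \<in> T" if "i < card X" for i
      using hX[OF that] XT by blast
    show "\<exists>c. y - comb ({..<card X} \<times> UNIV) ?e c \<in> U" if "y \<in> T" for y
    proof -
      obtain s s' u where "y = s + s' + u" "s \<in> z2.span X" "s' \<in> z2.span (a ` X)" "u \<in> U"
      proof -
        have "y \<in> z2.span (X \<union> a ` X \<union> U)"
          using X(2) \<open>y \<in> T\<close> by (auto simp: gs_def)
        then show thesis
          using that U unfolding z2.span_Un by (auto simp: z2.span_eq_iff[THEN iffD2])
      qed
      moreover obtain c where "s = (\<Sum>x\<in>X. c x *\<^sub>2 x)"
        using \<open>s \<in> z2.span X\<close> fin by (auto simp: z2.span_finite)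
      \<comment> \<open>The combinations are indexed by X and not by its image, since a might
        identify elements of X.\<close>
      moreover have "\<exists>d. s' = (\<Sum>x\<in>X. d x *\<^sub>2 a x)"
      proof -
        have "z2.span (a ` X) \<subseteq> range (\<lambda>d. \<Sum>x\<in>X. d x *\<^sub>2 a x)"
        proof (rule z2.span_minimal)
          show "a ` X \<subseteq> range (\<lambda>d. \<Sum>x\<in>X. d x *\<^sub>2 a x)"
          proof
            fix y assume "y \<in> a ` X"
            then obtain x where "x \<in> X" "y = a x" by blast
            then have "y = (\<Sum>z\<in>X. (if z = x then 1 else 0) *\<^sub>2 a z)"
              using fin by (simp add: if_distrib[of "\<lambda>c. c *\<^sub>2 _"] sum.delta cong: if_cong)
            then show "y \<in> range (\<lambda>d. \<Sum>x\<in>X. d x *\<^sub>2 a x)"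
              by (rule range_eqI[of _ _ "\<lambda>z. if z = x then 1 else 0"])
          qed
          show "z2.subspace (range (\<lambda>d. \<Sum>x\<in>X. d x *\<^sub>2 a x))"
            unfolding z2.subspace_def
          proof (intro conjI ballI allI)
            show "0 \<in> range (\<lambda>d. \<Sum>x\<in>X. d x *\<^sub>2 a x)"
              by (intro range_eqI[of _ _ "\<lambda>_. 0"]) simp
          next
            fix f g assume "f \<in> range (\<lambda>d. \<Sum>x\<in>X. d x *\<^sub>2 a x)" "g \<in> range (\<lambda>d. \<Sum>x\<in>X. d x *\<^sub>2 a x)"
            then obtain d d' where "f = (\<Sum>x\<in>X. d x *\<^sub>2 a x)" "g = (\<Sum>x\<in>X. d' x *\<^sub>2 a x)"
              by blast
            then show "f + g \<in> range (\<lambda>d. \<Sum>x\<in>X. d x *\<^sub>2 a x)"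
              by (intro range_eqI[of _ _ "\<lambda>x. d x + d' x"])
                (simp add: z2.scale_left_distrib sum.distrib)
          next
            fix b f assume "f \<in> range (\<lambda>d. \<Sum>x\<in>X. d x *\<^sub>2 a x)"
            then obtain d where "f = (\<Sum>x\<in>X. d x *\<^sub>2 a x)"
              by blast
            then show "b *\<^sub>2 f \<in> range (\<lambda>d. \<Sum>x\<in>X. d x *\<^sub>2 a x)"
              by (intro range_eqI[of _ _ "\<lambda>x. b * d x"]) (simp add: z2.scale_sum_right)
          qed
        qed
        then show ?thesis
          using \<open>s' \<in> z2.span (a ` X)\<close> by blast
      qed
      then obtain d where "s' = (\<Sum>x\<in>X. d x *\<^sub>2 a x)"
        by blast
      ultimately have "y - (\<Sum>x\<in>X. c x *\<^sub>2 x + d x *\<^sub>2 a x) \<in> U"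
        by (simp add: sum.distrib)
      then show ?thesis
        using sum.reindex_bij_betw[OF h, of "\<lambda>x. c x *\<^sub>2 x + d x *\<^sub>2 a x"]
        by (intro exI[of _ "\<lambda>(i, b). if b then d (h i) else c (h i)"]) (simp add: comb)
    qed
    show "2 dvd c k" if c: "comb ({..<card X} \<times> UNIV) ?e c \<in> U"
      and k: "k \<in> {..<card X} \<times> UNIV" for c k
    proof -
      let ?h = "inv_into {..<card X} h"
      have inv: "?h (h k) = k" if "k < card X" for k
        using h that by (simp add: bij_betw_def)
      have "comb ({..<card X} \<times> UNIV) ?e c =
        (\<Sum>k<card X. c (?h (h k), False) *\<^sub>2 h k + c (?h (h k), True) *\<^sub>2 a (h k))"
        unfolding comb by (intro sum.cong) (auto simp: inv)
      also have "\<dots> = (\<Sum>x\<in>X. c (?h x, False) *\<^sub>2 x + c (?h x, True) *\<^sub>2 a x)"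
        by (rule sum.reindex_bij_betw[OF h])
      finally have "(\<Sum>x\<in>X. c (?h x, False) *\<^sub>2 x + c (?h x, True) *\<^sub>2 a x) \<in> U"
        using c by simp
      from indep[OF this, of "h (fst k)"] show "2 dvd c k"
        using k hX by (cases k; cases "snd k") (auto simp: inv)
    qed
  qed
qed

section \<open>Existence of the decomposition\<close>

text \<open>R is generated over Z_2 by \<omega>, so additivity, homogeneity over Z_2 and commutation
  with the operators amount to R-linearity.\<close>

definition lattice_iso :: "'i set \<Rightarrow> (('i \<Rightarrow> zz2) \<Rightarrow> 'i \<Rightarrow> zz2) \<Rightarrow>
    'j set \<Rightarrow> (('j \<Rightarrow> zz2) \<Rightarrow> 'j \<Rightarrow> zz2) \<Rightarrow> (('i \<Rightarrow> zz2) \<Rightarrow> 'j \<Rightarrow> zz2) \<Rightarrow> bool" where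
  "lattice_iso I w J v \<Phi> \<longleftrightarrow> bij_betw \<Phi> (coords I) (coords J) \<and>
     (\<forall>x\<in>coords I. \<forall>y\<in>coords I. \<Phi> (x + y) = \<Phi> x + \<Phi> y) \<and>
     (\<forall>a. \<forall>x\<in>coords I. \<Phi> (a *\<^sub>2 x) = a *\<^sub>2 \<Phi> x) \<and>
     (\<forall>x\<in>coords I. \<Phi> (w x) = v (\<Phi> x))"

definition omega_kernel :: "'i set \<Rightarrow> (('i \<Rightarrow> zz2) \<Rightarrow> 'i \<Rightarrow> zz2) \<Rightarrow> ('i \<Rightarrow> zz2) set" where
  "omega_kernel J v = {x \<in> coords J. even_vec (v x)}"

definition omega_image :: "'i set \<Rightarrow> (('i \<Rightarrow> zz2) \<Rightarrow> 'i \<Rightarrow> zz2) \<Rightarrow> ('i \<Rightarrow> zz2) set" where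
  "omega_image J v = {x \<in> coords J. \<exists>y\<in>coords J. even_vec (x - v y)}"

definition omega_eigen :: "'i set \<Rightarrow> (('i \<Rightarrow> zz2) \<Rightarrow> 'i \<Rightarrow> zz2) \<Rightarrow> zz2 \<Rightarrow> ('i \<Rightarrow> zz2) set" where
  "omega_eigen J v a = {x \<in> coords J. v x = (2 * a) *\<^sub>2 x}"

definition omega_image_eigen :: "'i set \<Rightarrow> (('i \<Rightarrow> zz2) \<Rightarrow> 'i \<Rightarrow> zz2) \<Rightarrow> zz2 \<Rightarrow> ('i \<Rightarrow> zz2) set" where
  "omega_image_eigen J v a = {x \<in> coords J. \<exists>z\<in>omega_eigen J v a. x - z \<in> omega_image J v}"

text \<open>The action of \<open>\<omega>\<close> on \<open>R\<close> in the basis \<open>1, \<omega>\<close>, on \<open>O\<^sub>E\<close> in the basis \<open>1, \<alpha>\<close>,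
  and on \<open>R / (\<omega> - 2 a)\<close> in the basis \<open>1\<close>; here \<open>q = (p + 1) / 4\<close>.\<close>

definition R_op :: "zz2 \<Rightarrow> (bool \<Rightarrow> zz2) \<Rightarrow> bool \<Rightarrow> zz2" where
  "R_op q c = (\<lambda>b. if b then c False - 2 * c True else - 4 * q * c True)"

definition O_op :: "zz2 \<Rightarrow> (bool \<Rightarrow> zz2) \<Rightarrow> bool \<Rightarrow> zz2" where
  "O_op q c = (\<lambda>b. if b then 2 * c False - 2 * c True else - 2 * q * c True)"

definition scalar_op :: "zz2 \<Rightarrow> (unit \<Rightarrow> zz2) \<Rightarrow> unit \<Rightarrow> zz2" where
  "scalar_op a c = (2 * a) *\<^sub>2 c"

definition pow_op :: "(('i \<Rightarrow> zz2) \<Rightarrow> 'i \<Rightarrow> zz2) \<Rightarrow> (nat \<times> 'i \<Rightarrow> zz2) \<Rightarrow> nat \<times> 'i \<Rightarrow> zz2" where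
  "pow_op w c = (\<lambda>(n, i). w (\<lambda>j. c (n, j)) i)"

definition sum_op :: "(('i \<Rightarrow> zz2) \<Rightarrow> 'i \<Rightarrow> zz2) \<Rightarrow> (('j \<Rightarrow> zz2) \<Rightarrow> 'j \<Rightarrow> zz2) \<Rightarrow>
    ('i + 'j \<Rightarrow> zz2) \<Rightarrow> 'i + 'j \<Rightarrow> zz2" where
  "sum_op w w' c = case_sum (w (c \<circ> Inl)) (w' (c \<circ> Inr))"

text \<open>An R-module structure on the free module over J: v is multiplication by \<omega>, and
  \<open>v_v\<close> is the equation \<omega>^2 + 2 \<omega> + (p + 1) = 0 with p + 1 = 4 q.\<close>

locale quad_lattice =
  fixes J :: "'i set" and v :: "('i \<Rightarrow> zz2) \<Rightarrow> 'i \<Rightarrow> zz2" and q :: zz2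
  assumes finite_J: "finite J"
    and v_closed [simp]: "x \<in> coords J \<Longrightarrow> v x \<in> coords J"
    and v_add: "x \<in> coords J \<Longrightarrow> y \<in> coords J \<Longrightarrow> v (x + y) = v x + v y"
    and v_scale: "x \<in> coords J \<Longrightarrow> v (a *\<^sub>2 x) = a *\<^sub>2 v x"
    and v_v: "x \<in> coords J \<Longrightarrow> v (v x) = - (2 *\<^sub>2 v x) - (4 * q) *\<^sub>2 x"
begin

lemma v_zero: "v 0 = 0"
  using v_scale[of 0 0] by simp

lemma v_diff: "x \<in> coords J \<Longrightarrow> y \<in> coords J \<Longrightarrow> v (x - y) = v x - v y"
  using v_add[of "x - y" y] by simp

lemma v_sum: "(\<And>i. i \<in> N \<Longrightarrow> f i \<in> coords J) \<Longrightarrow> v (\<Sum>i\<in>N. f i) = (\<Sum>i\<in>N. v (f i))"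
proof (induction N rule: infinite_finite_induct)
  case (insert i N)
  then have "(\<Sum>i\<in>N. f i) \<in> coords J"
    by (intro coords_sum) auto
  then have "v (f i + (\<Sum>j\<in>N. f j)) = v (f i) + v (\<Sum>j\<in>N. f j)"
    using insert.prems by (intro v_add) auto
  also have "v (\<Sum>j\<in>N. f j) = (\<Sum>j\<in>N. v (f j))"
    using insert by blast
  finally show ?case
    by (simp only: sum.insert[OF insert.hyps])
qed (simp_all add: v_zero)

lemma v_v_even: "x \<in> coords J \<Longrightarrow> v (v x) = 2 *\<^sub>2 (- v x - (2 * q) *\<^sub>2 x)"
  unfolding v_v by (simp add: fun_eq_iff algebra_simps)

section \<open>The submodules K and D and the operator \<alpha> on K\<close>

abbreviation "K \<equiv> omega_kernel J v"
abbreviation "D \<equiv> omega_image J v"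
abbreviation "eigen \<equiv> omega_eigen J v"

lemma K_subspace: "z2.subspace K"
  using z2.subspace_add[OF even_subspace] z2.subspace_scale[OF even_subspace]
  by (auto simp: z2.subspace_def omega_kernel_def v_zero v_add v_scale)

lemma D_subspace: "z2.subspace D"
  unfolding z2.subspace_def
proof (intro conjI ballI allI)
  show "0 \<in> D"
    by (auto simp: omega_image_def intro!: bexI[of _ 0] simp: v_zero)
next
  fix x y assume "x \<in> D" "y \<in> D"
  then obtain x' y' where "x \<in> coords J" "y \<in> coords J" "x' \<in> coords J" "y' \<in> coords J"
    and ev: "even_vec (x - v x')" "even_vec (y - v y')"
    unfolding omega_image_def by blast
  moreover have "even_vec ((x - v x') + (y - v y'))"
    using z2.subspace_add[OF even_subspace] ev by blast
  ultimately show "x + y \<in> D"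
    unfolding omega_image_def
    by (auto simp: v_add algebra_simps intro!: bexI[of _ "x' + y'"])
next
  fix c x assume "x \<in> D"
  then obtain x' where "x \<in> coords J" "x' \<in> coords J" and ev: "even_vec (x - v x')"
    unfolding omega_image_def by blast
  moreover have "even_vec (c *\<^sub>2 (x - v x'))"
    using z2.subspace_scale[OF even_subspace] ev by blast
  ultimately show "c *\<^sub>2 x \<in> D"
    unfolding omega_image_def
    by (auto simp: v_scale z2.scale_right_diff_distrib intro!: bexI[of _ "c *\<^sub>2 x'"])
qed

lemma even_in_D: "x \<in> coords J \<Longrightarrow> even_vec x \<Longrightarrow> x \<in> D"
  by (auto simp: omega_image_def v_zero intro!: bexI[of _ 0])

lemma even_in_K: "x \<in> coords J \<Longrightarrow> even_vec x \<Longrightarrow> x \<in> K"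
  using v_scale[of "half_vec x" 2] half_vec_coords[of x J]
  by (simp add: omega_kernel_def scale2_half_vec)

text \<open>The quadratic relation makes \<omega>^2 divisible by 2, so \<omega> maps both \<omega> L
  and 2 L into 2 L.\<close>

lemma D_subset_K: "D \<subseteq> K"
proof
  fix x assume "x \<in> D"
  then obtain y where y: "x \<in> coords J" "y \<in> coords J" "even_vec (x - v y)"
    unfolding omega_image_def by blast
  then have "x - v y \<in> K"
    by (intro even_in_K) auto
  moreover have "v y \<in> K"
    using y(2) by (simp only: omega_kernel_def v_v_even mem_Collect_eq even_vec_scale2_two v_closed simp_thms)
  ultimately have "(x - v y) + v y \<in> K"
    by (rule z2.subspace_add[OF K_subspace])
  then show "x \<in> K"
    by simp
qed

text \<open>The operator \<alpha> = \<omega> / 2, meaningful on K, where \<omega> x is even.\<close>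

definition al :: "('i \<Rightarrow> zz2) \<Rightarrow> 'i \<Rightarrow> zz2" where
  "al x = half_vec (v x)"

lemma K_coords: "x \<in> K \<Longrightarrow> x \<in> coords J"
  by (simp add: omega_kernel_def)

lemma two_al: "x \<in> K \<Longrightarrow> 2 *\<^sub>2 al x = v x"
  by (simp add: al_def omega_kernel_def scale2_half_vec)

lemma al_coords: "x \<in> K \<Longrightarrow> al x \<in> coords J"
  by (simp add: al_def omega_kernel_def half_vec_coords)

lemma al_eqI: "x \<in> K \<Longrightarrow> v x = 2 *\<^sub>2 y \<Longrightarrow> al x = y"
  by (simp add: al_def)

text \<open>The quadratic relation at x, with \<omega> x written as 2 \<alpha> x, is divided by 2.
  The remaining factor 2 on the right shows that \<alpha> x lies in K again.\<close>

lemma v_al: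
  assumes "x \<in> K"
  shows "v (al x) = 2 *\<^sub>2 (- al x - q *\<^sub>2 x)"
proof -
  have "2 *\<^sub>2 v (al x) = v (v x)"
    using assms by (simp add: v_scale[symmetric] al_coords two_al)
  also have "\<dots> = - (2 *\<^sub>2 v x) - (4 * q) *\<^sub>2 x"
    using assms K_coords by (simp add: v_v)
  also have "\<dots> = 2 *\<^sub>2 2 *\<^sub>2 (- al x - q *\<^sub>2 x)"
    unfolding two_al[OF assms, symmetric] by (simp add: fun_eq_iff algebra_simps)
  finally show ?thesis
    by (simp only: scale2_two_cancel)
qed

lemma al_K: "x \<in> K \<Longrightarrow> al x \<in> K"
  by (simp add: omega_kernel_def[of J v] al_coords v_al del: z2.scale_right_diff_distrib)

lemma al_al: "x \<in> K \<Longrightarrow> al (al x) = - al x - q *\<^sub>2 x"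
  by (intro al_eqI al_K v_al)

lemma al_add: "x \<in> K \<Longrightarrow> y \<in> K \<Longrightarrow> al (x + y) = al x + al y"
  using z2.subspace_add[OF K_subspace, of x y]
  by (intro al_eqI) (simp_all add: v_add K_coords two_al z2.scale_right_distrib)

lemma al_scale:
  assumes "x \<in> K"
  shows "al (c *\<^sub>2 x) = c *\<^sub>2 al x"
proof (rule al_eqI)
  show "c *\<^sub>2 x \<in> K"
    using assms by (rule z2.subspace_scale[OF K_subspace])
  show "v (c *\<^sub>2 x) = 2 *\<^sub>2 c *\<^sub>2 al x"
    by (simp only: v_scale[OF K_coords[OF assms]] two_al[OF assms, symmetric]
        z2.scale_left_commute[of c 2])
qed

text \<open>For x = 2 h + \<omega> y one gets \<alpha> x = \<omega> h + \<omega>^2 y / 2 = \<omega>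
  (h - y) - 2 q y. Here h itself need not lie in K, but \<alpha> (2 h) = \<omega> h is defined for
  every h.\<close>

lemma al_D:
  assumes "x \<in> D"
  shows "al x \<in> D"
proof -
  have xK: "x \<in> K"
    using assms D_subset_K by blast
  obtain y where y: "x \<in> coords J" "y \<in> coords J" "even_vec (x - v y)"
    using assms unfolding omega_image_def by blast
  define h where "h = half_vec (x - v y)"
  have h: "h \<in> coords J" "x = 2 *\<^sub>2 h + v y"
    using y by (auto simp: h_def scale2_half_vec intro!: half_vec_coords)
  have "v x = 2 *\<^sub>2 v h + v (v y)"
    unfolding h(2) using h(1) y(2) by (simp add: v_add v_scale)
  also have "\<dots> = 2 *\<^sub>2 (v (h - y) - (2 * q) *\<^sub>2 y)"
    unfolding v_v_even[OF y(2)] v_diff[OF h(1) y(2)] by (simp add: fun_eq_iff algebra_simps)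
  finally have "v x = 2 *\<^sub>2 (v (h - y) - (2 * q) *\<^sub>2 y)" .
  then have "al x = v (h - y) - (2 * q) *\<^sub>2 y"
    using xK by (rule al_eqI[rotated])
  moreover have "v (h - y) - (2 * q) *\<^sub>2 y - v (h - y) = 2 *\<^sub>2 ((- q) *\<^sub>2 y)"
    by (simp add: fun_eq_iff)
  then have "even_vec (v (h - y) - (2 * q) *\<^sub>2 y - v (h - y))"
    by (simp only: even_vec_scale2_two)
  ultimately show ?thesis
    using h(1) y(2) unfolding omega_image_def by (auto intro!: bexI[of _ "h - y"])
qed

section \<open>Assembling equivariant bases\<close>

lemma equivariant_pow:
  assumes "finite B" "\<And>n k. n < r \<Longrightarrow> k \<in> B \<Longrightarrow> e (n, k) \<in> coords J"
    and "\<And>n c. n < r \<Longrightarrow> comb B (\<lambda>k. e (n, k)) (w c) = v (comb B (\<lambda>k. e (n, k)) c)"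
  shows "comb ({..<r} \<times> B) e (pow_op w c) = v (comb ({..<r} \<times> B) e c)"
proof -
  have "comb B (\<lambda>k. e (n, k)) c' \<in> coords J" if "n < r" for n c'
    using assms(2) that by (intro comb_in_subspace) auto
  then show ?thesis
    using assms(1,3) by (subst comb_Times, simp)+ (subst v_sum; simp add: pow_op_def)
qed

lemma equivariant_sum:
  assumes "finite A" "finite B"
    and "\<And>k. k \<in> A \<Longrightarrow> e (Inl k) \<in> coords J" "\<And>k. k \<in> B \<Longrightarrow> e (Inr k) \<in> coords J"
    and "\<And>c. comb A (e \<circ> Inl) (w c) = v (comb A (e \<circ> Inl) c)"
    and "\<And>c. comb B (e \<circ> Inr) (w' c) = v (comb B (e \<circ> Inr) c)"
  shows "comb (A <+> B) e (sum_op w w' c) = v (comb (A <+> B) e c)"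
proof -
  have "comb A (e \<circ> Inl) c' \<in> coords J" "comb B (e \<circ> Inr) c'' \<in> coords J" for c' c''
    using assms(3,4) by (auto intro!: comb_in_subspace)
  moreover have "sum_op w w' c \<circ> Inl = w (c \<circ> Inl)" "sum_op w w' c \<circ> Inr = w' (c \<circ> Inr)"
    by (auto simp: sum_op_def)
  ultimately show ?thesis
    using assms by (simp add: comb_Plus v_add)
qed

lemma lattice_iso_comb:
  assumes "bij_betw (comb I e) (coords I) (coords J)"
    and "\<And>c. comb I e (w c) = v (comb I e c)"
  shows "lattice_iso I w J v (comb I e)"
  using assms by (simp add: lattice_iso_def comb_add comb_scale2)

text \<open>By definition of K and D, \<omega> induces an isomorphism from L / K onto D / 2 L. Hence
  lifts x of a basis of L / K give a basis \<omega> x of D / 2 L, and with the family f for K / D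
  all layers of the chain 2 L, D, K, L are covered. The family f is left arbitrary because the two
  residue classes of p modulo 8 require different ones.\<close>

lemma basis_of_kernel_basis:
  assumes B: "finite B" and f: "\<forall>k\<in>B. f k \<in> K"
    and f_gen: "\<forall>y\<in>K. \<exists>c. y - comb B f c \<in> D"
    and f_indep: "\<forall>c. comb B f c \<in> D \<longrightarrow> (\<forall>k\<in>B. 2 dvd c k)"
  shows "\<exists>r (x :: nat \<Rightarrow> 'i \<Rightarrow> zz2). (\<forall>n<r. x n \<in> coords J) \<and>
    bij_betw (comb (({..<r} \<times> UNIV) <+> B) (case_sum (\<lambda>(n, b). if b then v (x n) else x n) f))
      (coords (({..<r} \<times> UNIV) <+> B)) (coords J)"
proof -
  obtain r and x :: "nat \<Rightarrow> 'i \<Rightarrow> zz2" where x: "\<And>n. n < r \<Longrightarrow> x n \<in> coords J"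
    and x_gen: "\<And>y. y \<in> coords J \<Longrightarrow> \<exists>c. y - comb {..<r} x c \<in> K"
    and x_indep: "\<And>c. comb {..<r} x c \<in> K \<Longrightarrow> \<forall>n<r. 2 dvd c n"
    using basis_mod_subspace[OF finite_J order_refl coords_subspace K_subspace] even_in_K by blast
  let ?A = "{..<r} \<times> (UNIV :: bool set)"
  let ?e = "\<lambda>(n, b). if b then v (x n) else x n"
  let ?E = "case_sum ?e f"
  have E: "comb (?A <+> B) ?E c = comb {..<r} x (\<lambda>n. c (Inl (n, False)))
      + v (comb {..<r} x (\<lambda>n. c (Inl (n, True)))) + comb B f (c \<circ> Inr)" for c
  proof -
    have "comb ?A ?e (c \<circ> Inl) =
      comb {..<r} x (\<lambda>n. c (Inl (n, False))) + (\<Sum>n<r. c (Inl (n, True)) *\<^sub>2 v (x n))"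
      by (simp add: comb_Times comb_bool sum.distrib) (simp add: comb_def)
    moreover have "v (comb {..<r} x (\<lambda>n. c (Inl (n, True)))) = (\<Sum>n<r. c (Inl (n, True)) *\<^sub>2 v (x n))"
      unfolding comb_def using x by (subst v_sum) (auto simp: v_scale)
    moreover have "?E \<circ> Inl = ?e" "?E \<circ> Inr = f"
      by auto
    ultimately show ?thesis
      using B by (simp add: comb_Plus)
  qed
  have x_comb: "comb {..<r} x c \<in> coords J" for c
    using x by (intro comb_in_subspace) auto
  have f_comb: "comb B f c \<in> K" for c
    using f by (intro comb_in_subspace K_subspace) blast
  have vD: "v y \<in> D" if "y \<in> coords J" for y
    using that by (auto simp: omega_image_def intro!: bexI[of _ y])
  have "bij_betw (comb (?A <+> B) ?E) (coords (?A <+> B)) (coords J)"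
  proof (rule comb_bij_of_basis_mod_two)
    show "finite (?A <+> B)"
      using B by simp
    show "?E k \<in> coords J" if "k \<in> ?A <+> B" for k
      using that x f K_coords by (auto split: if_splits)
  next
    fix y assume y: "y \<in> coords J"
    \<comment> \<open>The layers are removed from the top: y modulo K, the rest modulo D, and what
      is left is \<omega> z up to even vectors. Expanding z modulo K suffices there, since \<omega>
      maps K into 2 L.\<close>
    obtain c\<^sub>1 where c\<^sub>1: "y - comb {..<r} x c\<^sub>1 \<in> K"
      using x_gen[OF y] by blast
    obtain d where "y - comb {..<r} x c\<^sub>1 - comb B f d \<in> D"
      using bspec[OF f_gen c\<^sub>1] by blast
    then obtain z where z: "z \<in> coords J" "even_vec (y - comb {..<r} x c\<^sub>1 - comb B f d - v z)"
      unfolding omega_image_def by blast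
    obtain c\<^sub>2 where "z - comb {..<r} x c\<^sub>2 \<in> K"
      using x_gen[OF z(1)] by blast
    then have "even_vec (v z - v (comb {..<r} x c\<^sub>2))"
      using z(1) x_comb by (simp add: omega_kernel_def v_diff)
    with z(2) have "even_vec ((y - comb {..<r} x c\<^sub>1 - comb B f d - v z) + (v z - v (comb {..<r} x c\<^sub>2)))"
      using z2.subspace_add[OF even_subspace] by blast
    moreover define c where "c = case_sum (\<lambda>(n, b). if b then c\<^sub>2 n else c\<^sub>1 n) d"
    have "comb (?A <+> B) ?E c = comb {..<r} x c\<^sub>1 + v (comb {..<r} x c\<^sub>2) + comb B f d"
      unfolding E by (simp add: c_def comp_def)
    ultimately show "\<exists>c. even_vec (y - comb (?A <+> B) ?E c)"
      by (intro exI[of _ c]) (simp add: algebra_simps)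
  next
    fix c assume c: "c \<in> coords (?A <+> B)" "even_vec (comb (?A <+> B) ?E c)"
    let ?x\<^sub>1 = "comb {..<r} x (\<lambda>n. c (Inl (n, False)))"
    let ?x\<^sub>2 = "comb {..<r} x (\<lambda>n. c (Inl (n, True)))"
    let ?y = "comb B f (c \<circ> Inr)"
    have closed: "?x\<^sub>1 \<in> coords J" "?x\<^sub>2 \<in> coords J" "?y \<in> coords J"
      using x_comb f_comb K_coords by blast+
    have S: "?x\<^sub>1 + v ?x\<^sub>2 + ?y \<in> D"
      using c(2) closed unfolding E by (intro even_in_D) auto
    \<comment> \<open>Independence follows the same order: reduction modulo K isolates the
      coefficients of x, reduction modulo D those of f, and an even \<omega>
      \<open>?x\<^sub>2\<close> means that \<open>?x\<^sub>2\<close> lies in K.\<close>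
    have "?x\<^sub>1 + v ?x\<^sub>2 + ?y - v ?x\<^sub>2 - ?y \<in> K"
      using S D_subset_K vD[OF closed(2)] f_comb
      by (intro z2.subspace_diff[OF K_subspace]) auto
    then have x1: "\<forall>n<r. 2 dvd c (Inl (n, False))"
      using x_indep[of "\<lambda>n. c (Inl (n, False))"] by simp
    then have ev1: "even_vec ?x\<^sub>1"
      unfolding even_vec_def by (auto simp: comb_def sum_fun_apply intro!: dvd_sum)
    have "?x\<^sub>1 + v ?x\<^sub>2 + ?y - ?x\<^sub>1 - v ?x\<^sub>2 \<in> D"
      using S vD[OF closed(2)] even_in_D[OF closed(1) ev1]
      by (intro z2.subspace_diff[OF D_subspace]) auto
    then have y: "\<forall>k\<in>B. 2 dvd c (Inr k)"
      using spec[OF f_indep, of "c \<circ> Inr"] by simp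
    then have evy: "even_vec ?y"
      unfolding even_vec_def by (auto simp: comb_def sum_fun_apply intro!: dvd_sum)
    have "even_vec (?x\<^sub>1 + v ?x\<^sub>2 + ?y - ?x\<^sub>1 - ?y)"
      using c(2) ev1 evy z2.subspace_diff[OF even_subspace] unfolding E by blast
    then have "?x\<^sub>2 \<in> K"
      using closed by (simp add: omega_kernel_def)
    then have x2: "\<forall>n<r. 2 dvd c (Inl (n, True))"
      using x_indep by blast
    have "2 dvd c k" for k
    proof (cases "k \<in> ?A <+> B")
      case True
      then consider n b where "n < r" "k = Inl (n, b)" | j where "j \<in> B" "k = Inr j"
        by blast
      then show ?thesis
        using x1 x2 y by cases (metis (full_types), blast)
    next
      case False
      then show ?thesis
        using c(1) by (simp add: coords_def)
    qed
    then show "even_vec c"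
      by (simp add: even_vec_def)
  qed
  then show ?thesis
    using x by blast
qed

lemma equivariant_R_part:
  assumes "\<And>n. n < r \<Longrightarrow> x n \<in> coords J"
  shows "comb ({..<r} \<times> UNIV) (\<lambda>(n, b). if b then v (x n) else x n) (pow_op (R_op q) c)
       = v (comb ({..<r} \<times> UNIV) (\<lambda>(n, b). if b then v (x n) else x n) c)"
proof (rule equivariant_pow)
  fix n c
  assume "n < r"
  then show "comb UNIV (\<lambda>b. case (n, b) of (n, b) \<Rightarrow> if b then v (x n) else x n) (R_op q c)
     = v (comb UNIV (\<lambda>b. case (n, b) of (n, b) \<Rightarrow> if b then v (x n) else x n) c)"
    using assms[of n]
    by (simp add: comb_bool R_op_def v_add v_scale v_v fun_eq_iff algebra_simps)
qed (use assms in auto)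

theorem decomposition_odd:
  assumes "\<not> 2 dvd q"
  shows "\<exists>r s \<Phi>. lattice_iso (({..<r} \<times> UNIV) <+> ({..<s} \<times> UNIV))
           (sum_op (pow_op (R_op q)) (pow_op (O_op q))) J v \<Phi>"
proof -
  have K: "K \<subseteq> coords J" "K \<inter> {x. even_vec x} \<subseteq> D"
    using K_coords even_in_D by blast+
  obtain s and y :: "nat \<Rightarrow> 'i \<Rightarrow> zz2" where y: "\<And>n. n < s \<Longrightarrow> y n \<in> K"
    and gen: "\<forall>z\<in>K. \<exists>c. z - comb ({..<s} \<times> UNIV) (\<lambda>(n, b). if b then al (y n) else y n) c \<in> D"
    and indep: "\<forall>c. comb ({..<s} \<times> UNIV) (\<lambda>(n, b). if b then al (y n) else y n) c \<in> D \<longrightarrow>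
      (\<forall>k\<in>{..<s} \<times> UNIV. 2 dvd c k)"
    using basis_mod_subspace_quadratic[of J K D al q, OF finite_J K(1) K_subspace D_subspace K(2)
        D_subset_K al_K al_D al_add al_scale al_al assms] by blast
  let ?f = "\<lambda>(n, b). if b then al (y n) else y n"
  let ?B = "{..<s} \<times> (UNIV :: bool set)"
  have f: "\<forall>k\<in>?B. ?f k \<in> K"
    using y al_K by (auto split: if_splits)
  have fin: "finite ?B"
    by simp
  obtain r and x :: "nat \<Rightarrow> 'i \<Rightarrow> zz2" where x: "\<And>n. n < r \<Longrightarrow> x n \<in> coords J"
    and bij: "bij_betw (comb (({..<r} \<times> UNIV) <+> ?B) (case_sum (\<lambda>(n, b). if b then v (x n) else x n) ?f))
           (coords (({..<r} \<times> UNIV) <+> ?B)) (coords J)"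
    using basis_of_kernel_basis[OF fin f gen indep] by blast
  \<comment> \<open>The operator \<open>O_op\<close> encodes \<omega> y = 2 \<alpha> y and \<omega>
    \<alpha> y = - 2 \<alpha> y - 2 q y.\<close>
  have O_part: "comb ?B ?f (pow_op (O_op q) c) = v (comb ?B ?f c)" for c
  proof (rule equivariant_pow)
    fix n c
    assume "n < s"
    then show "comb UNIV (\<lambda>b. case (n, b) of (n, b) \<Rightarrow> if b then al (y n) else y n) (O_op q c)
       = v (comb UNIV (\<lambda>b. case (n, b) of (n, b) \<Rightarrow> if b then al (y n) else y n) c)"
      using y[of n] two_al[of "y n", symmetric]
      by (simp add: comb_bool O_op_def v_add v_scale v_al al_coords K_coords fun_eq_iff algebra_simps)
  qed (use f K_coords in auto)
  have "lattice_iso (({..<r} \<times> UNIV) <+> ?B) (sum_op (pow_op (R_op q)) (pow_op (O_op q))) J v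
    (comb (({..<r} \<times> UNIV) <+> ?B) (case_sum (\<lambda>(n, b). if b then v (x n) else x n) ?f))"
    using bij
  proof (rule lattice_iso_comb)
    show "comb (({..<r} \<times> UNIV) <+> ?B) (case_sum (\<lambda>(n, b). if b then v (x n) else x n) ?f)
          (sum_op (pow_op (R_op q)) (pow_op (O_op q)) c)
        = v (comb (({..<r} \<times> UNIV) <+> ?B) (case_sum (\<lambda>(n, b). if b then v (x n) else x n) ?f) c)" for c
    proof (rule equivariant_sum)
      show "case_sum (\<lambda>(n, b). if b then v (x n) else x n) ?f (Inr k) \<in> coords J" if "k \<in> ?B" for k
        using bspec[OF f that] K_coords by simp
    qed (use x in \<open>auto simp: comp_def equivariant_R_part O_part split: if_splits\<close>)
  qed
  then show ?thesis
    by blast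
qed

section \<open>Eigenspaces of \<alpha> and the split case\<close>

lemma eigen_subspace: "z2.subspace (eigen a)"
  by (auto simp: z2.subspace_def omega_eigen_def v_zero v_add v_scale z2.scale_right_distrib mult.commute)

lemma eigen_subset_K: "eigen a \<subseteq> K"
  by (auto simp: omega_eigen_def omega_kernel_def even_vec_def)

lemma al_eigen: "x \<in> eigen a \<Longrightarrow> al x = a *\<^sub>2 x"
  using eigen_subset_K[of a] by (intro al_eqI) (auto simp: omega_eigen_def)

text \<open>On K the relation for \<alpha> factors as (\<alpha> - a) (\<alpha> - b) = 0, so \<alpha>
  - b maps K into the kernel of \<alpha> - a.\<close>

lemma eigen_projection:
  assumes "a + b = - 1" "a * b = q" "x \<in> K"
  shows "al x - b *\<^sub>2 x \<in> eigen a"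
proof -
  have *: "b *\<^sub>2 x \<in> K"
    using assms(3) by (rule z2.subspace_scale[OF K_subspace])
  then have "al x - b *\<^sub>2 x \<in> K"
    using al_K[OF assms(3)] by (intro z2.subspace_diff[OF K_subspace])
  moreover have "v (al x - b *\<^sub>2 x) = (2 * a) *\<^sub>2 (al x - b *\<^sub>2 x)"
  proof -
    have q: "q = a * b" and b: "b = - 1 - a"
      using assms(2) add_diff_cancel_left'[of a b] by (simp_all add: assms(1))
    have "v (al x - b *\<^sub>2 x) = 2 *\<^sub>2 (- al x - q *\<^sub>2 x) - b *\<^sub>2 2 *\<^sub>2 al x"
      using assms(3) by (simp add: v_diff v_al v_scale al_coords K_coords two_al)
    also have "\<dots> = (2 * a) *\<^sub>2 (al x - b *\<^sub>2 x)"
      by (simp add: fun_eq_iff q b algebra_simps)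
    finally show ?thesis .
  qed
  ultimately show ?thesis
    by (simp add: omega_eigen_def K_coords)
qed

theorem decomposition_split:
  assumes sum: "a + b = - 1" and prod: "a * b = q" and unit: "\<not> 2 dvd a - b"
  shows "\<exists>r s t \<Phi>. lattice_iso (({..<r} \<times> UNIV) <+> (({..<s} \<times> UNIV) <+> ({..<t} \<times> UNIV)))
           (sum_op (pow_op (R_op q)) (sum_op (pow_op (scalar_op a)) (pow_op (scalar_op b)))) J v \<Phi>"
proof -
  have eigen_coords: "eigen c \<subseteq> coords J" for c
    by (auto simp: omega_eigen_def)
  have even: "eigen c \<inter> {x. even_vec x} \<subseteq> D" for c
    using eigen_coords even_in_D by blast
  \<comment> \<open>\<open>D\<close> need not lie in the eigenspace: the y form a basis of the image
    of the eigenspace in L / D. Taking them inside the eigenspace makes each one span a rank one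
    summand.\<close>
  obtain s and y :: "nat \<Rightarrow> 'i \<Rightarrow> zz2" where y: "\<And>n. n < s \<Longrightarrow> y n \<in> eigen a"
    and y_gen: "\<And>z. z \<in> eigen a \<Longrightarrow> \<exists>c. z - comb {..<s} y c \<in> D"
    and y_indep: "\<And>c. comb {..<s} y c \<in> D \<Longrightarrow> \<forall>n<s. 2 dvd c n"
    using basis_mod_subspace[OF finite_J eigen_coords eigen_subspace D_subspace even] by blast
  obtain t and z :: "nat \<Rightarrow> 'i \<Rightarrow> zz2" where z: "\<And>n. n < t \<Longrightarrow> z n \<in> eigen b"
    and z_gen: "\<And>x. x \<in> eigen b \<Longrightarrow> \<exists>c. x - comb {..<t} z c \<in> D"
    and z_indep: "\<And>c. comb {..<t} z c \<in> D \<Longrightarrow> \<forall>n<t. 2 dvd c n"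
    using basis_mod_subspace[OF finite_J eigen_coords eigen_subspace D_subspace even] by blast
  let ?S = "{..<s} \<times> (UNIV :: unit set)" and ?T = "{..<t} \<times> (UNIV :: unit set)"
  let ?f = "case_sum (\<lambda>(n, _). y n) (\<lambda>(n, _). z n)"
  obtain u where u: "u * (a - b) = 1"
    using odd_zz2_unit[OF unit] by (metis dvdE mult.commute)
  have comb_f: "comb (?S <+> ?T) ?f c
      = comb {..<s} y (\<lambda>n. c (Inl (n, ()))) + comb {..<t} z (\<lambda>n. c (Inr (n, ())))" for c
    by (simp add: comb_Plus comb_Times comp_def) (simp add: comb_def UNIV_unit)
  have y_comb: "comb {..<s} y c \<in> eigen a" and z_comb: "comb {..<t} z c \<in> eigen b" for c
    using y z by (auto intro!: comb_in_subspace eigen_subspace)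
  have f: "\<forall>k\<in>?S <+> ?T. ?f k \<in> K"
    using subsetD[OF eigen_subset_K y] subsetD[OF eigen_subset_K z] by auto
  have fin: "finite (?S <+> ?T)"
    by simp
  have f_gen: "\<forall>x\<in>K. \<exists>c. x - comb (?S <+> ?T) ?f c \<in> D"
  proof
    fix x assume x: "x \<in> K"
    \<comment> \<open>With u inverse to a - b, the operators u (\<alpha> - b) and - u (\<alpha> - a)
      map K to the two eigenspaces and add up to the identity.\<close>
    have "u *\<^sub>2 (al x - b *\<^sub>2 x) \<in> eigen a"
      using eigen_projection[OF sum prod x] z2.subspace_scale[OF eigen_subspace] by blast
    then obtain c where c: "u *\<^sub>2 (al x - b *\<^sub>2 x) - comb {..<s} y c \<in> D"
      using y_gen by blast
    have "(- u) *\<^sub>2 (al x - a *\<^sub>2 x) \<in> eigen b"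
      using eigen_projection[of b a, OF _ _ x] sum prod z2.subspace_scale[OF eigen_subspace]
      by (metis add.commute mult.commute)
    then obtain d where d: "(- u) *\<^sub>2 (al x - a *\<^sub>2 x) - comb {..<t} z d \<in> D"
      using z_gen by blast
    have "u *\<^sub>2 (al x - b *\<^sub>2 x) + (- u) *\<^sub>2 (al x - a *\<^sub>2 x) = (u * (a - b)) *\<^sub>2 x"
      by (simp add: fun_eq_iff algebra_simps)
    then have "u *\<^sub>2 (al x - b *\<^sub>2 x) + (- u) *\<^sub>2 (al x - a *\<^sub>2 x) = x"
      by (simp only: u z2.scale_one)
    then have "x - (comb {..<s} y c + comb {..<t} z d) =
      (u *\<^sub>2 (al x - b *\<^sub>2 x) - comb {..<s} y c) + ((- u) *\<^sub>2 (al x - a *\<^sub>2 x) - comb {..<t} z d)"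
      by (metis add_diff_add)
    then have "x - (comb {..<s} y c + comb {..<t} z d) \<in> D"
      using z2.subspace_add[OF D_subspace c d] by (simp only:)
    then show "\<exists>c. x - comb (?S <+> ?T) ?f c \<in> D"
      by (intro exI[of _ "case_sum (\<lambda>(n, _). c n) (\<lambda>(n, _). d n)"]) (simp add: comb_f)
  qed
  have f_indep: "\<forall>c. comb (?S <+> ?T) ?f c \<in> D \<longrightarrow> (\<forall>k\<in>?S <+> ?T. 2 dvd c k)"
  proof (intro allI impI)
    fix c assume c: "comb (?S <+> ?T) ?f c \<in> D"
    let ?y = "comb {..<s} y (\<lambda>n. c (Inl (n, ())))" and ?z = "comb {..<t} z (\<lambda>n. c (Inr (n, ())))"
    have yz: "?y + ?z \<in> D"
      using c by (simp add: comb_f)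
    have yK: "?y \<in> K" and zK: "?z \<in> K"
      using y_comb z_comb eigen_subset_K by blast+
    have al: "al (?y + ?z) = a *\<^sub>2 ?y + b *\<^sub>2 ?z"
      using al_add[OF yK zK] al_eigen[OF y_comb] al_eigen[OF z_comb] by simp
    \<comment> \<open>The projection u (\<alpha> - b) keeps the first eigencomponent and kills the
      second; it preserves D because \<alpha> does, so both components lie in D.\<close>
    have "u *\<^sub>2 (al (?y + ?z) - b *\<^sub>2 (?y + ?z)) \<in> D"
      using yz al_D by (intro z2.subspace_diff z2.subspace_scale D_subspace)
    moreover have "u *\<^sub>2 (al (?y + ?z) - b *\<^sub>2 (?y + ?z)) = (u * (a - b)) *\<^sub>2 ?y"
      unfolding al by (simp add: fun_eq_iff algebra_simps)
    ultimately have yD: "?y \<in> D"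
      by (simp only: u z2.scale_one)
    then have "?y + ?z - ?y \<in> D"
      using yz by (intro z2.subspace_diff[OF D_subspace])
    then have "?z \<in> D"
      by simp
    then show "\<forall>k\<in>?S <+> ?T. 2 dvd c k"
      using y_indep[OF yD] z_indep by auto
  qed
  obtain r and x :: "nat \<Rightarrow> 'i \<Rightarrow> zz2" where x: "\<And>n. n < r \<Longrightarrow> x n \<in> coords J"
    and bij: "bij_betw (comb (({..<r} \<times> UNIV) <+> (?S <+> ?T)) (case_sum (\<lambda>(n, b). if b then v (x n) else x n) ?f))
           (coords (({..<r} \<times> UNIV) <+> (?S <+> ?T))) (coords J)"
    using basis_of_kernel_basis[OF fin f f_gen f_indep] by blast
  have scalar_part: "comb ({..<m} \<times> (UNIV :: unit set)) (\<lambda>(n, _). g n) (pow_op (scalar_op e) c)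
      = v (comb ({..<m} \<times> UNIV) (\<lambda>(n, _). g n) c)"
    if "\<And>n. n < m \<Longrightarrow> g n \<in> eigen e" for g m e c
  proof (rule equivariant_pow)
    fix n c
    assume "n < m"
    then show "comb (UNIV :: unit set) (\<lambda>k. case (n, k) of (n, _) \<Rightarrow> g n) (scalar_op e c)
       = v (comb (UNIV :: unit set) (\<lambda>k. case (n, k) of (n, _) \<Rightarrow> g n) c)"
      using that[of n]
      by (simp add: comb_def UNIV_unit scalar_op_def omega_eigen_def v_scale mult.commute)
  qed (use that eigen_coords in auto)
  have ST_part: "comb (?S <+> ?T) ?f (sum_op (pow_op (scalar_op a)) (pow_op (scalar_op b)) c)
      = v (comb (?S <+> ?T) ?f c)" for c
    using y z eigen_coords by (intro equivariant_sum) (auto simp: comp_def scalar_part)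
  have "lattice_iso (({..<r} \<times> UNIV) <+> (?S <+> ?T))
    (sum_op (pow_op (R_op q)) (sum_op (pow_op (scalar_op a)) (pow_op (scalar_op b)))) J v
    (comb (({..<r} \<times> UNIV) <+> (?S <+> ?T)) (case_sum (\<lambda>(n, b). if b then v (x n) else x n) ?f))"
    using bij
  proof (rule lattice_iso_comb)
    show "comb (({..<r} \<times> UNIV) <+> (?S <+> ?T)) (case_sum (\<lambda>(n, b). if b then v (x n) else x n) ?f)
          (sum_op (pow_op (R_op q)) (sum_op (pow_op (scalar_op a)) (pow_op (scalar_op b))) c)
        = v (comb (({..<r} \<times> UNIV) <+> (?S <+> ?T)) (case_sum (\<lambda>(n, b). if b then v (x n) else x n) ?f) c)" for c
    proof (rule equivariant_sum)
      show "case_sum (\<lambda>(n, b). if b then v (x n) else x n) ?f (Inr k) \<in> coords J" if "k \<in> ?S <+> ?T" for k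
        using bspec[OF f that] K_coords by simp
    qed (use x in \<open>auto simp: comp_def equivariant_R_part ST_part split: if_splits\<close>)
  qed
  then show ?thesis
    by blast
qed

end

section \<open>Uniqueness of the ranks\<close>

lemma two_dvd_four_zz2 [simp]: "2 dvd (4 :: zz2)"
  using dvd_triv_left[of 2 "2 :: zz2"] by simp

lemma lattice_iso_sym:
  assumes \<Phi>: "lattice_iso I w J v \<Phi>" and w: "\<And>x. x \<in> coords I \<Longrightarrow> w x \<in> coords I"
  shows "lattice_iso J v I w (inv_into (coords I) \<Phi>)"
proof -
  let ?\<Psi> = "inv_into (coords I) \<Phi>"
  have bij: "bij_betw \<Phi> (coords I) (coords J)"
    and add: "\<And>x y. x \<in> coords I \<Longrightarrow> y \<in> coords I \<Longrightarrow> \<Phi> (x + y) = \<Phi> x + \<Phi> y"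
    and scale: "\<And>a x. x \<in> coords I \<Longrightarrow> \<Phi> (a *\<^sub>2 x) = a *\<^sub>2 \<Phi> x"
    and equi: "\<And>x. x \<in> coords I \<Longrightarrow> \<Phi> (w x) = v (\<Phi> x)"
    using \<Phi> by (auto simp: lattice_iso_def)
  have closed: "?\<Psi> y \<in> coords I" and inv: "\<Phi> (?\<Psi> y) = y" if "y \<in> coords J" for y
    using bij that by (auto simp: bij_betw_def inv_into_into f_inv_into_f)
  have eqI: "?\<Psi> y = x" if "x \<in> coords I" "\<Phi> x = y" for x y
    using bij that by (auto simp: bij_betw_def)
  show ?thesis
    unfolding lattice_iso_def
  proof (intro conjI ballI allI)
    show "bij_betw ?\<Psi> (coords J) (coords I)"
      using bij by (rule bij_betw_inv_into)
  next
    fix x y assume "x \<in> coords J" "y \<in> coords J"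
    then show "?\<Psi> (x + y) = ?\<Psi> x + ?\<Psi> y"
      by (intro eqI coords_add closed) (simp_all add: add closed inv)
  next
    fix a x assume "x \<in> coords J"
    then show "?\<Psi> (a *\<^sub>2 x) = a *\<^sub>2 ?\<Psi> x"
      by (intro eqI coords_scale closed) (simp_all add: scale closed inv)
  next
    fix x assume "x \<in> coords J"
    then show "?\<Psi> (v x) = w (?\<Psi> x)"
      by (intro eqI w closed) (simp_all add: equi closed inv)
  qed
qed

text \<open>The index of U in L without a quotient structure. It is computed from the sets L and U
  alone, so two decompositions of one lattice must yield the same number.\<close>

definition index_by_classes :: "('i \<Rightarrow> zz2) set \<Rightarrow> ('i \<Rightarrow> zz2) set \<Rightarrow> nat" where
  "index_by_classes L U = card ((\<lambda>y. {z \<in> L. y - z \<in> U}) ` L)"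

lemma lattice_iso_diff:
  assumes "lattice_iso I w J v \<Phi>" "x \<in> coords I" "y \<in> coords I"
  shows "\<Phi> (x - y) = \<Phi> x - \<Phi> y"
proof -
  have "\<Phi> ((x - y) + y) = \<Phi> (x - y) + \<Phi> y"
    using assms unfolding lattice_iso_def by blast
  then show ?thesis
    by simp
qed

text \<open>In the coordinates given by \<Phi> the class of a vector modulo U is the set of k in P
  at which its coordinate is odd. Indicator vectors realize every subset of P, so the classes
  correspond to \<open>Pow P\<close>.\<close>

lemma index_by_classes_parity:
  assumes \<Phi>: "lattice_iso I w J v \<Phi>" and "finite P" "P \<subseteq> I"
    and U: "\<And>c. c \<in> coords I \<Longrightarrow> \<Phi> c \<in> U \<longleftrightarrow> (\<forall>k\<in>P. 2 dvd c k)"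
  shows "index_by_classes (coords J) U = 2 ^ card P"
proof -
  have bij: "bij_betw \<Phi> (coords I) (coords J)"
    using \<Phi> by (simp add: lattice_iso_def)
  let ?g = "\<lambda>y. {z \<in> coords J. y - z \<in> U}"
  have rel: "\<Phi> c - \<Phi> d \<in> U \<longleftrightarrow> (\<forall>k\<in>P. 2 dvd c k \<longleftrightarrow> 2 dvd d k)"
    if "c \<in> coords I" "d \<in> coords I" for c d
    using U[of "c - d"] that by (simp add: lattice_iso_diff[OF \<Phi>] two_dvd_diff_zz2)
  have closed: "\<Phi> c \<in> coords J" if "c \<in> coords I" for c
    using bij that by (auto simp: bij_betw_def)
  have class_eq: "?g (\<Phi> c) = ?g (\<Phi> d) \<longleftrightarrow> (\<forall>k\<in>P. 2 dvd c k \<longleftrightarrow> 2 dvd d k)"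
    if c: "c \<in> coords I" and d: "d \<in> coords I" for c d
  proof
    assume eq: "?g (\<Phi> c) = ?g (\<Phi> d)"
    have "\<Phi> d \<in> ?g (\<Phi> d)"
      using rel[OF d d] closed[OF d] by simp
    then have "\<Phi> c - \<Phi> d \<in> U"
      unfolding eq[symmetric] by blast
    then show "\<forall>k\<in>P. 2 dvd c k \<longleftrightarrow> 2 dvd d k"
      unfolding rel[OF c d] .
  next
    assume par: "\<forall>k\<in>P. 2 dvd c k \<longleftrightarrow> 2 dvd d k"
    have "\<Phi> c - z \<in> U \<longleftrightarrow> \<Phi> d - z \<in> U" if "z \<in> coords J" for z
    proof -
      obtain e where e: "e \<in> coords I" "z = \<Phi> e"
        using bij \<open>z \<in> coords J\<close> by (auto simp: bij_betw_def)
      show ?thesis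
        unfolding e(2) rel[OF c e(1)] rel[OF d e(1)] using par by blast
    qed
    then show "?g (\<Phi> c) = ?g (\<Phi> d)"
      by blast
  qed
  let ?ind = "\<lambda>S k. if k \<in> S then 1 else 0 :: zz2"
  have ind: "?ind S \<in> coords I" if "S \<subseteq> P" for S
    using that assms(3) by (auto simp: coords_def)
  have ind_odd: "2 dvd ?ind S k \<longleftrightarrow> k \<notin> S" for S k
    by simp
  have "bij_betw (\<lambda>S. ?g (\<Phi> (?ind S))) (Pow P) (?g ` coords J)"
    unfolding bij_betw_def
  proof (intro conjI)
    show "inj_on (\<lambda>S. ?g (\<Phi> (?ind S))) (Pow P)"
    proof (rule inj_onI)
      fix S T assume ST: "S \<in> Pow P" "T \<in> Pow P" and eq: "?g (\<Phi> (?ind S)) = ?g (\<Phi> (?ind T))"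
      have "S \<subseteq> P" "T \<subseteq> P"
        using ST by auto
      then have "\<forall>k\<in>P. k \<in> S \<longleftrightarrow> k \<in> T"
        using eq unfolding class_eq[OF ind[OF \<open>S \<subseteq> P\<close>] ind[OF \<open>T \<subseteq> P\<close>]] ind_odd by blast
      then show "S = T"
        using ST by blast
    qed
    show "(\<lambda>S. ?g (\<Phi> (?ind S))) ` Pow P = ?g ` coords J"
    proof (intro equalityI subsetI)
      fix X assume "X \<in> (\<lambda>S. ?g (\<Phi> (?ind S))) ` Pow P"
      then obtain S where "S \<subseteq> P" "X = ?g (\<Phi> (?ind S))"
        by blast
      then show "X \<in> ?g ` coords J"
        using closed[OF ind] by blast
    next
      fix X assume "X \<in> ?g ` coords J"
      then obtain y where y: "y \<in> coords J" "X = ?g y"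
        by blast
      obtain c where c: "c \<in> coords I" and "y = \<Phi> c"
        using bij y(1) by (auto simp: bij_betw_def)
      then have X: "X = ?g (\<Phi> c)"
        using y(2) by blast
      let ?S = "{k \<in> P. \<not> 2 dvd c k}"
      have "\<forall>k\<in>P. 2 dvd ?ind ?S k \<longleftrightarrow> 2 dvd c k"
        unfolding ind_odd by blast
      moreover have S: "?S \<subseteq> P"
        by blast
      ultimately have "?g (\<Phi> (?ind ?S)) = X"
        unfolding X class_eq[OF ind[OF S] c] by blast
      then show "X \<in> (\<lambda>S. ?g (\<Phi> (?ind S))) ` Pow P"
        using S by blast
    qed
  qed
  from bij_betw_same_card[OF this] show ?thesis
    using assms(2) by (simp add: index_by_classes_def card_Pow)
qed

section \<open>Transport of the invariant submodules along an isomorphism\<close>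

context
  fixes I :: "'i set" and w and J :: "'j set" and v \<Phi>
  assumes \<Phi>: "lattice_iso I w J v \<Phi>" and w: "\<And>x. x \<in> coords I \<Longrightarrow> w x \<in> coords I"
begin

lemma lattice_iso_closed: "x \<in> coords I \<Longrightarrow> \<Phi> x \<in> coords J"
  using \<Phi> by (auto simp: lattice_iso_def bij_betw_def)

lemma lattice_iso_surj: "y \<in> coords J \<Longrightarrow> \<exists>x\<in>coords I. y = \<Phi> x"
  using \<Phi> by (auto simp: lattice_iso_def bij_betw_def)

lemma lattice_iso_inj: "x \<in> coords I \<Longrightarrow> y \<in> coords I \<Longrightarrow> \<Phi> x = \<Phi> y \<longleftrightarrow> x = y"
  using \<Phi> by (auto simp: lattice_iso_def bij_betw_def inj_on_def)

lemma lattice_iso_scale: "x \<in> coords I \<Longrightarrow> \<Phi> (a *\<^sub>2 x) = a *\<^sub>2 \<Phi> x"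
  using \<Phi> by (auto simp: lattice_iso_def)

lemma lattice_iso_op: "x \<in> coords I \<Longrightarrow> v (\<Phi> x) = \<Phi> (w x)"
  using \<Phi> by (auto simp: lattice_iso_def)

lemma lattice_iso_even:
  assumes x: "x \<in> coords I"
  shows "even_vec (\<Phi> x) \<longleftrightarrow> even_vec x"
proof
  assume ev: "even_vec (\<Phi> x)"
  then obtain h where h: "h \<in> coords I" "half_vec (\<Phi> x) = \<Phi> h"
    using lattice_iso_surj[OF half_vec_coords] lattice_iso_closed[OF x] by blast
  then have "\<Phi> (2 *\<^sub>2 h) = \<Phi> x"
    using scale2_half_vec[OF ev] by (simp add: lattice_iso_scale)
  then have "2 *\<^sub>2 h = x"
    using h(1) x by (simp add: lattice_iso_inj)
  then show "even_vec x"
    using even_vec_scale2_two[of h] by simp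
next
  assume ev: "even_vec x"
  have "\<Phi> x = 2 *\<^sub>2 \<Phi> (half_vec x)"
    using lattice_iso_scale[OF half_vec_coords[OF ev x], of 2] by (simp add: scale2_half_vec[OF ev])
  then show "even_vec (\<Phi> x)"
    by simp
qed

lemma lattice_iso_omega_kernel: "x \<in> coords I \<Longrightarrow> \<Phi> x \<in> omega_kernel J v \<longleftrightarrow> x \<in> omega_kernel I w"
  by (simp add: omega_kernel_def lattice_iso_closed lattice_iso_op lattice_iso_even w)

lemma lattice_iso_omega_image:
  assumes "x \<in> coords I"
  shows "\<Phi> x \<in> omega_image J v \<longleftrightarrow> x \<in> omega_image I w"
proof -
  have "coords J = \<Phi> ` coords I"
    using lattice_iso_closed lattice_iso_surj by blast
  moreover have "even_vec (\<Phi> x - v (\<Phi> y)) \<longleftrightarrow> even_vec (x - w y)" if "y \<in> coords I" for y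
    using that assms w by (simp add: lattice_iso_op lattice_iso_diff[OF \<Phi>, symmetric] lattice_iso_even)
  ultimately show ?thesis
    using assms by (simp add: omega_image_def)
qed

lemma lattice_iso_omega_eigen:
  "x \<in> coords I \<Longrightarrow> \<Phi> x \<in> omega_eigen J v a \<longleftrightarrow> x \<in> omega_eigen I w a"
  by (simp add: omega_eigen_def lattice_iso_closed lattice_iso_op lattice_iso_scale[symmetric]
      lattice_iso_inj w)

lemma lattice_iso_omega_image_eigen:
  assumes "x \<in> coords I"
  shows "\<Phi> x \<in> omega_image_eigen J v a \<longleftrightarrow> x \<in> omega_image_eigen I w a"
proof -
  have eig: "omega_eigen J v a = \<Phi> ` omega_eigen I w a"
  proof (intro equalityI subsetI)
    fix y assume y: "y \<in> omega_eigen J v a"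
    then obtain x where "x \<in> coords I" "y = \<Phi> x"
      using lattice_iso_surj[of y] by (auto simp: omega_eigen_def)
    then show "y \<in> \<Phi> ` omega_eigen I w a"
      using y lattice_iso_omega_eigen by blast
  next
    fix y assume "y \<in> \<Phi> ` omega_eigen I w a"
    then obtain x where "x \<in> omega_eigen I w a" "x \<in> coords I" "y = \<Phi> x"
      by (auto simp: omega_eigen_def)
    then show "y \<in> omega_eigen J v a"
      using lattice_iso_omega_eigen by blast
  qed
  have "\<Phi> x - \<Phi> z \<in> omega_image J v \<longleftrightarrow> x - z \<in> omega_image I w" if "z \<in> omega_eigen I w a" for z
  proof -
    have "z \<in> coords I"
      using that by (simp add: omega_eigen_def)
    then show ?thesis
      using assms by (simp add: lattice_iso_diff[OF \<Phi>, symmetric] lattice_iso_omega_image)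
  qed
  then show ?thesis
    using assms by (simp add: omega_image_eigen_def lattice_iso_closed eig)
qed

end

section \<open>The standard lattices and their invariants\<close>

lemma R_op_closed: "R_op q x \<in> coords UNIV" and O_op_closed: "O_op q x \<in> coords UNIV"
  by (simp_all add: coords_def)

lemma pow_op_closed:
  assumes "\<And>x. x \<in> coords I \<Longrightarrow> w x \<in> coords I" and "w 0 = 0" and "x \<in> coords ({..<n} \<times> I)"
  shows "pow_op w x \<in> coords ({..<n} \<times> I)"
proof -
  have "pow_op w x (m, i) = 0" if "(m, i) \<notin> {..<n} \<times> I" for m i
  proof (cases "m < n")
    case True
    have "(\<lambda>j. x (m, j)) \<in> coords I"
      using assms(3) by (simp add: coords_def)
    from assms(1)[OF this] show ?thesis
      using True that by (simp add: pow_op_def coords_def)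
  next
    case False
    then have "(\<lambda>j. x (m, j)) = 0"
      using assms(3) by (simp add: coords_def fun_eq_iff)
    then show ?thesis
      using assms(2) by (simp add: pow_op_def)
  qed
  then show ?thesis
    by (auto simp: coords_def)
qed

lemma coords_Plus: "x \<in> coords (I <+> J) \<longleftrightarrow> x \<circ> Inl \<in> coords I \<and> x \<circ> Inr \<in> coords J"
proof (intro iffI conjI)
  assume "x \<circ> Inl \<in> coords I \<and> x \<circ> Inr \<in> coords J"
  then have "x k = 0" if "k \<notin> I <+> J" for k
    using that by (cases k) (auto simp: coords_def)
  then show "x \<in> coords (I <+> J)"
    by (simp add: coords_def)
qed (auto simp: coords_def)

lemma sum_op_closed:
  assumes "\<And>x. x \<in> coords I \<Longrightarrow> w x \<in> coords I" "\<And>x. x \<in> coords J \<Longrightarrow> w' x \<in> coords J"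
    and "x \<in> coords (I <+> J)"
  shows "sum_op w w' x \<in> coords (I <+> J)"
proof -
  have "sum_op w w' x \<circ> Inl = w (x \<circ> Inl)" "sum_op w w' x \<circ> Inr = w' (x \<circ> Inr)"
    by (auto simp: sum_op_def)
  then show ?thesis
    using assms by (simp add: coords_Plus)
qed

lemma op_zero [simp]: "R_op q 0 = 0" "O_op q 0 = 0" "scalar_op a 0 = 0"
  by (simp_all add: R_op_def O_op_def scalar_op_def fun_eq_iff)

lemma scalar_op_closed: "x \<in> coords I \<Longrightarrow> scalar_op a x \<in> coords I"
  by (simp add: scalar_op_def)

abbreviation odd_index :: "nat \<Rightarrow> nat \<Rightarrow> (nat \<times> bool + nat \<times> bool) set" where
  "odd_index r s \<equiv> ({..<r} \<times> UNIV) <+> ({..<s} \<times> UNIV)"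

abbreviation odd_op :: "zz2 \<Rightarrow> (nat \<times> bool + nat \<times> bool \<Rightarrow> zz2) \<Rightarrow> nat \<times> bool + nat \<times> bool \<Rightarrow> zz2" where
  "odd_op q \<equiv> sum_op (pow_op (R_op q)) (pow_op (O_op q))"

abbreviation split_index :: "nat \<Rightarrow> nat \<Rightarrow> nat \<Rightarrow> (nat \<times> bool + (nat \<times> unit + nat \<times> unit)) set" where
  "split_index r s t \<equiv> ({..<r} \<times> UNIV) <+> (({..<s} \<times> UNIV) <+> ({..<t} \<times> UNIV))"

abbreviation split_op :: "zz2 \<Rightarrow> zz2 \<Rightarrow> zz2 \<Rightarrow>
    (nat \<times> bool + (nat \<times> unit + nat \<times> unit) \<Rightarrow> zz2) \<Rightarrow> nat \<times> bool + (nat \<times> unit + nat \<times> unit) \<Rightarrow> zz2" where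
  "split_op q a b \<equiv> sum_op (pow_op (R_op q)) (sum_op (pow_op (scalar_op a)) (pow_op (scalar_op b)))"

lemma odd_op_closed: "x \<in> coords (odd_index r s) \<Longrightarrow> odd_op q x \<in> coords (odd_index r s)"
  by (intro sum_op_closed pow_op_closed) (simp_all add: R_op_closed O_op_closed)

lemma split_op_closed: "x \<in> coords (split_index r s t) \<Longrightarrow> split_op q a b x \<in> coords (split_index r s t)"
  by (intro sum_op_closed pow_op_closed) (simp_all add: R_op_closed scalar_op_closed)

lemma odd_op_apply:
  "odd_op q c (Inl (n, False)) = - 4 * q * c (Inl (n, True))"
  "odd_op q c (Inl (n, True)) = c (Inl (n, False)) - 2 * c (Inl (n, True))"
  "odd_op q c (Inr (n, False)) = - 2 * q * c (Inr (n, True))"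
  "odd_op q c (Inr (n, True)) = 2 * c (Inr (n, False)) - 2 * c (Inr (n, True))"
  by (simp_all add: sum_op_def pow_op_def R_op_def O_op_def)

lemma split_op_apply:
  "split_op q a b c (Inl (n, False)) = - 4 * q * c (Inl (n, True))"
  "split_op q a b c (Inl (n, True)) = c (Inl (n, False)) - 2 * c (Inl (n, True))"
  "split_op q a b c (Inr (Inl k)) = 2 * a * c (Inr (Inl k))"
  "split_op q a b c (Inr (Inr k)) = 2 * b * c (Inr (Inr k))"
  by (simp_all add: sum_op_def pow_op_def R_op_def scalar_op_def split: prod.splits)

lemma forall_odd_index:
  "(\<forall>k. P k) \<longleftrightarrow> (\<forall>n. P (Inl (n, False)) \<and> P (Inl (n, True)) \<and> P (Inr (n, False)) \<and> P (Inr (n, True)))"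
  for P :: "nat \<times> bool + nat \<times> bool \<Rightarrow> bool"
  by (metis (full_types) obj_sumE surj_pair)

lemma forall_split_index:
  "(\<forall>k. P k) \<longleftrightarrow> (\<forall>n. P (Inl (n, False)) \<and> P (Inl (n, True))) \<and>
     (\<forall>k. P (Inr (Inl k))) \<and> (\<forall>k. P (Inr (Inr k)))"
  for P :: "nat \<times> bool + (nat \<times> unit + nat \<times> unit) \<Rightarrow> bool"
  by (metis (full_types) obj_sumE surj_pair)

lemma forall_dvd_iff: "(\<And>n. n \<ge> r \<Longrightarrow> f n = (0 :: zz2)) \<Longrightarrow> (\<forall>n. 2 dvd f n) \<longleftrightarrow> (\<forall>n<r. 2 dvd f n)"
  for r :: nat
  by (metis dvd_0_right not_less)

lemma coordsD: "x \<in> coords I \<Longrightarrow> k \<notin> I \<Longrightarrow> x k = 0"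
  by (simp add: coords_def)

lemma odd_coords_zero:
  assumes "c \<in> coords (odd_index r s)"
  shows "n \<ge> r \<Longrightarrow> c (Inl (n, b)) = 0" "n \<ge> s \<Longrightarrow> c (Inr (n, b)) = 0"
  by (rule coordsD[OF assms], force)+

lemma split_coords_zero:
  assumes "c \<in> coords (split_index r s t)"
  shows "n \<ge> r \<Longrightarrow> c (Inl (n, b)) = 0" "n \<ge> s \<Longrightarrow> c (Inr (Inl (n, u))) = 0"
    "n \<ge> t \<Longrightarrow> c (Inr (Inr (n, u))) = 0"
  by (rule coordsD[OF assms], force)+

lemma coordsI: "(\<And>k. x k \<noteq> 0 \<Longrightarrow> k \<in> I) \<Longrightarrow> x \<in> coords I"
  by (auto simp: coords_def)

text \<open>Modulo 2 the only nonzero entries of \<omega> are those sending 1 to \<omega> in each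
  copy of R, so just the coefficients at 1 there have to be even.\<close>

lemma omega_kernel_odd:
  assumes "c \<in> coords (odd_index r s)"
  shows "c \<in> omega_kernel (odd_index r s) (odd_op q) \<longleftrightarrow>
    (\<forall>k\<in>(\<lambda>n. Inl (n, False)) ` {..<r}. 2 dvd c k)"
proof -
  have "even_vec (odd_op q c) \<longleftrightarrow> (\<forall>n. 2 dvd c (Inl (n, False)))"
    unfolding even_vec_def forall_odd_index by (simp add: odd_op_apply two_dvd_add_zz2 two_dvd_diff_zz2 two_dvd_mult_zz2)
  also have "\<dots> \<longleftrightarrow> (\<forall>k\<in>(\<lambda>n. Inl (n, False)) ` {..<r}. 2 dvd c k)"
    by (subst forall_dvd_iff[of r]) (auto simp: odd_coords_zero[OF assms])
  finally show ?thesis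
    using assms by (simp add: omega_kernel_def)
qed

lemma omega_image_odd:
  assumes c: "c \<in> coords (odd_index r s)"
  shows "c \<in> omega_image (odd_index r s) (odd_op q) \<longleftrightarrow>
    (\<forall>k\<in>(\<lambda>n. Inl (n, False)) ` {..<r} \<union> Inr ` ({..<s} \<times> UNIV). 2 dvd c k)"
proof -
  have "c \<in> omega_image (odd_index r s) (odd_op q) \<longleftrightarrow>
    (\<forall>n. 2 dvd c (Inl (n, False)) \<and> 2 dvd c (Inr (n, False)) \<and> 2 dvd c (Inr (n, True)))"
  proof
    assume "c \<in> omega_image (odd_index r s) (odd_op q)"
    then obtain y where "even_vec (c - odd_op q y)"
      unfolding omega_image_def by blast
    then show "\<forall>n. 2 dvd c (Inl (n, False)) \<and> 2 dvd c (Inr (n, False)) \<and> 2 dvd c (Inr (n, True))"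
      unfolding even_vec_def forall_odd_index
      by (simp add: odd_op_apply two_dvd_add_zz2 two_dvd_diff_zz2 two_dvd_mult_zz2)
  next
    assume ev: "\<forall>n. 2 dvd c (Inl (n, False)) \<and> 2 dvd c (Inr (n, False)) \<and> 2 dvd c (Inr (n, True))"
    \<comment> \<open>Since \<omega> maps 1 to \<omega> in R, the coefficients of c at \<omega> are
      moved to 1; applying the operator restores them, which leaves the coefficients that are even
      by assumption.\<close>
    define y :: "nat \<times> bool + nat \<times> bool \<Rightarrow> zz2" where "y = case_sum (\<lambda>(n, b). if b then 0 else c (Inl (n, True))) (\<lambda>_. 0)"
    have y: "y \<in> coords (odd_index r s)"
      using odd_coords_zero(1)[OF c]
      by (intro coordsI) (auto simp: y_def split: sum.splits if_splits; metis not_less)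
    have "even_vec (c - odd_op q y)"
      using ev unfolding even_vec_def forall_odd_index
      by (simp add: odd_op_apply two_dvd_add_zz2 two_dvd_diff_zz2 two_dvd_mult_zz2 y_def)
    then show "c \<in> omega_image (odd_index r s) (odd_op q)"
      using c y unfolding omega_image_def by blast
  qed
  also have "\<dots> \<longleftrightarrow> (\<forall>n<r. 2 dvd c (Inl (n, False))) \<and> (\<forall>n<s. 2 dvd c (Inr (n, False))) \<and>
      (\<forall>n<s. 2 dvd c (Inr (n, True)))"
    unfolding all_conj_distrib
    using forall_dvd_iff[of r "\<lambda>n. c (Inl (n, False))"] forall_dvd_iff[of s "\<lambda>n. c (Inr (n, False))"]
      forall_dvd_iff[of s "\<lambda>n. c (Inr (n, True))"] odd_coords_zero[OF c] by simp
  also have "\<dots> \<longleftrightarrow> (\<forall>k\<in>(\<lambda>n. Inl (n, False)) ` {..<r} \<union> Inr ` ({..<s} \<times> UNIV). 2 dvd c k)"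
    by (auto; metis (full_types))
  finally show ?thesis .
qed

text \<open>The index of K is \<open>2 ^ r\<close>, and each O_E adds a factor 4 to the index of D,
  because D = 2 L on that summand.\<close>

lemma odd_ranks_unique:
  assumes "lattice_iso (odd_index r s) (odd_op q) J v \<Phi>"
    and "lattice_iso (odd_index r' s') (odd_op q) J v \<Psi>"
  shows "r = r' \<and> s = s'"
proof -
  have kernel: "index_by_classes (coords J) (omega_kernel J v) = 2 ^ r"
    if "lattice_iso (odd_index r s) (odd_op q) J v \<Phi>" for r s \<Phi>
  proof -
    let ?P = "(\<lambda>n. Inl (n, False)) ` {..<r} :: (nat \<times> bool + nat \<times> bool) set"
    have "index_by_classes (coords J) (omega_kernel J v) = 2 ^ card ?P"
      using that
      by (rule index_by_classes_parity)
        (auto simp: lattice_iso_omega_kernel[OF that odd_op_closed] omega_kernel_odd)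
    also have "card ?P = r"
      by (subst card_image) (auto simp: inj_on_def)
    finally show ?thesis .
  qed
  have image: "index_by_classes (coords J) (omega_image J v) = 2 ^ (r + 2 * s)"
    if "lattice_iso (odd_index r s) (odd_op q) J v \<Phi>" for r s \<Phi>
  proof -
    let ?P = "(\<lambda>n. Inl (n, False)) ` {..<r} \<union> Inr ` ({..<s} \<times> UNIV) :: (nat \<times> bool + nat \<times> bool) set"
    have "index_by_classes (coords J) (omega_image J v) = 2 ^ card ?P"
      using that
    proof (rule index_by_classes_parity)
      fix c assume "c \<in> coords (odd_index r s)"
      then show "\<Phi> c \<in> omega_image J v \<longleftrightarrow> (\<forall>k\<in>?P. 2 dvd c k)"
        by (simp only: lattice_iso_omega_image[OF that odd_op_closed] omega_image_odd)
    qed auto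
    also have "card ?P = r + 2 * s"
      by (subst card_Un_disjoint) (auto simp: card_image inj_on_def card_cartesian_product)
    finally show ?thesis .
  qed
  have "(2 :: nat) ^ r = 2 ^ r'" "(2 :: nat) ^ (r + 2 * s) = 2 ^ (r' + 2 * s')"
    using kernel[OF assms(1)] kernel[OF assms(2)] image[OF assms(1)] image[OF assms(2)] by simp_all
  then show ?thesis
    by simp
qed

lemma omega_kernel_split:
  assumes "c \<in> coords (split_index r s t)"
  shows "c \<in> omega_kernel (split_index r s t) (split_op q a b) \<longleftrightarrow>
    (\<forall>k\<in>(\<lambda>n. Inl (n, False)) ` {..<r}. 2 dvd c k)"
proof -
  have "even_vec (split_op q a b c) \<longleftrightarrow> (\<forall>n. 2 dvd c (Inl (n, False)))"
    unfolding even_vec_def forall_split_index by (simp add: split_op_apply two_dvd_add_zz2 two_dvd_diff_zz2 two_dvd_mult_zz2)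
  also have "\<dots> \<longleftrightarrow> (\<forall>k\<in>(\<lambda>n. Inl (n, False)) ` {..<r}. 2 dvd c k)"
    by (subst forall_dvd_iff[of r]) (auto simp: split_coords_zero[OF assms])
  finally show ?thesis
    using assms by (simp add: omega_kernel_def)
qed

text \<open>An eigenvector for a has even coefficients at 1 in the copies of R and vanishes on the
  summands with eigenvalue b, while it is arbitrary on those with eigenvalue a. Adding these vectors
  to D therefore removes exactly the parity conditions on the a-part; likewise for b.\<close>

lemma omega_image_eigen_split:
  assumes c: "c \<in> coords (split_index r s t)" and ab: "a \<noteq> b"
  shows "c \<in> omega_image_eigen (split_index r s t) (split_op q a b) a \<longleftrightarrow>
      (\<forall>k\<in>(\<lambda>n. Inl (n, False)) ` {..<r} \<union> (\<lambda>n. Inr (Inr (n, ()))) ` {..<t}. 2 dvd c k)"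
    and "c \<in> omega_image_eigen (split_index r s t) (split_op q a b) b \<longleftrightarrow>
      (\<forall>k\<in>(\<lambda>n. Inl (n, False)) ` {..<r} \<union> (\<lambda>n. Inr (Inl (n, ()))) ` {..<s}. 2 dvd c k)"
proof -
  let ?I = "split_index r s t" and ?w = "split_op q a b"
  define y :: "nat \<times> bool + (nat \<times> unit + nat \<times> unit) \<Rightarrow> zz2" where "y = case_sum (\<lambda>(n, b). if b then 0 else c (Inl (n, True))) (\<lambda>_. 0)"
  have y: "y \<in> coords ?I"
    using split_coords_zero(1)[OF c]
    by (intro coordsI) (auto simp: y_def split: sum.splits if_splits; metis not_less)
  have unfold: "c \<in> omega_image_eigen ?I ?w e \<longleftrightarrow>
      (\<exists>z\<in>omega_eigen ?I ?w e. \<exists>y\<in>coords ?I. even_vec (c - z - ?w y))" for e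
    using c by (auto simp: omega_image_eigen_def omega_image_def omega_eigen_def)
  have eig: "z \<in> omega_eigen ?I ?w e \<Longrightarrow> (\<forall>n. 2 dvd z (Inl (n, False))) \<and>
      (\<forall>k. (a - e) * z (Inr (Inl k)) = 0) \<and> (\<forall>k. (b - e) * z (Inr (Inr k)) = 0)" for z e
  proof -
    assume "z \<in> omega_eigen ?I ?w e"
    then have "\<forall>k. ?w z k = 2 * e * z k"
      by (simp add: omega_eigen_def fun_eq_iff)
    then have z: "\<And>n. z (Inl (n, False)) - 2 * z (Inl (n, True)) = 2 * e * z (Inl (n, True))"
      "\<And>k. 2 * a * z (Inr (Inl k)) = 2 * e * z (Inr (Inl k))"
      "\<And>k. 2 * b * z (Inr (Inr k)) = 2 * e * z (Inr (Inr k))"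
      unfolding forall_split_index by (simp_all only: split_op_apply)
    \<comment> \<open>The eigenvalue equation at the coordinate of \<omega> in a copy of R, solved
      for the coefficient at 1.\<close>
    have "z (Inl (n, False)) = 2 * ((e + 1) * z (Inl (n, True)))" for n
      using z(1)[of n] by (simp add: algebra_simps)
    then have "2 dvd z (Inl (n, False))" for n
      by (metis dvd_triv_left)
    moreover have "(a - e) * z (Inr (Inl k)) = 0" "(b - e) * z (Inr (Inr k)) = 0" for k
      using z(2,3)[of k] by (simp_all add: mult.assoc algebra_simps)
    ultimately show ?thesis
      by blast
  qed
  have mem_eig: "z \<in> omega_eigen ?I ?w e" if "z \<in> coords ?I" "\<And>k. z (Inl k) = 0"
      "\<And>k. (a - e) * z (Inr (Inl k)) = 0" "\<And>k. (b - e) * z (Inr (Inr k)) = 0" for z e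
  proof -
    have "?w z k = 2 * e * z k" for k
    proof -
      have "\<forall>k. ?w z k = 2 * e * z k"
        unfolding forall_split_index split_op_apply
        using that(2-4) by (simp add: mult.assoc algebra_simps)
      then show ?thesis ..
    qed
    then show ?thesis
      using that(1) by (simp add: omega_eigen_def fun_eq_iff)
  qed
  show "c \<in> omega_image_eigen ?I ?w a \<longleftrightarrow>
    (\<forall>k\<in>(\<lambda>n. Inl (n, False)) ` {..<r} \<union> (\<lambda>n. Inr (Inr (n, ()))) ` {..<t}. 2 dvd c k)"
  proof -
    have "c \<in> omega_image_eigen ?I ?w a \<longleftrightarrow>
      (\<forall>n. 2 dvd c (Inl (n, False))) \<and> (\<forall>k. 2 dvd c (Inr (Inr k)))"
    proof
      assume "c \<in> omega_image_eigen ?I ?w a"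
      then obtain z y where z: "z \<in> omega_eigen ?I ?w a" "even_vec (c - z - ?w y)"
        unfolding unfold by blast
      have "z (Inr (Inr k)) = 0" for k
        using eig[OF z(1)] ab by (cases k) auto
      then show "(\<forall>n. 2 dvd c (Inl (n, False))) \<and> (\<forall>k. 2 dvd c (Inr (Inr k)))"
        using z(2) eig[OF z(1)] unfolding even_vec_def forall_split_index
        by (simp add: split_op_apply two_dvd_add_zz2 two_dvd_diff_zz2 two_dvd_mult_zz2)
    next
      assume ev: "(\<forall>n. 2 dvd c (Inl (n, False))) \<and> (\<forall>k. 2 dvd c (Inr (Inr k)))"
      define z :: "nat \<times> bool + (nat \<times> unit + nat \<times> unit) \<Rightarrow> zz2" where "z = case_sum (\<lambda>_. 0) (case_sum (\<lambda>k. c (Inr (Inl k))) (\<lambda>_. 0))"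
      have "z \<in> coords ?I"
        using c by (auto simp: coords_def z_def split: sum.split)
      then have "z \<in> omega_eigen ?I ?w a"
        by (rule mem_eig) (simp_all add: z_def)
      moreover have "even_vec (c - z - ?w y)"
        using ev unfolding even_vec_def forall_split_index
        by (simp add: split_op_apply two_dvd_add_zz2 two_dvd_diff_zz2 two_dvd_mult_zz2 y_def z_def)
      ultimately show "c \<in> omega_image_eigen ?I ?w a"
        unfolding unfold using y by blast
    qed
    also have "\<dots> \<longleftrightarrow>
      (\<forall>n<r. 2 dvd c (Inl (n, False))) \<and> (\<forall>n<t. 2 dvd c (Inr (Inr (n, ()))))"
      using forall_dvd_iff[of r "\<lambda>n. c (Inl (n, False))"]
        forall_dvd_iff[of t "\<lambda>n. c (Inr (Inr (n, ())))"] split_coords_zero[OF c] by simp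
    also have "\<dots> \<longleftrightarrow>
      (\<forall>k\<in>(\<lambda>n. Inl (n, False)) ` {..<r} \<union> (\<lambda>n. Inr (Inr (n, ()))) ` {..<t}. 2 dvd c k)"
      by auto
    finally show ?thesis .
  qed
  show "c \<in> omega_image_eigen ?I ?w b \<longleftrightarrow>
    (\<forall>k\<in>(\<lambda>n. Inl (n, False)) ` {..<r} \<union> (\<lambda>n. Inr (Inl (n, ()))) ` {..<s}. 2 dvd c k)"
  proof -
    have "c \<in> omega_image_eigen ?I ?w b \<longleftrightarrow>
      (\<forall>n. 2 dvd c (Inl (n, False))) \<and> (\<forall>k. 2 dvd c (Inr (Inl k)))"
    proof
      assume "c \<in> omega_image_eigen ?I ?w b"
      then obtain z y where z: "z \<in> omega_eigen ?I ?w b" "even_vec (c - z - ?w y)"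
        unfolding unfold by blast
      have "z (Inr (Inl k)) = 0" for k
        using eig[OF z(1)] ab by (cases k) auto
      then show "(\<forall>n. 2 dvd c (Inl (n, False))) \<and> (\<forall>k. 2 dvd c (Inr (Inl k)))"
        using z(2) eig[OF z(1)] unfolding even_vec_def forall_split_index
        by (simp add: split_op_apply two_dvd_add_zz2 two_dvd_diff_zz2 two_dvd_mult_zz2)
    next
      assume ev: "(\<forall>n. 2 dvd c (Inl (n, False))) \<and> (\<forall>k. 2 dvd c (Inr (Inl k)))"
      define z :: "nat \<times> bool + (nat \<times> unit + nat \<times> unit) \<Rightarrow> zz2" where "z = case_sum (\<lambda>_. 0) (case_sum (\<lambda>_. 0) (\<lambda>k. c (Inr (Inr k))))"
      have "z \<in> coords ?I"
        using c by (auto simp: coords_def z_def split: sum.split)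
      then have "z \<in> omega_eigen ?I ?w b"
        by (rule mem_eig) (simp_all add: z_def)
      moreover have "even_vec (c - z - ?w y)"
        using ev unfolding even_vec_def forall_split_index
        by (simp add: split_op_apply two_dvd_add_zz2 two_dvd_diff_zz2 two_dvd_mult_zz2 y_def z_def)
      ultimately show "c \<in> omega_image_eigen ?I ?w b"
        unfolding unfold using y by blast
    qed
    also have "\<dots> \<longleftrightarrow>
      (\<forall>n<r. 2 dvd c (Inl (n, False))) \<and> (\<forall>n<s. 2 dvd c (Inr (Inl (n, ()))))"
      using forall_dvd_iff[of r "\<lambda>n. c (Inl (n, False))"]
        forall_dvd_iff[of s "\<lambda>n. c (Inr (Inl (n, ())))"] split_coords_zero[OF c] by simp
    also have "\<dots> \<longleftrightarrow>
      (\<forall>k\<in>(\<lambda>n. Inl (n, False)) ` {..<r} \<union> (\<lambda>n. Inr (Inl (n, ()))) ` {..<s}. 2 dvd c k)"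
      by auto
    finally show ?thesis .
  qed
qed

text \<open>The index of D alone would only give r + s + t. Enlarging D by the eigenspace of a
  removes the s summands of that eigenvalue and leaves \<open>r + t\<close>; the eigenspace of b
  leaves \<open>r + s\<close>.\<close>

lemma split_ranks_unique:
  assumes "lattice_iso (split_index r s t) (split_op q a b) J v \<Phi>"
    and "lattice_iso (split_index r' s' t') (split_op q a b) J v \<Psi>"
    and ab: "a \<noteq> b"
  shows "r = r' \<and> s = s' \<and> t = t'"
proof -
  let ?R = "\<lambda>r. (\<lambda>n. Inl (n, False)) ` {..<r} :: (nat \<times> bool + (nat \<times> unit + nat \<times> unit)) set"
  let ?S = "\<lambda>s. (\<lambda>n. Inr (Inl (n, ()))) ` {..<s} :: (nat \<times> bool + (nat \<times> unit + nat \<times> unit)) set"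
  let ?T = "\<lambda>t. (\<lambda>n. Inr (Inr (n, ()))) ` {..<t} :: (nat \<times> bool + (nat \<times> unit + nat \<times> unit)) set"
  have card: "card (?R r) = r" "card (?S s) = s" "card (?T t) = t" for r s t
    by (subst card_image; auto simp: inj_on_def)+
  have "index_by_classes (coords J) (omega_kernel J v) = 2 ^ card (?R r) \<and>
    index_by_classes (coords J) (omega_image_eigen J v a) = 2 ^ card (?R r \<union> ?T t) \<and>
    index_by_classes (coords J) (omega_image_eigen J v b) = 2 ^ card (?R r \<union> ?S s)"
    if "lattice_iso (split_index r s t) (split_op q a b) J v \<Phi>" for r s t \<Phi>
  proof (intro conjI; rule index_by_classes_parity[OF that])
    fix c assume c: "c \<in> coords (split_index r s t)"
    show "\<Phi> c \<in> omega_kernel J v \<longleftrightarrow> (\<forall>k\<in>?R r. 2 dvd c k)"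
      using c by (simp only: lattice_iso_omega_kernel[OF that split_op_closed] omega_kernel_split)
    show "\<Phi> c \<in> omega_image_eigen J v a \<longleftrightarrow> (\<forall>k\<in>?R r \<union> ?T t. 2 dvd c k)"
      by (simp only: lattice_iso_omega_image_eigen[OF that split_op_closed] c
          omega_image_eigen_split(1)[OF c ab])
    show "\<Phi> c \<in> omega_image_eigen J v b \<longleftrightarrow> (\<forall>k\<in>?R r \<union> ?S s. 2 dvd c k)"
      by (simp only: lattice_iso_omega_image_eigen[OF that split_op_closed] c
          omega_image_eigen_split(2)[OF c ab])
  qed auto
  moreover have "card (?R r \<union> ?T t) = r + t" "card (?R r \<union> ?S s) = r + s" for r s t
    by (subst card_Un_disjoint; (auto simp: card))+
  ultimately have index: "index_by_classes (coords J) (omega_kernel J v) = 2 ^ r \<and>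
    index_by_classes (coords J) (omega_image_eigen J v a) = 2 ^ (r + t) \<and>
    index_by_classes (coords J) (omega_image_eigen J v b) = 2 ^ (r + s)"
    if "lattice_iso (split_index r s t) (split_op q a b) J v \<Phi>" for r s t \<Phi>
    using that by (simp only: card)
  have "(2 :: nat) ^ r = 2 ^ r'" "(2 :: nat) ^ (r + t) = 2 ^ (r' + t')" "(2 :: nat) ^ (r + s) = 2 ^ (r' + s')"
    using index[OF assms(1)] index[OF assms(2)] by simp_all
  then show ?thesis
    by simp
qed

section \<open>Cosets of an ideal\<close>

lemma (in ideal) mem_rcos_iff:
  assumes "x \<in> carrier R" "y \<in> carrier R"
  shows "y \<in> I +> x \<longleftrightarrow> y \<ominus> x \<in> I"
  by (rule a_rcos_module_minus[OF ring_axioms assms])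

lemma (in ideal) rcos_eq_iff:
  assumes "x \<in> carrier R" "y \<in> carrier R"
  shows "I +> x = I +> y \<longleftrightarrow> x \<ominus> y \<in> I"
  using a_rcos_self[OF assms(1)] a_repr_independence'[OF _ assms(2), of x]
  by (auto simp: mem_rcos_iff[OF assms(2,1), symmetric])

section \<open>The quadratic rings\<close>

abbreviation quad_poly :: "nat \<Rightarrow> 'a::comm_ring_1 poly" where
  "quad_poly p \<equiv> [:of_nat p, 0, 1:]"

lemma quad_ideal_iff: "f \<in> quad_ideal p \<longleftrightarrow> quad_poly p dvd f"
  by (auto simp: quad_ideal_def cgenideal_def dvd_def mult.commute)

lemma quad_ideal_ideal: "ideal (quad_ideal p) (class_ring :: 'a::comm_ring_1 poly ring)"
  unfolding quad_ideal_def by (rule cring.cgenideal_ideal[OF class_cring.cring_axioms]) simp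

lemma quad_ring_cring: "cring (quad_ring p :: 'a::comm_ring_1 poly set ring)"
  unfolding quad_ring_def
  by (rule ideal.quotient_is_cring[OF quad_ideal_ideal]) (rule class_cring.cring_axioms)

interpretation quad: cring "quad_ring p"
  by (rule quad_ring_cring)

lemma quad_class_hom: "ring_hom_cring class_ring (quad_ring p) (quad_class p)"
  unfolding quad_ring_def quad_class_def[abs_def]
  by (rule ideal.rcos_ring_hom_cring[OF quad_ideal_ideal]) (rule class_cring.cring_axioms)

interpretation quad_hom: ring_hom_cring class_ring "quad_ring p" "quad_class p"
  by (rule quad_class_hom)

lemma quad_class_eq_iff: "quad_class p f = quad_class p g \<longleftrightarrow> quad_poly p dvd f - g"
  unfolding quad_class_def
  by (subst ideal.rcos_eq_iff[OF quad_ideal_ideal]) (simp_all add: class_ring_simps quad_ideal_iff)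

lemma mem_quad_class_iff: "g \<in> quad_class p f \<longleftrightarrow> quad_poly p dvd g - f"
  unfolding quad_class_def
  by (subst ideal.mem_rcos_iff[OF quad_ideal_ideal]) (simp_all add: class_ring_simps quad_ideal_iff)

lemma quad_class_closed [simp]: "quad_class p f \<in> carrier (quad_ring p)"
  using quad_hom.hom_closed[of f] by simp

lemma quad_class_add: "quad_class p f \<oplus>\<^bsub>quad_ring p\<^esub> quad_class p g = quad_class p (f + g)"
  using quad_hom.hom_add[of f g] by simp

lemma quad_class_mult: "quad_class p f \<otimes>\<^bsub>quad_ring p\<^esub> quad_class p g = quad_class p (f * g)"
  using quad_hom.hom_mult[of f g] by simp

lemma quad_class_one: "\<one>\<^bsub>quad_ring p\<^esub> = quad_class p 1"
  by (simp flip: quad_hom.hom_one)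

lemma quad_class_zero: "\<zero>\<^bsub>quad_ring p\<^esub> = quad_class p 0"
  by (simp flip: quad_hom.hom_zero)

lemma quad_class_diff: "quad_class p f \<ominus>\<^bsub>quad_ring p\<^esub> quad_class p g = quad_class p (f - g)"
  using quad_hom.hom_a_inv[of g] by (simp add: a_minus_def class_ring_simps quad_class_add flip: quad_hom.hom_a_inv)

lemma quad_class_power: "quad_class p f [^]\<^bsub>quad_ring p\<^esub> (n :: nat) = quad_class p (f ^ n)"
  by (induction n) (simp_all add: quad_class_one quad_class_mult mult.commute)

lemma quad_class_finsum:
  "finite A \<Longrightarrow> (\<Oplus>\<^bsub>quad_ring p\<^esub> i\<in>A. quad_class p (f i)) = quad_class p (\<Sum>i\<in>A. f i)"
proof (induction A rule: finite_induct)
  case (insert i A)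
  then show ?case
    by (subst quad.finsum_insert) (auto simp: quad_class_add)
qed (simp add: quad_class_zero)

lemma carrier_quad_ring: "carrier (quad_ring p) = range (quad_class p)"
  unfolding quad_ring_def quad_class_def by (auto simp: FactRing_def A_RCOSETS_def')

text \<open>Division with remainder by the monic polynomial X^2 + p, over any commutative ring:
  multiplying the remainder a + b X by X gives a X - p b.\<close>

lemma quad_class_cases:
  fixes x :: "'a::comm_ring_1 poly set"
  assumes "x \<in> carrier (quad_ring p)"
  obtains a b where "x = quad_class p [:a, b:]"
proof -
  have "\<exists>a b. quad_poly p dvd f - [:a, b:]" for f :: "'a poly"
  proof (induction f)
    case 0
    show ?case by (intro exI[of _ 0]) simp
  next
    case (pCons c f)
    then obtain a b where "quad_poly p dvd f - [:a, b:]"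
      by blast
    then have "quad_poly p dvd [:0, 1:] * (f - [:a, b:]) + [:b:] * quad_poly p"
      by (intro dvd_add dvd_mult) auto
    also have "[:0, 1:] * (f - [:a, b:]) + [:b:] * quad_poly p = pCons c f - [:c - of_nat p * b, a:]"
      by (simp add: algebra_simps pCons_one)
    finally show ?case
      by blast
  qed
  then show thesis
    using assms that unfolding carrier_quad_ring by (auto simp: quad_class_eq_iff) (metis quad_class_eq_iff)
qed

text \<open>A nonzero multiple of X^2 + p has degree at least 2.\<close>

lemma quad_class_linear_eq_iff:
  fixes a b c d :: "'a::idom"
  shows "quad_class p [:a, b:] = quad_class p [:c, d:] \<longleftrightarrow> a = c \<and> b = d"
proof
  assume "quad_class p [:a, b:] = quad_class p [:c, d:]"
  then have dvd: "quad_poly p dvd [:a - c, b - d:]"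
    by (simp add: quad_class_eq_iff)
  have "[:a - c, b - d:] = 0"
  proof (rule ccontr)
    assume "[:a - c, b - d:] \<noteq> 0"
    then have "degree (quad_poly p :: 'a poly) \<le> degree [:a - c, b - d:]"
      using dvd by (intro dvd_imp_degree_le)
    then show False
      by (auto split: if_splits)
  qed
  then show "a = c \<and> b = d"
    by simp
qed simp

text \<open>Coordinates with respect to 1 and \<omega> = \<pi> - 1, hence the class of a + b (X -
  1).\<close>

definition R_elem :: "nat \<Rightarrow> zz2 \<Rightarrow> zz2 \<Rightarrow> zz2 poly set" where
  "R_elem p a b = quad_class p [:a - b, b:]"

lemma R_elem_closed [simp]: "R_elem p a b \<in> carrier (R_ring p)"
  by (simp add: R_elem_def)

lemma R_elem_eq_iff [simp]: "R_elem p a b = R_elem p c d \<longleftrightarrow> a = c \<and> b = d"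
  by (auto simp: R_elem_def quad_class_linear_eq_iff)

lemma R_elem_cases:
  assumes "x \<in> carrier (R_ring p)"
  obtains a b where "x = R_elem p a b"
proof -
  obtain a b where "x = quad_class p [:a, b:]"
    using assms by (rule quad_class_cases)
  then have "x = R_elem p (a + b) b"
    by (simp add: R_elem_def)
  then show thesis
    by (rule that)
qed

lemma R_elem_add: "R_elem p a b \<oplus>\<^bsub>R_ring p\<^esub> R_elem p c d = R_elem p (a + c) (b + d)"
  by (simp add: R_elem_def quad_class_add algebra_simps)

lemma R_elem_diff: "R_elem p a b \<ominus>\<^bsub>R_ring p\<^esub> R_elem p c d = R_elem p (a - c) (b - d)"
  by (simp add: R_elem_def quad_class_diff algebra_simps)

text \<open>The rule \<omega>^2 = - 2 \<omega> - 4 q; the product of the representatives has leading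
  coefficient \<open>b * d\<close>, which is thus the quotient by X^2 + p.\<close>

lemma R_elem_mult:
  assumes "4 * q = (of_nat p + 1 :: zz2)"
  shows "R_elem p a b \<otimes>\<^bsub>R_ring p\<^esub> R_elem p c d =
    R_elem p (a * c - 4 * q * (b * d)) (a * d + b * c - 2 * (b * d))"
proof -
  have p: "of_nat p = 4 * q - 1"
    using assms by simp
  have "[:a - b, b:] * [:c - d, d:] -
      [:(a * c - 4 * q * (b * d)) - (a * d + b * c - 2 * (b * d)), a * d + b * c - 2 * (b * d):]
    = [:b * d:] * quad_poly p"
    by (simp add: p algebra_simps)
  then show ?thesis
    unfolding R_elem_def quad_class_mult quad_class_eq_iff by (simp only: dvd_triv_right)
qed

lemma zz2_to_R_eq: "zz2_to_R p a = R_elem p a 0"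
  by (simp add: zz2_to_R_def R_elem_def)

lemma omega_eq: "omega p = R_elem p 0 1"
  by (simp add: omega_def R_elem_def quad_class_one quad_class_diff one_pCons)

text \<open>\<open>R_elem p a b\<close> is \<open>a + b \<omega>\<close> and \<open>w\<close> is the action of
  \<open>\<omega>\<close> in coordinates.\<close>

definition coordinatized :: "nat \<Rightarrow> (zz2 poly set, 'm) module \<Rightarrow> 'i set \<Rightarrow>
    (('i \<Rightarrow> zz2) \<Rightarrow> 'i \<Rightarrow> zz2) \<Rightarrow> (('i \<Rightarrow> zz2) \<Rightarrow> 'm) \<Rightarrow> bool" where
  "coordinatized p N I w \<phi> \<longleftrightarrow> (\<forall>x\<in>coords I. w x \<in> coords I) \<and>
     bij_betw \<phi> (coords I) (carrier N) \<and>
     (\<forall>x\<in>coords I. \<forall>y\<in>coords I. \<phi> (x + y) = \<phi> x \<oplus>\<^bsub>N\<^esub> \<phi> y) \<and>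
     (\<forall>a b. \<forall>x\<in>coords I. \<phi> (a *\<^sub>2 x + b *\<^sub>2 w x) = R_elem p a b \<odot>\<^bsub>N\<^esub> \<phi> x)"

lemma coordinatized_R:
  assumes "4 * q = (of_nat p + 1 :: zz2)"
  shows "coordinatized p (regular_module (R_ring p)) UNIV (R_op q) (\<lambda>c. R_elem p (c False) (c True))"
  unfolding coordinatized_def
proof (intro conjI ballI allI)
  show "bij_betw (\<lambda>c. R_elem p (c False) (c True)) (coords UNIV) (carrier (regular_module (R_ring p)))"
  proof (rule bij_betwI')
    fix c d :: "bool \<Rightarrow> zz2"
    show "R_elem p (c False) (c True) = R_elem p (d False) (d True) \<longleftrightarrow> c = d"
      by (auto simp: fun_eq_iff all_bool_eq)
  next
    fix x assume "x \<in> carrier (regular_module (R_ring p))"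
    then obtain a b where "x = R_elem p a b"
      by (auto simp: regular_module_def elim: R_elem_cases)
    then show "\<exists>c\<in>coords UNIV. x = R_elem p (c False) (c True)"
      by (intro bexI[of _ "\<lambda>t. if t then b else a"]) (auto simp: coords_def)
  qed (simp add: regular_module_def)
qed (simp_all add: regular_module_def R_elem_add R_elem_mult[OF assms] R_op_closed,
     simp add: R_op_def algebra_simps)

text \<open>The value 2 a of \<omega> satisfies the quadratic relation, so c + d \<omega> may be
  evaluated to c + 2 a d. The principal ideal is the kernel of this evaluation, and every coset
  contains exactly one constant.\<close>

lemma coordinatized_R_mod_omega:
  assumes q: "4 * q = (of_nat p + 1 :: zz2)" and root: "a * a + a + q = 0"
  shows "coordinatized p (R_mod_omega p a) UNIV (scalar_op a)
    (\<lambda>c. PIdl\<^bsub>R_ring p\<^esub> R_elem p (- (2 * a)) 1 +>\<^bsub>R_ring p\<^esub> R_elem p (c ()) 0)"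
proof -
  let ?g = "R_elem p (- (2 * a)) 1"
  let ?I = "PIdl\<^bsub>R_ring p\<^esub> ?g"
  have gen: "omega p \<ominus>\<^bsub>R_ring p\<^esub> zz2_to_R p (2 * a) = ?g"
    by (simp add: omega_eq zz2_to_R_eq R_elem_diff)
  have ideal: "ideal ?I (R_ring p)"
    by (rule quad.cgenideal_ideal) simp
  interpret h: ring_hom_cring "R_ring p" "R_ring p Quot ?I" "(+>\<^bsub>R_ring p\<^esub>) ?I"
    by (rule ideal.rcos_ring_hom_cring[OF ideal quad_ring_cring])
  have mem: "R_elem p c d \<in> ?I \<longleftrightarrow> c = - 2 * a * d" for c d
  proof
    assume "R_elem p c d \<in> ?I"
    then obtain x where "x \<in> carrier (R_ring p)" "R_elem p c d = x \<otimes>\<^bsub>R_ring p\<^esub> ?g"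
      by (auto simp: cgenideal_def)
    then obtain s t where "R_elem p c d = R_elem p s t \<otimes>\<^bsub>R_ring p\<^esub> ?g"
      using R_elem_cases by metis
    then have c: "c = - 2 * a * s - 4 * q * t" and d: "d = s - 2 * a * t - 2 * t"
      by (simp_all add: R_elem_mult[OF q] algebra_simps)
    \<comment> \<open>This is the value at \<omega> = 2 a of a multiple of \<omega> - 2 a.\<close>
    have "c + 2 * a * d = - 4 * t * (a * a + a + q)"
      unfolding c d by (simp add: algebra_simps)
    then show "c = - 2 * a * d"
      by (simp add: root eq_neg_iff_add_eq_0)
  next
    assume "c = - 2 * a * d"
    then have "R_elem p c d = R_elem p d 0 \<otimes>\<^bsub>R_ring p\<^esub> ?g"
      by (simp add: R_elem_mult[OF q] mult_ac)
    then show "R_elem p c d \<in> ?I"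
      unfolding cgenideal_def using R_elem_closed by blast
  qed
  have cos_eq: "?I +>\<^bsub>R_ring p\<^esub> R_elem p c d = ?I +>\<^bsub>R_ring p\<^esub> R_elem p c' d' \<longleftrightarrow>
      c - c' = - 2 * a * (d - d')" for c d c' d'
    by (simp only: ideal.rcos_eq_iff[OF ideal R_elem_closed R_elem_closed] R_elem_diff mem)
  have carr: "carrier (R_mod_omega p a) = (\<lambda>x. ?I +>\<^bsub>R_ring p\<^esub> x) ` carrier (R_ring p)"
    unfolding R_mod_omega_def quotient_module_def gen
    by (simp only: restrict_scalars_def regular_module_def FactRing_def A_RCOSETS_def'
        partial_object.select_convs) blast
  show ?thesis
    unfolding coordinatized_def
  proof (intro conjI ballI allI)
    show "bij_betw (\<lambda>c. ?I +>\<^bsub>R_ring p\<^esub> R_elem p (c ()) 0) (coords UNIV) (carrier (R_mod_omega p a))"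
    proof (rule bij_betwI')
      fix c d :: "unit \<Rightarrow> zz2"
      show "?I +>\<^bsub>R_ring p\<^esub> R_elem p (c ()) 0 = ?I +>\<^bsub>R_ring p\<^esub> R_elem p (d ()) 0 \<longleftrightarrow> c = d"
        by (auto simp: cos_eq fun_eq_iff)
    next
      fix x assume "x \<in> carrier (R_mod_omega p a)"
      then obtain c d where "x = ?I +>\<^bsub>R_ring p\<^esub> R_elem p c d"
        unfolding carr using R_elem_cases by blast
      then have "x = ?I +>\<^bsub>R_ring p\<^esub> R_elem p (c + 2 * a * d) 0"
        by (simp add: cos_eq)
      then show "\<exists>c\<in>coords UNIV. x = ?I +>\<^bsub>R_ring p\<^esub> R_elem p (c ()) 0"
        by (intro bexI[of _ "\<lambda>_. c + 2 * a * d"]) (auto simp: coords_def)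
    qed (simp add: carr)
  next
    fix c d :: "unit \<Rightarrow> zz2"
    show "?I +>\<^bsub>R_ring p\<^esub> R_elem p ((c + d) ()) 0 =
      (?I +>\<^bsub>R_ring p\<^esub> R_elem p (c ()) 0) \<oplus>\<^bsub>R_mod_omega p a\<^esub> (?I +>\<^bsub>R_ring p\<^esub> R_elem p (d ()) 0)"
      unfolding R_mod_omega_def quotient_module_def gen
      using h.hom_add[of "R_elem p (c ()) 0" "R_elem p (d ()) 0"]
      by (simp add: restrict_scalars_def regular_module_def R_elem_add)
  next
    fix s t and c :: "unit \<Rightarrow> zz2"
    have "?I +>\<^bsub>R_ring p\<^esub> R_elem p ((s *\<^sub>2 c + t *\<^sub>2 scalar_op a c) ()) 0 =
        ?I +>\<^bsub>R_ring p\<^esub> (R_elem p s t \<otimes>\<^bsub>R_ring p\<^esub> R_elem p (c ()) 0)"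
      unfolding R_elem_mult[OF q] cos_eq by (simp add: scalar_op_def algebra_simps)
    then show "?I +>\<^bsub>R_ring p\<^esub> R_elem p ((s *\<^sub>2 c + t *\<^sub>2 scalar_op a c) ()) 0 =
      R_elem p s t \<odot>\<^bsub>R_mod_omega p a\<^esub> (?I +>\<^bsub>R_ring p\<^esub> R_elem p (c ()) 0)"
      unfolding R_mod_omega_def quotient_module_def gen
      using h.hom_mult[of "R_elem p s t" "R_elem p (c ()) 0"]
      by (simp add: restrict_scalars_def regular_module_def)
  qed (simp add: coords_def)
qed

section \<open>The ring of integers of E\<close>

lemma Fract_one_eq_to_fract: "(\<lambda>z. Fract z 1) = to_fract"
  by (simp add: fun_eq_iff to_fract_def)

lemma to_fract_of_nat [simp]: "to_fract (of_nat n) = of_nat n"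
  by (induction n) simp_all

lemma R_to_E_quad_class: "R_to_E p (quad_class p f) = quad_class p (fract_poly f)"
proof -
  have f: "f \<in> quad_class p f"
    by (simp add: mem_quad_class_iff)
  have "quad_class p (fract_poly g) = quad_class p (fract_poly f)" if "g \<in> quad_class p f" for g
  proof -
    have "quad_poly p dvd g - f"
      using that by (simp add: mem_quad_class_iff)
    then have "fract_poly (quad_poly p) dvd fract_poly (g - f)"
      by (rule fract_poly_dvd)
    moreover have "fract_poly (quad_poly p :: zz2 poly) = quad_poly p"
      by (simp add: to_fract_of_nat map_poly_pCons)
    ultimately show ?thesis
      by (simp add: quad_class_eq_iff)
  qed
  then have "(\<lambda>f. quad_class p (fract_poly f)) ` quad_class p f = {quad_class p (fract_poly f)}"
    using f by blast
  then show ?thesis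
    unfolding R_to_E_def Fract_one_eq_to_fract by simp
qed

lemma to_fract_numeral [simp]: "to_fract (numeral n) = numeral n"
  by (metis of_nat_numeral to_fract_of_nat)

lemma to_fract_power [simp]: "to_fract (x ^ n) = to_fract x ^ n"
  by (induction n) simp_all

lemma two_neq_zero_fract [simp]: "(2 :: zz2 fract) \<noteq> 0"
  using to_fract_eq_0_iff[of "2 :: zz2"] by simp

lemma quad_class_addI: "quad_class p f = quad_class p f' \<Longrightarrow> quad_class p g = quad_class p g' \<Longrightarrow>
    quad_class p (f + g) = quad_class p (f' + g')"
  by (simp flip: quad_class_add)

lemma quad_class_multI: "quad_class p f = quad_class p f' \<Longrightarrow> quad_class p g = quad_class p g' \<Longrightarrow>
    quad_class p (f * g) = quad_class p (f' * g')"
  by (simp flip: quad_class_mult)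

lemma quad_class_powerI: "quad_class p f = quad_class p g \<Longrightarrow> quad_class p (f ^ n) = quad_class p (g ^ n)"
  by (simp flip: quad_class_power)

text \<open>\<open>O_poly a b\<close> represents \<open>a + b \<alpha>\<close> with \<open>\<alpha> = (\<pi> - 1) / 2\<close>.\<close>

definition O_poly :: "zz2 \<Rightarrow> zz2 \<Rightarrow> zz2 fract poly" where
  "O_poly a b = [:to_fract a - to_fract b / 2, to_fract b / 2:]"

lemma O_poly_add: "O_poly a b + O_poly c d = O_poly (a + c) (b + d)"
  by (simp add: O_poly_def add_divide_distrib algebra_simps)

lemma O_poly_eqI: "to_fract b = 2 * u \<Longrightarrow> O_poly a b = [:to_fract a - u, u:]"
  by (simp add: O_poly_def)

lemma smult_O_poly: "Polynomial.smult (to_fract c) (O_poly a b) = O_poly (c * a) (c * b)"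
  by (simp add: O_poly_def algebra_simps)

lemma O_poly_const: "O_poly a 0 = [:to_fract a:]"
  by (simp add: O_poly_def)

lemma quad_class_O_poly_eq_iff:
  "quad_class p (O_poly a b) = quad_class p (O_poly c d) \<longleftrightarrow> a = c \<and> b = d"
  by (auto simp: O_poly_def quad_class_linear_eq_iff)

lemma smult_sum: "Polynomial.smult c (\<Sum>i\<in>A. f i) = (\<Sum>i\<in>A. Polynomial.smult c (f i))"
  by (induction A rule: infinite_finite_induct) (simp_all add: smult_add_right)

lemma of_nat_eq_fract:
  assumes "4 * q = (of_nat p + 1 :: zz2)"
  shows "(of_nat p :: zz2 fract) = 4 * to_fract q - 1"
proof -
  have "to_fract (4 * q) = to_fract (of_nat p + 1)"
    using assms by simp
  then show ?thesis
    by simp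
qed

lemma quad_class_O_poly_mult:
  assumes "4 * q = (of_nat p + 1 :: zz2)"
  shows "quad_class p (O_poly a b * O_poly c d) =
    quad_class p (O_poly (a * c - q * (b * d)) (a * d + b * c - b * d))"
proof -
  \<comment> \<open>Halving b and d in the fraction field removes all denominators, so that a
    polynomial identity remains; \<open>u * v\<close> is the leading coefficient of the
    product.\<close>
  define u v where "u = to_fract b / 2" and "v = to_fract d / 2"
  have b: "to_fract b = 2 * u" and d: "to_fract d = 2 * v"
    by (simp_all add: u_def v_def)
  have "to_fract (a * d + b * c - b * d) = 2 * (to_fract a * v + u * to_fract c - 2 * u * v)"
    by (simp add: b d algebra_simps)
  note prod = O_poly_eqI[OF this]
  have "O_poly a b * O_poly c d - O_poly (a * c - q * (b * d)) (a * d + b * c - b * d)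
      = [:u * v:] * quad_poly p"
    unfolding prod O_poly_eqI[OF b] O_poly_eqI[OF d]
    by (simp add: of_nat_eq_fract[OF assms] b d algebra_simps)
  then show ?thesis
    unfolding quad_class_eq_iff by (simp only: dvd_triv_right)
qed

text \<open>All polynomials whose class lies in Z_2[\<alpha>]. The set is closed under congruence
  modulo X^2 + p, so sums, products and powers can be treated on representatives.\<close>

definition O_polys :: "nat \<Rightarrow> zz2 fract poly set" where
  "O_polys p = {f. \<exists>a b. quad_class p f = quad_class p (O_poly a b)}"

lemma O_polys_O_poly [simp]: "O_poly a b \<in> O_polys p"
  by (auto simp: O_polys_def)

lemma O_polys_add: "f \<in> O_polys p \<Longrightarrow> g \<in> O_polys p \<Longrightarrow> f + g \<in> O_polys p"
  unfolding O_polys_def using quad_class_addI O_poly_add by (smt (verit, best) mem_Collect_eq)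

lemma O_polys_smult:
  assumes "f \<in> O_polys p"
  shows "Polynomial.smult (to_fract c) f \<in> O_polys p"
proof -
  obtain a b where "quad_class p f = quad_class p (O_poly a b)"
    using assms by (auto simp: O_polys_def)
  then have "quad_class p ([:to_fract c:] * f) = quad_class p ([:to_fract c:] * O_poly a b)"
    by (intro quad_class_multI) auto
  then show ?thesis
    by (auto simp: O_polys_def smult_O_poly)
qed

lemma O_polys_mult:
  assumes "4 * q = (of_nat p + 1 :: zz2)" "f \<in> O_polys p" "g \<in> O_polys p"
  shows "f * g \<in> O_polys p"
proof -
  obtain a b c d where "quad_class p f = quad_class p (O_poly a b)" "quad_class p g = quad_class p (O_poly c d)"
    using assms(2,3) by (auto simp: O_polys_def)
  then have "quad_class p (f * g) = quad_class p (O_poly a b * O_poly c d)"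
    by (rule quad_class_multI)
  then show ?thesis
    unfolding O_polys_def quad_class_O_poly_mult[OF assms(1)] by blast
qed

lemma O_polys_power:
  assumes "4 * q = (of_nat p + 1 :: zz2)" "f \<in> O_polys p"
  shows "f ^ n \<in> O_polys p"
proof (induction n)
  case 0
  then show ?case
    using O_polys_O_poly[of 1 0 p] by (simp add: O_poly_const flip: one_pCons)
qed (simp add: O_polys_mult[OF assms])

lemma O_polys_sum: "(\<And>i. i \<in> A \<Longrightarrow> f i \<in> O_polys p) \<Longrightarrow> sum f A \<in> O_polys p"
proof (induction A rule: infinite_finite_induct)
  case (infinite A)
  then show ?case using O_polys_O_poly[of 0 0 p] by (simp add: O_poly_def)
next
  case empty
  then show ?case using O_polys_O_poly[of 0 0 p] by (simp add: O_poly_def)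
qed (simp add: O_polys_add)

lemma integral_quad_class_iff:
  "integral_over_zz2 p (quad_class p f) \<longleftrightarrow>
    (\<exists>g :: zz2 poly. lead_coeff g = 1 \<and>
      quad_class p (\<Sum>i\<le>degree g. Polynomial.smult (to_fract (coeff g i)) (f ^ i)) = quad_class p 0)"
proof -
  have "(\<Oplus>\<^bsub>E_ring p\<^esub> i \<in> {..degree g}. R_to_E p (zz2_to_R p (coeff g i)) \<otimes>\<^bsub>E_ring p\<^esub>
      (quad_class p f [^]\<^bsub>E_ring p\<^esub> i)) = quad_class p (\<Sum>i\<le>degree g. Polynomial.smult (to_fract (coeff g i)) (f ^ i))"
    for g :: "zz2 poly"
  proof -
    have "R_to_E p (zz2_to_R p c) = quad_class p [:to_fract c:]" for c
      by (simp add: zz2_to_R_def R_to_E_quad_class map_poly_pCons)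
    then show ?thesis
      by (simp add: quad_class_power quad_class_mult quad_class_finsum)
  qed
  then show ?thesis
    unfolding integral_over_zz2_def by (simp add: quad_class_zero)
qed

lemma integral_O_poly:
  assumes q: "4 * q = (of_nat p + 1 :: zz2)"
  shows "integral_over_zz2 p (quad_class p (O_poly a b))"
proof -
  \<comment> \<open>The characteristic polynomial of a + b \<alpha>: the conjugate of \<alpha> is -
    1 - \<alpha>, so the trace is 2 a - b and the norm is a^2 - a b + q b^2.\<close>
  let ?g = "[:a * a - a * b + q * (b * b), b - 2 * a, 1:]"
  have "quad_class p (O_poly a b ^ 2) = quad_class p (O_poly (a * a - q * (b * b)) (a * b + b * a - b * b))"
    unfolding power2_eq_square by (rule quad_class_O_poly_mult[OF q])
  then have "quad_class p (([:to_fract (a * a - a * b + q * (b * b)):] + Polynomial.smult (to_fract (b - 2 * a)) (O_poly a b)) + O_poly a b ^ 2)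
     = quad_class p (([:to_fract (a * a - a * b + q * (b * b)):] + Polynomial.smult (to_fract (b - 2 * a)) (O_poly a b)) + O_poly (a * a - q * (b * b)) (a * b + b * a - b * b))"
    by (intro quad_class_addI refl)
  also have "([:to_fract (a * a - a * b + q * (b * b)):] + Polynomial.smult (to_fract (b - 2 * a)) (O_poly a b)) + O_poly (a * a - q * (b * b)) (a * b + b * a - b * b) = 0"
    unfolding O_poly_const[symmetric] smult_O_poly O_poly_add by (simp add: O_poly_def algebra_simps)
  finally have "quad_class p (\<Sum>i\<le>degree ?g. Polynomial.smult (to_fract (coeff ?g i)) (O_poly a b ^ i)) = quad_class p 0"
    by (simp add: numeral_2_eq_2)
  then show ?thesis
    unfolding integral_quad_class_iff by (intro exI[of _ ?g]) simp
qed

lemma zz2_eq_power_two_times_unit: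
  assumes "(x :: zz2) \<noteq> 0"
  obtains n u where "x = 2 ^ n * u" "\<not> 2 dvd u"
proof -
  obtain m where "\<not> 2 ^ m dvd x"
    using assms zz2_eq_zeroI by blast
  define m' where "m' = (LEAST m. \<not> 2 ^ m dvd x)"
  have m': "\<not> 2 ^ m' dvd x" and least: "\<And>k. k < m' \<Longrightarrow> 2 ^ k dvd x"
    unfolding m'_def using \<open>\<not> 2 ^ m dvd x\<close> by (rule LeastI, use not_less_Least in blast)
  obtain n where n: "m' = Suc n"
    using m' by (cases m') auto
  then obtain u where u: "x = 2 ^ n * u"
    using least[of n] by (auto elim: dvdE)
  have "\<not> 2 dvd u"
    using m' unfolding n u by (auto simp: mult.assoc)
  then show thesis
    using u that by blast
qed

text \<open>A denominator is a power of 2 times an odd element, and odd elements are units.\<close>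

lemma power_two_times_fract:
  obtains n a where "2 ^ n * (x :: zz2 fract) = to_fract a"
proof (cases x)
  case (Fract a b)
  obtain n u where b: "b = 2 ^ n * u" and "\<not> 2 dvd u"
    using zz2_eq_power_two_times_unit Fract(2) by blast
  then obtain u' where u': "u * u' = 1"
    using odd_zz2_unit by (metis dvdE)
  have "to_fract u * to_fract u' = 1"
    using arg_cong[OF u', of to_fract] by simp
  then have "to_fract u' = 1 / to_fract u"
    by (metis nonzero_mult_div_cancel_left mult_zero_left zero_neq_one)
  then have "2 ^ n * x = to_fract (a * u')"
    unfolding Fract(1) Fract_conv_to_fract b by simp
  then show thesis
    by (rule that)
qed

text \<open>If \<open>x\<close> is integral with minimal denominator \<open>2 ^ k\<close> and \<open>k > 0\<close>, then \<open>y = 2 ^ k x\<close> has odd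
  norm \<open>N\<close>, but the equation of \<open>x\<close> makes \<open>y ^ n\<close> divisible by 2 and hence \<open>N ^ n\<close> even.\<close>

lemma integral_imp_O_poly:
  assumes q: "4 * q = (of_nat p + 1 :: zz2)" and "\<not> 2 dvd q"
    and int: "integral_over_zz2 p (quad_class p f)"
  shows "f \<in> O_polys p"
proof -
  obtain c d where cd: "quad_class p f = quad_class p [:c, d:]"
    using quad_class_cases[OF quad_class_closed] by blast
  define F where "F = [:c, d:]"
  have "\<exists>k a b. Polynomial.smult (2 ^ k) F = O_poly a b"
  proof -
    obtain m a where a: "2 ^ m * (c + d) = to_fract a"
      by (rule power_two_times_fract)
    obtain n b where b: "2 ^ n * (2 * d) = to_fract b"
      by (rule power_two_times_fract)
    \<comment> \<open>In terms of \<alpha> one has c + d X = (c + d) + (2 d) \<alpha>, so these are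
      the two coordinates whose denominators have to be cleared.\<close>
    have "2 ^ (m + n) * (c + d) = to_fract (2 ^ n * a)" "2 ^ (m + n) * (2 * d) = to_fract (2 ^ m * b)"
      using a b by (simp_all add: power_add mult_ac)
    moreover have "Polynomial.smult (2 ^ (m + n)) F = [:2 ^ (m + n) * (c + d) - 2 ^ (m + n) * (2 * d) / 2, 2 ^ (m + n) * (2 * d) / 2:]"
      by (simp add: F_def algebra_simps)
    ultimately have "Polynomial.smult (2 ^ (m + n)) F = O_poly (2 ^ n * a) (2 ^ m * b)"
      unfolding O_poly_def by (simp only:)
    then show ?thesis
      by blast
  qed
  define k where "k = (LEAST k. \<exists>a b. Polynomial.smult (2 ^ k) F = O_poly a b)"
  obtain a b where ab: "Polynomial.smult (2 ^ k) F = O_poly a b"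
    using LeastI_ex[OF \<open>\<exists>k a b. Polynomial.smult (2 ^ k) F = O_poly a b\<close>] unfolding k_def by blast
  have "k = 0"
  proof (rule ccontr)
    assume "k \<noteq> 0"
    have "\<not> (2 dvd a \<and> 2 dvd b)"
    proof
      assume "2 dvd a \<and> 2 dvd b"
      then obtain a' b' where "a = 2 * a'" "b = 2 * b'"
        by (auto elim!: dvdE)
      then have "Polynomial.smult 2 (Polynomial.smult (2 ^ (k - 1)) F) = Polynomial.smult 2 (O_poly a' b')"
        using ab \<open>k \<noteq> 0\<close> smult_O_poly[of 2 a' b'] by (simp flip: power_Suc)
      from arg_cong[OF this, of "Polynomial.smult (1 / 2)"]
      have "Polynomial.smult (2 ^ (k - 1)) F = O_poly a' b'"
        by simp
      then have "k \<le> k - 1"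
        unfolding k_def by (intro Least_le) blast
      then show False
        using \<open>k \<noteq> 0\<close> by simp
    qed
    define N where "N = a * a - a * b + q * (b * b)"
    have N: "\<not> 2 dvd N"
      using \<open>\<not> (2 dvd a \<and> 2 dvd b)\<close> \<open>\<not> 2 dvd q\<close>
      by (auto simp: N_def two_dvd_add_zz2 two_dvd_diff_zz2 two_dvd_mult_zz2)
    obtain g :: "zz2 poly" where g: "lead_coeff g = 1"
      and eq: "quad_class p (\<Sum>i\<le>degree g. Polynomial.smult (to_fract (coeff g i)) (F ^ i)) = quad_class p 0"
      using int unfolding cd integral_quad_class_iff F_def by blast
    define n where "n = degree g"
    \<comment> \<open>Multiplying the equation by \<open>2 ^ (k * n)\<close> turns its i-th term
      into \<open>2 ^ (k * (n - i))\<close> times the coefficient times the i-th power of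
      \<open>O_poly a b\<close>. For i < n the exponent is positive because k > 0; the subtracted 1
      is the factor 2 put in front of G.\<close>
    define G where "G = (\<Sum>i<n. Polynomial.smult (to_fract (2 ^ (k * (n - i) - 1) * coeff g i)) (O_poly a b ^ i))"
    have "Polynomial.smult (2 ^ (k * n)) (\<Sum>i\<le>n. Polynomial.smult (to_fract (coeff g i)) (F ^ i)) = O_poly a b ^ n + Polynomial.smult 2 G"
    proof -
      have "Polynomial.smult (2 ^ (k * n)) (Polynomial.smult (to_fract (coeff g i)) (F ^ i)) =
        Polynomial.smult 2 (Polynomial.smult (to_fract (2 ^ (k * (n - i) - 1) * coeff g i)) (O_poly a b ^ i))" if "i < n" for i
      proof -
        have "k * n = k * (n - i) + k * i"
          using that by (simp flip: distrib_left)
        moreover have "0 < k * (n - i)"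
          using that \<open>k \<noteq> 0\<close> by simp
        ultimately have "k * n = Suc (k * (n - i) - 1) + k * i"
          by linarith
        then have "(2 :: zz2 fract) ^ (k * n) = 2 * 2 ^ (k * (n - i) - 1) * (2 ^ k) ^ i"
          by (simp only: power_add power_Suc power_mult)
        then show ?thesis
          by (simp add: ab[symmetric] smult_power mult_ac)
      qed
      moreover have "Polynomial.smult (2 ^ (k * n)) (Polynomial.smult (to_fract (coeff g n)) (F ^ n)) = O_poly a b ^ n"
        using g by (simp add: ab[symmetric] smult_power n_def power_mult)
      ultimately show ?thesis
        by (simp add: lessThan_Suc_atMost[symmetric] smult_add_right smult_sum G_def)
    qed
    moreover have "quad_class p ([:2 ^ (k * n):] * (\<Sum>i\<le>n. Polynomial.smult (to_fract (coeff g i)) (F ^ i))) = quad_class p ([:2 ^ (k * n):] * 0)"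
      using eq unfolding n_def by (intro quad_class_multI refl)
    ultimately have "quad_class p (O_poly a b ^ n + Polynomial.smult 2 G) = quad_class p 0"
      by simp
    \<comment> \<open>The factor \<open>O_poly (a - b) (- b)\<close> is the conjugate of a + b
      \<alpha>, so the leading term becomes the n-th power of the norm.\<close>
    then have "quad_class p ((O_poly a b ^ n + Polynomial.smult 2 G) * O_poly (a - b) (- b) ^ n) = quad_class p (0 * O_poly (a - b) (- b) ^ n)"
      by (intro quad_class_multI refl)
    then have zero: "quad_class p ((O_poly a b * O_poly (a - b) (- b)) ^ n + Polynomial.smult 2 (G * O_poly (a - b) (- b) ^ n)) = quad_class p 0"
      by (simp add: distrib_right power_mult_distrib)
    have "G * O_poly (a - b) (- b) ^ n \<in> O_polys p"
      unfolding G_def by (intro O_polys_mult[OF q] O_polys_sum O_polys_smult O_polys_power[OF q]) auto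
    then obtain s t where "quad_class p (G * O_poly (a - b) (- b) ^ n) = quad_class p (O_poly s t)"
      by (auto simp: O_polys_def)
    then have "quad_class p ([:2:] * (G * O_poly (a - b) (- b) ^ n)) = quad_class p ([:2:] * O_poly s t)"
      by (intro quad_class_multI refl)
    also have "[:2:] * O_poly s t = O_poly (2 * s) (2 * t)"
      using smult_O_poly[of 2 s t] by simp
    finally have even_part: "quad_class p (Polynomial.smult 2 (G * O_poly (a - b) (- b) ^ n)) =
        quad_class p (O_poly (2 * s) (2 * t))"
      by simp
    have "quad_class p (O_poly a b * O_poly (a - b) (- b)) = quad_class p (O_poly N 0)"
      unfolding quad_class_O_poly_mult[OF q] by (simp add: N_def algebra_simps)
    then have "quad_class p ((O_poly a b * O_poly (a - b) (- b)) ^ n) = quad_class p (O_poly N 0 ^ n)"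
      by (rule quad_class_powerI)
    also have "O_poly N 0 ^ n = O_poly (N ^ n) 0"
      unfolding O_poly_const by (induction n) (simp_all add: one_pCons)
    finally have "quad_class p (O_poly (N ^ n) 0 + O_poly (2 * s) (2 * t)) = quad_class p 0"
      using zero quad_class_addI[OF _ even_part] by metis
    then have "quad_class p (O_poly (N ^ n + 2 * s) (2 * t)) = quad_class p (O_poly 0 0)"
      unfolding O_poly_add by (simp add: O_poly_const)
    then have "N ^ n + 2 * s = 0"
      by (simp only: quad_class_O_poly_eq_iff)
    then have "2 dvd N ^ n"
      by (metis add_diff_cancel_left' diff_0 dvd_minus_iff dvd_triv_left add.commute)
    moreover have "\<not> 2 dvd N ^ n" for n
      by (induction n) (simp_all add: two_dvd_mult_zz2 N)
    ultimately show False
      by blast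
  qed
  then show ?thesis
    using ab cd by (auto simp: O_polys_def F_def)
qed

lemma coordinatized_O_E:
  assumes q: "4 * q = (of_nat p + 1 :: zz2)" and "\<not> 2 dvd q"
  shows "coordinatized p (O_E_module p) UNIV (O_op q) (\<lambda>c. quad_class p (O_poly (c False) (c True)))"
proof -
  have carr: "carrier (O_E_module p) = {x \<in> carrier (E_ring p). integral_over_zz2 p x}"
    by (simp add: O_E_module_def restrict_scalars_def regular_module_def O_E_ring_def)
  show ?thesis
    unfolding coordinatized_def
  proof (intro conjI ballI allI)
    show "bij_betw (\<lambda>c. quad_class p (O_poly (c False) (c True))) (coords UNIV) (carrier (O_E_module p))"
    proof (rule bij_betwI')
      fix c d :: "bool \<Rightarrow> zz2"
      show "quad_class p (O_poly (c False) (c True)) = quad_class p (O_poly (d False) (d True)) \<longleftrightarrow> c = d"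
        by (auto simp: quad_class_O_poly_eq_iff fun_eq_iff all_bool_eq)
    next
      fix x assume "x \<in> carrier (O_E_module p)"
      then obtain f where "x = quad_class p f" "integral_over_zz2 p (quad_class p f)"
        unfolding carr carrier_quad_ring by blast
      then obtain a b where "x = quad_class p (O_poly a b)"
        using integral_imp_O_poly[OF assms] unfolding O_polys_def by blast
      then show "\<exists>c\<in>coords UNIV. x = quad_class p (O_poly (c False) (c True))"
        by (intro bexI[of _ "\<lambda>t. if t then b else a"]) (auto simp: coords_def)
    qed (simp add: carr integral_O_poly[OF q])
  next
    fix s t and c :: "bool \<Rightarrow> zz2"
    \<comment> \<open>Because \<omega> = 2 \<alpha>, the scalar s + t \<omega> has coordinate 2 t at
      \<alpha>.\<close>
    have "R_to_E p (R_elem p s t) = quad_class p (O_poly s (2 * t))"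
      by (simp add: R_elem_def R_to_E_quad_class map_poly_pCons O_poly_def)
    then show "quad_class p (O_poly ((s *\<^sub>2 c + t *\<^sub>2 O_op q c) False) ((s *\<^sub>2 c + t *\<^sub>2 O_op q c) True)) =
      R_elem p s t \<odot>\<^bsub>O_E_module p\<^esub> quad_class p (O_poly (c False) (c True))"
      by (simp add: O_E_module_def restrict_scalars_def regular_module_def O_E_ring_def quad_class_mult
          quad_class_O_poly_mult[OF q] quad_class_O_poly_eq_iff O_op_def algebra_simps)
  qed (simp_all add: O_op_closed O_E_module_def restrict_scalars_def regular_module_def O_E_ring_def
      quad_class_add O_poly_add)
qed

section \<open>Coordinates on modules\<close>

lemma coordinatized_power:
  fixes N :: "(zz2 poly set, 'm) module"
  assumes N: "coordinatized p N I w \<phi>" and w: "w 0 = 0"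
  shows "coordinatized p (module_power N n) ({..<n} \<times> I) (pow_op w)
    (\<lambda>c. \<lambda>m\<in>{..<n}. \<phi> (\<lambda>i. c (m, i)))"
proof -
  have w_closed: "\<And>x. x \<in> coords I \<Longrightarrow> w x \<in> coords I"
    and bij: "bij_betw \<phi> (coords I) (carrier N)"
    and add: "\<And>x y. x \<in> coords I \<Longrightarrow> y \<in> coords I \<Longrightarrow> \<phi> (x + y) = \<phi> x \<oplus>\<^bsub>N\<^esub> \<phi> y"
    and act: "\<And>a b x. x \<in> coords I \<Longrightarrow> \<phi> (a *\<^sub>2 x + b *\<^sub>2 w x) = R_elem p a b \<odot>\<^bsub>N\<^esub> \<phi> x"
    using N unfolding coordinatized_def by blast+
  have slice: "(\<lambda>i. c (m, i)) \<in> coords I" if "c \<in> coords ({..<n} \<times> I)" for c and m :: nat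
    using that by (simp add: coords_def)
  let ?\<psi> = "\<lambda>c. \<lambda>m\<in>{..<n}. \<phi> (\<lambda>i. c (m, i))"
  show ?thesis
    unfolding coordinatized_def
  proof (intro conjI ballI allI)
    show "pow_op w x \<in> coords ({..<n} \<times> I)" if "x \<in> coords ({..<n} \<times> I)" for x
      using w_closed w that by (rule pow_op_closed)
  next
    show "bij_betw ?\<psi> (coords ({..<n} \<times> I)) (carrier (module_power N n))"
    proof (rule bij_betwI')
      fix c d assume cd: "c \<in> coords ({..<n} \<times> I)" "d \<in> coords ({..<n} \<times> I)"
      show "?\<psi> c = ?\<psi> d \<longleftrightarrow> c = d"
      proof
        assume eq: "?\<psi> c = ?\<psi> d"
        have "c (m, i) = d (m, i)" for m i
        proof (cases "m < n")
          case True
          then have "\<phi> (\<lambda>i. c (m, i)) = \<phi> (\<lambda>i. d (m, i))"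
            using fun_cong[OF eq, of m] by simp
          then have "(\<lambda>i. c (m, i)) = (\<lambda>i. d (m, i))"
            using bij slice[OF cd(1)] slice[OF cd(2)] by (auto simp: bij_betw_def inj_on_def)
          then show ?thesis
            by (rule fun_cong)
        qed (use cd in \<open>simp add: coords_def\<close>)
        then show "c = d"
          by (auto simp: fun_eq_iff)
      qed simp
    next
      fix c assume "c \<in> coords ({..<n} \<times> I)"
      then show "?\<psi> c \<in> carrier (module_power N n)"
        using bij slice by (auto simp: module_power_def bij_betw_def)
    next
      fix f assume f: "f \<in> carrier (module_power N n)"
      define c where "c = (\<lambda>(m, i). if m < n then inv_into (coords I) \<phi> (f m) i else 0)"
      have fN: "f m \<in> \<phi> ` coords I" if "m < n" for m
        using f that bij by (auto simp: module_power_def bij_betw_def)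
      have "c (m, i) = 0" if "(m, i) \<notin> {..<n} \<times> I" for m i
        using that inv_into_into[OF fN, of m] by (auto simp: c_def coords_def)
      then have "c \<in> coords ({..<n} \<times> I)"
        by (auto simp: coords_def)
      moreover have "f = ?\<psi> c"
      proof
        fix m
        show "f m = ?\<psi> c m"
        proof (cases "m < n")
          case True
          then have "(\<lambda>i. c (m, i)) = inv_into (coords I) \<phi> (f m)"
            by (simp add: c_def)
          then show ?thesis
            using True f_inv_into_f[OF fN[OF True]] by simp
        next
          case False
          \<comment> \<open>Elements of the power are extensional functions, so both sides are
            \<open>undefined\<close> from n on.\<close>
          have "f \<in> {..<n} \<rightarrow>\<^sub>E carrier N"
            using f by (simp add: module_power_def)
          then have "f m = undefined"
            using False by (intro PiE_arb[of f "{..<n}"]) auto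
          then show ?thesis
            using False by simp
        qed
      qed
      ultimately show "\<exists>c\<in>coords ({..<n} \<times> I). f = ?\<psi> c"
        by blast
    qed
  next
    fix c d assume cd: "c \<in> coords ({..<n} \<times> I)" "d \<in> coords ({..<n} \<times> I)"
    have "\<phi> (\<lambda>i. (c + d) (m, i)) = \<phi> (\<lambda>i. c (m, i)) \<oplus>\<^bsub>N\<^esub> \<phi> (\<lambda>i. d (m, i))" for m
      using add[OF slice[OF cd(1), of m] slice[OF cd(2), of m]] by (simp add: plus_fun_def)
    then show "?\<psi> (c + d) = ?\<psi> c \<oplus>\<^bsub>module_power N n\<^esub> ?\<psi> d"
      by (simp add: module_power_def fun_eq_iff)
  next
    fix a b c assume c: "c \<in> coords ({..<n} \<times> I)"
    have "\<phi> (\<lambda>i. (a *\<^sub>2 c + b *\<^sub>2 pow_op w c) (m, i)) = R_elem p a b \<odot>\<^bsub>N\<^esub> \<phi> (\<lambda>i. c (m, i))" for m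
      using act[OF slice[OF c, of m], of a b] by (simp add: plus_fun_def scale2_def pow_op_def)
    then show "?\<psi> (a *\<^sub>2 c + b *\<^sub>2 pow_op w c) = R_elem p a b \<odot>\<^bsub>module_power N n\<^esub> ?\<psi> c"
      by (simp add: module_power_def fun_eq_iff)
  qed
qed

lemma coordinatized_direct_sum:
  fixes M :: "(zz2 poly set, 'm) module" and N :: "(zz2 poly set, 'n) module"
  assumes M: "coordinatized p M I w \<phi>" and N: "coordinatized p N J w' \<psi>"
  shows "coordinatized p (direct_sum M N) (I <+> J) (sum_op w w') (\<lambda>c. (\<phi> (c \<circ> Inl), \<psi> (c \<circ> Inr)))"
proof -
  let ?\<chi> = "\<lambda>c. (\<phi> (c \<circ> Inl), \<psi> (c \<circ> Inr))"
  have w_closed: "\<And>x. x \<in> coords I \<Longrightarrow> w x \<in> coords I" "\<And>x. x \<in> coords J \<Longrightarrow> w' x \<in> coords J"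
    and bij: "bij_betw \<phi> (coords I) (carrier M)" "bij_betw \<psi> (coords J) (carrier N)"
    and add: "\<And>x y. x \<in> coords I \<Longrightarrow> y \<in> coords I \<Longrightarrow> \<phi> (x + y) = \<phi> x \<oplus>\<^bsub>M\<^esub> \<phi> y"
      "\<And>x y. x \<in> coords J \<Longrightarrow> y \<in> coords J \<Longrightarrow> \<psi> (x + y) = \<psi> x \<oplus>\<^bsub>N\<^esub> \<psi> y"
    and act: "\<And>a b x. x \<in> coords I \<Longrightarrow> \<phi> (a *\<^sub>2 x + b *\<^sub>2 w x) = R_elem p a b \<odot>\<^bsub>M\<^esub> \<phi> x"
      "\<And>a b x. x \<in> coords J \<Longrightarrow> \<psi> (a *\<^sub>2 x + b *\<^sub>2 w' x) = R_elem p a b \<odot>\<^bsub>N\<^esub> \<psi> x"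
    using M N unfolding coordinatized_def by blast+
  show ?thesis
    unfolding coordinatized_def
  proof (intro conjI ballI allI)
    show "sum_op w w' x \<in> coords (I <+> J)" if "x \<in> coords (I <+> J)" for x
      using w_closed that by (rule sum_op_closed)
  next
    show "bij_betw ?\<chi> (coords (I <+> J)) (carrier (direct_sum M N))"
    proof (rule bij_betwI')
      fix c d assume "c \<in> coords (I <+> J)" "d \<in> coords (I <+> J)"
      then have cd: "c \<circ> Inl \<in> coords I" "c \<circ> Inr \<in> coords J" "d \<circ> Inl \<in> coords I" "d \<circ> Inr \<in> coords J"
        by (simp_all add: coords_Plus)
      show "?\<chi> c = ?\<chi> d \<longleftrightarrow> c = d"
      proof
        assume "?\<chi> c = ?\<chi> d"
        then have "c \<circ> Inl = d \<circ> Inl" "c \<circ> Inr = d \<circ> Inr"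
          using bij cd by (auto simp: bij_betw_def inj_on_def)
        then have "c k = d k" for k
          by (cases k) (auto simp: fun_eq_iff)
        then show "c = d"
          by blast
      qed simp
    next
      fix c assume "c \<in> coords (I <+> J)"
      then show "?\<chi> c \<in> carrier (direct_sum M N)"
        using bij by (auto simp: coords_Plus direct_sum_def bij_betw_def)
    next
      fix x assume "x \<in> carrier (direct_sum M N)"
      then obtain y z where "y \<in> carrier M" "z \<in> carrier N" "x = (y, z)"
        by (auto simp: direct_sum_def)
      moreover obtain c where "c \<in> coords I" "y = \<phi> c"
        using bij(1) \<open>y \<in> carrier M\<close> by (auto simp: bij_betw_def)
      moreover obtain d where "d \<in> coords J" "z = \<psi> d"
        using bij(2) \<open>z \<in> carrier N\<close> by (auto simp: bij_betw_def)
      moreover have "case_sum c d \<circ> Inl = c" "case_sum c d \<circ> Inr = d"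
        by auto
      ultimately show "\<exists>c\<in>coords (I <+> J). x = ?\<chi> c"
        by (intro bexI[of _ "case_sum c d"]) (simp_all add: coords_Plus)
    qed
  next
    fix c d assume "c \<in> coords (I <+> J)" "d \<in> coords (I <+> J)"
    moreover have "(c + d) \<circ> Inl = (c \<circ> Inl) + (d \<circ> Inl)" "(c + d) \<circ> Inr = (c \<circ> Inr) + (d \<circ> Inr)"
      by (auto simp: fun_eq_iff)
    ultimately show "?\<chi> (c + d) = ?\<chi> c \<oplus>\<^bsub>direct_sum M N\<^esub> ?\<chi> d"
      using add by (simp add: direct_sum_def coords_Plus)
  next
    fix a b c assume "c \<in> coords (I <+> J)"
    moreover have "(a *\<^sub>2 c + b *\<^sub>2 sum_op w w' c) \<circ> Inl = a *\<^sub>2 (c \<circ> Inl) + b *\<^sub>2 w (c \<circ> Inl)"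
      "(a *\<^sub>2 c + b *\<^sub>2 sum_op w w' c) \<circ> Inr = a *\<^sub>2 (c \<circ> Inr) + b *\<^sub>2 w' (c \<circ> Inr)"
      by (auto simp: fun_eq_iff sum_op_def)
    ultimately show "?\<chi> (a *\<^sub>2 c + b *\<^sub>2 sum_op w w' c) = R_elem p a b \<odot>\<^bsub>direct_sum M N\<^esub> ?\<chi> c"
      using act by (simp add: direct_sum_def coords_Plus)
  qed
qed

lemma coordinatized_omega:
  assumes "coordinatized p N I w \<phi>" "x \<in> coords I"
  shows "\<phi> (w x) = R_elem p 0 1 \<odot>\<^bsub>N\<^esub> \<phi> x"
proof -
  have "\<phi> (0 *\<^sub>2 x + 1 *\<^sub>2 w x) = R_elem p 0 1 \<odot>\<^bsub>N\<^esub> \<phi> x"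
    using assms unfolding coordinatized_def by blast
  then show ?thesis
    by simp
qed

lemma coordinatized_scale:
  assumes "coordinatized p N I w \<phi>" "x \<in> coords I"
  shows "\<phi> (a *\<^sub>2 x) = R_elem p a 0 \<odot>\<^bsub>N\<^esub> \<phi> x"
proof -
  have "\<phi> (a *\<^sub>2 x + 0 *\<^sub>2 w x) = R_elem p a 0 \<odot>\<^bsub>N\<^esub> \<phi> x"
    using assms unfolding coordinatized_def by blast
  then show ?thesis
    by simp
qed

lemma module_isomorphic_imp_lattice_iso:
  assumes M: "coordinatized p M J v \<psi>" and N: "coordinatized p N I w \<phi>"
    and iso: "module_isomorphic (R_ring p) M N"
  shows "\<exists>\<Phi>. lattice_iso J v I w \<Phi>"
proof -
  obtain f where f: "f \<in> LinearCombinations.module_hom (R_ring p) M N" and bij_f: "bij_betw f (carrier M) (carrier N)"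
    using iso by (auto simp: module_isomorphic_def)
  have bij: "bij_betw \<phi> (coords I) (carrier N)" "bij_betw \<psi> (coords J) (carrier M)"
    and v: "\<And>x. x \<in> coords J \<Longrightarrow> v x \<in> coords J" and w: "\<And>x. x \<in> coords I \<Longrightarrow> w x \<in> coords I"
    and addN: "\<And>x y. x \<in> coords I \<Longrightarrow> y \<in> coords I \<Longrightarrow> \<phi> (x + y) = \<phi> x \<oplus>\<^bsub>N\<^esub> \<phi> y"
    and addM: "\<And>x y. x \<in> coords J \<Longrightarrow> y \<in> coords J \<Longrightarrow> \<psi> (x + y) = \<psi> x \<oplus>\<^bsub>M\<^esub> \<psi> y"
    using M N unfolding coordinatized_def by blast+
  define \<Phi> where "\<Phi> x = inv_into (coords I) \<phi> (f (\<psi> x))" for x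
  have \<psi>: "\<psi> x \<in> carrier M" if "x \<in> coords J" for x
    using bij(2) that by (auto simp: bij_betw_def)
  have \<Phi>: "\<Phi> x \<in> coords I" "\<phi> (\<Phi> x) = f (\<psi> x)" if "x \<in> coords J" for x
  proof -
    have "f (\<psi> x) \<in> \<phi> ` coords I"
      using \<psi>[OF that] bij_f bij(1) by (auto simp: bij_betw_def)
    then show "\<Phi> x \<in> coords I" "\<phi> (\<Phi> x) = f (\<psi> x)"
      unfolding \<Phi>_def by (rule inv_into_into, rule f_inv_into_f)
  qed
  have eqI: "\<Phi> x = y" if "x \<in> coords J" "y \<in> coords I" "\<phi> y = f (\<psi> x)" for x y
    using bij(1) \<Phi>[OF that(1)] that by (auto simp: bij_betw_def inj_on_def)
  have "lattice_iso J v I w \<Phi>"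
    unfolding lattice_iso_def
  proof (intro conjI ballI allI)
    have "bij_betw (inv_into (coords I) \<phi> \<circ> (f \<circ> \<psi>)) (coords J) (coords I)"
      by (rule bij_betw_trans[OF bij_betw_trans[OF bij(2) bij_f] bij_betw_inv_into[OF bij(1)]])
    moreover have "inv_into (coords I) \<phi> \<circ> (f \<circ> \<psi>) = \<Phi>"
      by (auto simp: \<Phi>_def fun_eq_iff)
    ultimately show "bij_betw \<Phi> (coords J) (coords I)"
      by simp
  next
    fix x y assume "x \<in> coords J" "y \<in> coords J"
    then show "\<Phi> (x + y) = \<Phi> x + \<Phi> y"
      by (intro eqI) (simp_all add: \<Phi> addN addM LinearCombinations.module_hom_add[OF f] \<psi>)
  next
    fix a x assume "x \<in> coords J"
    then show "\<Phi> (a *\<^sub>2 x) = a *\<^sub>2 \<Phi> x"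
      by (intro eqI) (simp_all add: \<Phi> coordinatized_scale[OF M] coordinatized_scale[OF N] LinearCombinations.module_hom_smult[OF f] \<psi>)
  next
    fix x assume "x \<in> coords J"
    then show "\<Phi> (v x) = w (\<Phi> x)"
      by (intro eqI) (simp_all add: \<Phi> v w coordinatized_omega[OF M] coordinatized_omega[OF N] LinearCombinations.module_hom_smult[OF f] \<psi>)
  qed
  then show ?thesis
    by blast
qed

text \<open>Conjugation by the coordinate maps. As every scalar is some a + b \<omega>,
  compatibility with Z_2 and with \<omega> already gives R-linearity.\<close>

lemma lattice_iso_imp_module_isomorphic:
  assumes M: "coordinatized p M J v \<psi>" and N: "coordinatized p N I w \<phi>"
    and \<Phi>: "lattice_iso J v I w \<Phi>"
  shows "module_isomorphic (R_ring p) M N"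
proof -
  have bij: "bij_betw \<phi> (coords I) (carrier N)" "bij_betw \<psi> (coords J) (carrier M)"
    and v: "\<And>x. x \<in> coords J \<Longrightarrow> v x \<in> coords J" and w: "\<And>x. x \<in> coords I \<Longrightarrow> w x \<in> coords I"
    and addN: "\<And>x y. x \<in> coords I \<Longrightarrow> y \<in> coords I \<Longrightarrow> \<phi> (x + y) = \<phi> x \<oplus>\<^bsub>N\<^esub> \<phi> y"
    and addM: "\<And>x y. x \<in> coords J \<Longrightarrow> y \<in> coords J \<Longrightarrow> \<psi> (x + y) = \<psi> x \<oplus>\<^bsub>M\<^esub> \<psi> y"
    and actN: "\<And>a b x. x \<in> coords I \<Longrightarrow> \<phi> (a *\<^sub>2 x + b *\<^sub>2 w x) = R_elem p a b \<odot>\<^bsub>N\<^esub> \<phi> x"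
    and actM: "\<And>a b x. x \<in> coords J \<Longrightarrow> \<psi> (a *\<^sub>2 x + b *\<^sub>2 v x) = R_elem p a b \<odot>\<^bsub>M\<^esub> \<psi> x"
    using M N unfolding coordinatized_def by blast+
  have \<Phi>_bij: "bij_betw \<Phi> (coords J) (coords I)"
    and \<Phi>_add: "\<And>x y. x \<in> coords J \<Longrightarrow> y \<in> coords J \<Longrightarrow> \<Phi> (x + y) = \<Phi> x + \<Phi> y"
    and \<Phi>_scale: "\<And>a x. x \<in> coords J \<Longrightarrow> \<Phi> (a *\<^sub>2 x) = a *\<^sub>2 \<Phi> x"
    and \<Phi>_op: "\<And>x. x \<in> coords J \<Longrightarrow> \<Phi> (v x) = w (\<Phi> x)"
    using \<Phi> unfolding lattice_iso_def by blast+
  define f where "f m = \<phi> (\<Phi> (inv_into (coords J) \<psi> m))" for m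
  have f: "f (\<psi> x) = \<phi> (\<Phi> x)" if "x \<in> coords J" for x
    using bij(2) that by (simp add: f_def bij_betw_def)
  have surj: "\<exists>x\<in>coords J. m = \<psi> x" if "m \<in> carrier M" for m
    using bij(2) that by (auto simp: bij_betw_def)
  have closed: "\<Phi> x \<in> coords I" if "x \<in> coords J" for x
    using \<Phi>_bij that by (auto simp: bij_betw_def)
  have bij_f: "bij_betw f (carrier M) (carrier N)"
  proof -
    have "bij_betw (\<phi> \<circ> (\<Phi> \<circ> inv_into (coords J) \<psi>)) (carrier M) (carrier N)"
      by (rule bij_betw_trans[OF bij_betw_trans[OF bij_betw_inv_into[OF bij(2)] \<Phi>_bij] bij(1)])
    moreover have "\<phi> \<circ> (\<Phi> \<circ> inv_into (coords J) \<psi>) = f"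
      by (auto simp: f_def fun_eq_iff)
    ultimately show ?thesis
      by simp
  qed
  moreover have "f \<in> LinearCombinations.module_hom (R_ring p) M N"
    unfolding LinearCombinations.module_hom_def
  proof (intro CollectI conjI allI impI)
    show "f \<in> carrier M \<rightarrow> carrier N"
      using bij_f by (auto simp: bij_betw_def)
  next
    fix m m' assume "m \<in> carrier M \<and> m' \<in> carrier M"
    then obtain x y where xy: "x \<in> coords J" "m = \<psi> x" "y \<in> coords J" "m' = \<psi> y"
      using surj by metis
    then have "f (\<psi> (x + y)) = \<phi> (\<Phi> x) \<oplus>\<^bsub>N\<^esub> \<phi> (\<Phi> y)"
      by (simp add: f \<Phi>_add addN closed)
    then show "f (m \<oplus>\<^bsub>M\<^esub> m') = f m \<oplus>\<^bsub>N\<^esub> f m'"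
      using xy by (simp add: addM f)
  next
    fix r m assume "r \<in> carrier (R_ring p) \<and> m \<in> carrier M"
    then obtain a b x where r: "r = R_elem p a b" and x: "x \<in> coords J" "m = \<psi> x"
      using surj R_elem_cases by metis
    then have "f (\<psi> (a *\<^sub>2 x + b *\<^sub>2 v x)) = \<phi> (a *\<^sub>2 \<Phi> x + b *\<^sub>2 w (\<Phi> x))"
      by (simp add: f v \<Phi>_add \<Phi>_scale \<Phi>_op)
    then show "f (r \<odot>\<^bsub>M\<^esub> m) = r \<odot>\<^bsub>N\<^esub> f m"
      using x by (simp add: r actM actN f closed)
  qed
  ultimately show ?thesis
    unfolding module_isomorphic_def by blast
qed

section \<open>Coordinates for a finitely generated free module\<close>

lemma restrict_scalars_simps [simp]:
  "carrier (restrict_scalars h M) = carrier M" "add (restrict_scalars h M) = add M"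
  "zero (restrict_scalars h M) = zero M" "a \<odot>\<^bsub>restrict_scalars h M\<^esub> x = h a \<odot>\<^bsub>M\<^esub> x"
  by (simp_all add: restrict_scalars_def)

lemma R_elem_one: "\<one>\<^bsub>R_ring p\<^esub> = R_elem p 1 0"
  by (simp add: quad_class_one R_elem_def one_pCons)

lemma restrict_scalars_zz2_module:
  fixes M :: "(zz2 poly set, 'm) module"
  assumes "Module.module (R_ring p) M"
  shows "Module.module class_ring (restrict_scalars (zz2_to_R p) M)"
proof -
  interpret M: Module.module "R_ring p" M by fact
  have mult: "R_elem p (a * b) 0 = R_elem p a 0 \<otimes>\<^bsub>R_ring p\<^esub> R_elem p b 0" for a b
    by (simp add: R_elem_def quad_class_mult mult.commute)
  have add: "R_elem p (a + b) 0 = R_elem p a 0 \<oplus>\<^bsub>R_ring p\<^esub> R_elem p b 0" for a b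
    by (simp add: R_elem_add)
  show ?thesis
  proof (rule moduleI)
    show "abelian_group (restrict_scalars (zz2_to_R p) M)"
    proof (rule abelian_groupI)
      fix x assume "x \<in> carrier (restrict_scalars (zz2_to_R p) M)"
      then show "\<exists>y\<in>carrier (restrict_scalars (zz2_to_R p) M).
          y \<oplus>\<^bsub>restrict_scalars (zz2_to_R p) M\<^esub> x = \<zero>\<^bsub>restrict_scalars (zz2_to_R p) M\<^esub>"
        using M.l_neg by auto
    qed (simp_all add: M.a_ac)
  qed (simp_all add: class_cring.cring_axioms zz2_to_R_eq mult add M.smult_l_distr M.smult_r_distr
      M.smult_assoc1 R_elem_one[symmetric])
qed

text \<open>Freeness supplies a basis over Z_2 that is possibly infinite, and finiteness is only
  known over R. The finitely many basis vectors occurring in the generators and their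
  \<omega>-multiples already span M and stay independent.\<close>

lemma free_coordinates:
  fixes M :: "(zz2 poly set, 'm) module"
  assumes M: "Module.module (R_ring p) M" and fg: "finitely_generated_module (R_ring p) M"
    and free: "free_module class_ring (restrict_scalars (zz2_to_R p) M)"
  obtains B and \<phi> :: "('m \<Rightarrow> zz2) \<Rightarrow> 'm"
  where "finite B" "bij_betw \<phi> (coords B) (carrier M)"
    and "\<And>c d. \<phi> (c + d) = \<phi> c \<oplus>\<^bsub>M\<^esub> \<phi> d" "\<And>a c. \<phi> (a *\<^sub>2 c) = R_elem p a 0 \<odot>\<^bsub>M\<^esub> \<phi> c"
proof -
  let ?Z = "restrict_scalars (zz2_to_R p) M"
  interpret M: Module.module "R_ring p" M by fact
  interpret Z: Module.module "class_ring :: zz2 ring" ?Z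
    by (rule restrict_scalars_zz2_module[OF M])
  obtain B\<^sub>0 where B\<^sub>0: "B\<^sub>0 \<subseteq> carrier M" "\<not> Z.lin_dep B\<^sub>0" "Z.span B\<^sub>0 = carrier M"
    using free unfolding free_module_def by auto
  obtain A where A: "finite A" "A \<subseteq> carrier M" "M.span A = carrier M"
    using fg unfolding finitely_generated_module_def by auto
  have "\<exists>S. finite S \<and> S \<subseteq> B\<^sub>0 \<and> m \<in> Z.span S" if "m \<in> carrier M" for m
  proof -
    have "m \<in> Z.span B\<^sub>0"
      using that B\<^sub>0(3) by (simp only:)
    then obtain a S where "m = Z.lincomb a S" "finite S" "S \<subseteq> B\<^sub>0"
      unfolding Z.span_def by blast
    then have "m \<in> Z.span S"
      unfolding Z.span_def by (intro CollectI exI[of _ a] exI[of _ S]) simp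
    then show ?thesis
      using \<open>finite S\<close> \<open>S \<subseteq> B\<^sub>0\<close> by blast
  qed
  then obtain S where S: "\<And>m. m \<in> carrier M \<Longrightarrow> finite (S m) \<and> S m \<subseteq> B\<^sub>0 \<and> m \<in> Z.span (S m)"
    by metis
  \<comment> \<open>The multiples by \<omega> are included because R = Z_2 + Z_2 \<omega>: A and
    \<omega> A together generate M over Z_2.\<close>
  define B where "B = (\<Union>a\<in>A. S a \<union> S (R_elem p 0 1 \<odot>\<^bsub>M\<^esub> a))"
  have omega_A: "R_elem p 0 1 \<odot>\<^bsub>M\<^esub> a \<in> carrier M" if "a \<in> A" for a
    using that A(2) by auto
  have B: "finite B" "B \<subseteq> B\<^sub>0"
    unfolding B_def using A(1,2) S omega_A by blast+
  have B_carrier: "B \<subseteq> carrier M"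
    using B(2) B\<^sub>0(1) by blast
  interpret span: submodule "class_ring :: zz2 ring" "Z.span B" ?Z
    using B_carrier by (intro Z.span_is_submodule) simp
  have gen: "a \<in> Z.span B" "R_elem p 0 1 \<odot>\<^bsub>M\<^esub> a \<in> Z.span B" if a: "a \<in> A" for a
  proof -
    have "S a \<subseteq> B" "S (R_elem p 0 1 \<odot>\<^bsub>M\<^esub> a) \<subseteq> B"
      using a by (auto simp: B_def)
    then show "a \<in> Z.span B" "R_elem p 0 1 \<odot>\<^bsub>M\<^esub> a \<in> Z.span B"
      using Z.span_is_monotone S[of a] S[OF omega_A[OF a]] a A(2) by blast+
  qed
  have smult_gen: "r \<odot>\<^bsub>M\<^esub> a \<in> Z.span B" if r: "r \<in> carrier (R_ring p)" and a: "a \<in> A" for r a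
  proof -
    have aM: "a \<in> carrier M"
      using a A(2) by blast
    obtain s t where r: "r = R_elem p s t"
      using R_elem_cases[OF r] by blast
    have "R_elem p s t = R_elem p s 0 \<oplus>\<^bsub>R_ring p\<^esub> R_elem p t 0 \<otimes>\<^bsub>R_ring p\<^esub> R_elem p 0 1"
      by (simp add: R_elem_def quad_class_mult quad_class_add)
    then have "r \<odot>\<^bsub>M\<^esub> a = R_elem p s 0 \<odot>\<^bsub>M\<^esub> a \<oplus>\<^bsub>M\<^esub> R_elem p t 0 \<odot>\<^bsub>M\<^esub> (R_elem p 0 1 \<odot>\<^bsub>M\<^esub> a)"
      using aM by (simp add: r M.smult_l_distr M.smult_assoc1)
    then show ?thesis
      using span.smult_closed[of s a] span.smult_closed[of t "R_elem p 0 1 \<odot>\<^bsub>M\<^esub> a"]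
        span.m_closed gen[OF a] by (simp add: zz2_to_R_eq)
  qed
  have sum_gen: "(\<Oplus>\<^bsub>M\<^esub>a\<in>T. u a \<odot>\<^bsub>M\<^esub> a) \<in> Z.span B"
    if "finite T" "T \<subseteq> A" "u \<in> T \<rightarrow> carrier (R_ring p)" for T u
    using that
  proof (induction T rule: finite_induct)
    case empty
    then show ?case using span.zero_closed by simp
  next
    case (insert x T)
    then have "(\<Oplus>\<^bsub>M\<^esub>a\<in>insert x T. u a \<odot>\<^bsub>M\<^esub> a) = u x \<odot>\<^bsub>M\<^esub> x \<oplus>\<^bsub>M\<^esub> (\<Oplus>\<^bsub>M\<^esub>a\<in>T. u a \<odot>\<^bsub>M\<^esub> a)"
      using A(2) by (intro M.finsum_insert) auto
    moreover have "(\<Oplus>\<^bsub>M\<^esub>a\<in>T. u a \<odot>\<^bsub>M\<^esub> a) \<in> Z.span B" "u x \<odot>\<^bsub>M\<^esub> x \<in> Z.span B"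
      using insert smult_gen by auto
    ultimately show ?case
      using span.m_closed by simp
  qed
  have "carrier M \<subseteq> Z.span B"
  proof
    fix m assume "m \<in> carrier M"
    then have "m \<in> M.span A"
      using A(3) by (simp only:)
    then obtain u T where "m = M.lincomb u T" "finite T" "T \<subseteq> A" "u \<in> T \<rightarrow> carrier (R_ring p)"
      unfolding M.span_def by blast
    then show "m \<in> Z.span B"
      using sum_gen[of T u] by (simp only: M.lincomb_def)
  qed
  then have span_B: "Z.span B = carrier M"
    using span.subset by auto
  have indep: "\<not> Z.lin_dep B"
    using Z.subset_li_is_li[OF B\<^sub>0(2) B(2)] .
  define \<phi> where "\<phi> c = Z.lincomb c B" for c
  have add: "\<phi> (c + d) = \<phi> c \<oplus>\<^bsub>M\<^esub> \<phi> d" for c d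
    using Z.lincomb_sum[of B c d] B(1) B_carrier by (simp add: \<phi>_def plus_fun_def)
  have scale: "\<phi> (a *\<^sub>2 c) = R_elem p a 0 \<odot>\<^bsub>M\<^esub> \<phi> c" for a c
    using Z.lincomb_smult[of B c a] B_carrier by (simp add: \<phi>_def scale2_def zz2_to_R_eq)
  have closed: "\<phi> c \<in> carrier M" for c
    using Z.lincomb_closed[of B c] B_carrier by (simp add: \<phi>_def)
  have "bij_betw \<phi> (coords B) (carrier M)"
    unfolding bij_betw_def
  proof (intro conjI inj_onI equalityI subsetI)
    fix c d assume cd: "c \<in> coords B" "d \<in> coords B" "\<phi> c = \<phi> d"
    have "\<phi> (c - d) \<oplus>\<^bsub>M\<^esub> \<phi> d = \<zero>\<^bsub>M\<^esub> \<oplus>\<^bsub>M\<^esub> \<phi> d"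
      using add[of "c - d" d] cd(3) closed by simp
    then have "\<phi> (c - d) = \<zero>\<^bsub>M\<^esub>"
      using closed M.zero_closed by (simp only: M.add.right_cancel)
    then have "(c - d) b = 0" if "b \<in> B" for b
      using Z.lin_dep_crit[of B B "c - d" b] B(1) indep that by (auto simp: \<phi>_def)
    then show "c = d"
      using cd(1,2) by (auto simp: coords_def fun_eq_iff) (metis right_minus_eq)
  next
    fix m assume "m \<in> carrier M"
    then have "m \<in> Z.span B"
      by (simp only: span_B)
    then obtain c where "m = \<phi> c"
      using Z.finite_span[of B] B(1) B_carrier by (auto simp: \<phi>_def)
    also have "\<phi> c = \<phi> (\<lambda>b. if b \<in> B then c b else 0)"
      unfolding \<phi>_def Z.lincomb_def using B_carrier by (intro Z.finsum_cong') (auto simp: zz2_to_R_eq)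
    finally show "m \<in> \<phi> ` coords B"
      by (rule image_eqI[of _ \<phi>]) (simp add: coords_def)
  qed (use closed in auto)
  then show thesis
    using B(1) add scale that by blast
qed

lemma coordinatized_free_module:
  fixes M :: "(zz2 poly set, 'm) module"
  assumes M: "Module.module (R_ring p) M" and fg: "finitely_generated_module (R_ring p) M"
    and free: "free_module class_ring (restrict_scalars (zz2_to_R p) M)"
    and q: "4 * q = (of_nat p + 1 :: zz2)"
  obtains B w and \<phi> :: "('m \<Rightarrow> zz2) \<Rightarrow> 'm"
  where "coordinatized p M B w \<phi>" "quad_lattice B w q"
proof -
  interpret M: Module.module "R_ring p" M by fact
  obtain B and \<phi> :: "('m \<Rightarrow> zz2) \<Rightarrow> 'm" where fin: "finite B"
    and bij: "bij_betw \<phi> (coords B) (carrier M)"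
    and add: "\<And>c d. \<phi> (c + d) = \<phi> c \<oplus>\<^bsub>M\<^esub> \<phi> d"
    and scale: "\<And>a c. \<phi> (a *\<^sub>2 c) = R_elem p a 0 \<odot>\<^bsub>M\<^esub> \<phi> c"
    using free_coordinates[OF M fg free] by metis
  define w where "w x = inv_into (coords B) \<phi> (R_elem p 0 1 \<odot>\<^bsub>M\<^esub> \<phi> x)" for x
  have closed: "\<phi> x \<in> carrier M" if "x \<in> coords B" for x
    using bij that by (auto simp: bij_betw_def)
  have w: "w x \<in> coords B" "\<phi> (w x) = R_elem p 0 1 \<odot>\<^bsub>M\<^esub> \<phi> x" if "x \<in> coords B" for x
  proof -
    have "R_elem p 0 1 \<odot>\<^bsub>M\<^esub> \<phi> x \<in> \<phi> ` coords B"
      using closed[OF that] bij by (auto simp: bij_betw_def)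
    then show "w x \<in> coords B" "\<phi> (w x) = R_elem p 0 1 \<odot>\<^bsub>M\<^esub> \<phi> x"
      unfolding w_def by (rule inv_into_into, rule f_inv_into_f)
  qed
  have eqI: "x = y" if "x \<in> coords B" "y \<in> coords B" "\<phi> x = \<phi> y" for x y
    using bij that by (auto simp: bij_betw_def inj_on_def)
  have act: "\<phi> (a *\<^sub>2 x + b *\<^sub>2 w x) = R_elem p a b \<odot>\<^bsub>M\<^esub> \<phi> x" if x: "x \<in> coords B" for a b x
  proof -
    have "R_elem p a b = R_elem p a 0 \<oplus>\<^bsub>R_ring p\<^esub> R_elem p b 0 \<otimes>\<^bsub>R_ring p\<^esub> R_elem p 0 1"
      by (simp add: R_elem_def quad_class_mult quad_class_add)
    then show ?thesis
      using closed[OF x] by (simp add: add scale w x M.smult_l_distr M.smult_assoc1)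
  qed
  have "coordinatized p M B w \<phi>"
    unfolding coordinatized_def using w(1) bij add act by blast
  moreover have "quad_lattice B w q"
  proof
    fix x y and a :: zz2 assume x: "x \<in> coords B"
    show "w x \<in> coords B"
      using x by (rule w(1))
    show "w (x + y) = w x + w y" if y: "y \<in> coords B"
      using x y by (intro eqI) (simp_all add: w add M.smult_r_distr closed)
    show "w (a *\<^sub>2 x) = a *\<^sub>2 w x"
    proof (rule eqI)
      have "R_elem p 0 1 \<otimes>\<^bsub>R_ring p\<^esub> R_elem p a 0 = R_elem p a 0 \<otimes>\<^bsub>R_ring p\<^esub> R_elem p 0 1"
        by (rule quad.m_comm) simp_all
      then show "\<phi> (w (a *\<^sub>2 x)) = \<phi> (a *\<^sub>2 w x)"
        using x by (simp add: w scale closed M.smult_assoc1[symmetric])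
    qed (use x w in auto)
    show "w (w x) = - (2 *\<^sub>2 w x) - (4 * q) *\<^sub>2 x"
    proof (rule eqI)
      have "R_elem p 0 1 \<otimes>\<^bsub>R_ring p\<^esub> R_elem p 0 1 = R_elem p (- (4 * q)) (- 2)"
        by (simp add: R_elem_mult[OF q])
      moreover have "- (2 *\<^sub>2 w x) - (4 * q) *\<^sub>2 x = (- (4 * q)) *\<^sub>2 x + (- 2) *\<^sub>2 w x"
        by simp
      ultimately show "\<phi> (w (w x)) = \<phi> (- (2 *\<^sub>2 w x) - (4 * q) *\<^sub>2 x)"
        using act[OF x, of "- (4 * q)" "- 2"] x by (simp only: w closed M.smult_assoc1[symmetric] R_elem_closed)
      show "- (2 *\<^sub>2 w x) - (4 * q) *\<^sub>2 x \<in> coords B"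
        using x w(1) by (auto intro: z2.subspace_neg[OF coords_subspace])
    qed (use x w in auto)
  qed (rule fin)
  ultimately show thesis
    by (rule that)
qed

section \<open>The decomposition theorem\<close>

theorem theorem3p1:
  fixes p :: nat and M :: "(zz2 poly set, 'm) module"
  assumes "Factorial_Ring.prime p" and "p mod 4 = 3"
    and "Module.module (R_ring p) M"
    and "finitely_generated_module (R_ring p) M"
    and "free_module class_ring (restrict_scalars (zz2_to_R p) M)"
  shows "(p mod 8 = 3 \<longrightarrow>
            (\<exists>!(r, s). module_isomorphic (R_ring p) M
               (direct_sum (module_power (regular_module (R_ring p)) r)
                           (module_power (O_E_module p) s)))) \<and>
         (p mod 8 = 7 \<longrightarrow>
            (\<forall>\<alpha>1 \<alpha>2 :: zz2.
               [:of_nat ((p + 1) div 4), 1, 1:] = [:- \<alpha>1, 1:] * [:- \<alpha>2, 1:] \<and>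
               \<alpha>1 dvd 1 \<and> 2 dvd \<alpha>2 \<longrightarrow>
               (\<exists>!(r, s, t). module_isomorphic (R_ring p) M
                  (direct_sum (module_power (regular_module (R_ring p)) r)
                    (direct_sum (module_power (R_mod_omega p \<alpha>1) s)
                                (module_power (R_mod_omega p \<alpha>2) t))))))"
proof (intro conjI impI allI)
  define q where "q = (of_nat ((p + 1) div 4) :: zz2)"
  have "4 * ((p + 1) div 4) = p + 1"
    using assms(2) by presburger
  then have q: "4 * q = (of_nat p + 1 :: zz2)"
    unfolding q_def by (metis of_nat_mult of_nat_numeral of_nat_add of_nat_1)
  obtain B v and \<psi> :: "('m \<Rightarrow> zz2) \<Rightarrow> 'm" where \<psi>: "coordinatized p M B v \<psi>"
    and lattice: "quad_lattice B v q"
    using coordinatized_free_module[OF assms(3-5) q] by blast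
  interpret quad_lattice B v q
    by (rule lattice)
  note R_power = coordinatized_power[OF coordinatized_R[OF q] op_zero(1)]
  {
    assume "p mod 8 = 3"
    then have "odd ((p + 1) div 4)"
      by presburger
    then have q_odd: "\<not> 2 dvd q"
      by (simp add: q_def)
    note std = coordinatized_direct_sum[OF R_power coordinatized_power[OF coordinatized_O_E[OF q q_odd] op_zero(2)]]
    \<comment> \<open>\<open>lattice_iso_sym\<close> reverses the direction: module isomorphisms
      start at M, while the decompositions start at the standard lattice.\<close>
    have iso_iff: "module_isomorphic (R_ring p) M
        (direct_sum (module_power (regular_module (R_ring p)) r) (module_power (O_E_module p) s)) \<longleftrightarrow>
      (\<exists>\<Phi>. lattice_iso (odd_index r s) (odd_op q) B v \<Phi>)" for r s
      using module_isomorphic_imp_lattice_iso[OF \<psi> std] lattice_iso_imp_module_isomorphic[OF \<psi> std]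
        lattice_iso_sym v_closed odd_op_closed by metis
    obtain r s \<Phi> where rs: "lattice_iso (odd_index r s) (odd_op q) B v \<Phi>"
      using decomposition_odd[OF q_odd] by blast
    show "\<exists>!(r, s). module_isomorphic (R_ring p) M
        (direct_sum (module_power (regular_module (R_ring p)) r) (module_power (O_E_module p) s))"
    proof (rule ex1I[of _ "(r, s)"])
      show "case (r, s) of (r, s) \<Rightarrow> module_isomorphic (R_ring p) M
        (direct_sum (module_power (regular_module (R_ring p)) r) (module_power (O_E_module p) s))"
        using rs by (auto simp: iso_iff)
      show "x = (r, s)" if "case x of (r, s) \<Rightarrow> module_isomorphic (R_ring p) M
        (direct_sum (module_power (regular_module (R_ring p)) r) (module_power (O_E_module p) s))" for x
        using that odd_ranks_unique[OF _ rs] by (auto simp: iso_iff)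
    qed
  }
  {
    fix \<alpha>1 \<alpha>2 :: zz2
    assume "p mod 8 = 7" and \<alpha>: "[:of_nat ((p + 1) div 4), 1, 1:] = [:- \<alpha>1, 1:] * [:- \<alpha>2, 1:] \<and>
      \<alpha>1 dvd 1 \<and> 2 dvd \<alpha>2"
    then have prod: "\<alpha>1 * \<alpha>2 = q" and "- \<alpha>2 - \<alpha>1 = 1"
      by (simp_all add: q_def mult.commute)
    then have sum: "\<alpha>1 + \<alpha>2 = - 1"
      by (metis add.commute minus_add_distrib minus_diff_eq minus_minus uminus_add_conv_diff)
    have "\<not> 2 dvd \<alpha>1"
      using \<alpha> dvd_trans not_two_dvd_one_zz2 by blast
    \<comment> \<open>A unit is odd and \<alpha>2 is even, so the eigenvalues differ by an odd
      element, that is, by a unit.\<close>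
    then have unit: "\<not> 2 dvd \<alpha>1 - \<alpha>2"
      using \<alpha> by (simp add: two_dvd_diff_zz2)
    then have neq: "\<alpha>1 \<noteq> \<alpha>2"
      by auto
    have root1: "\<alpha>1 * \<alpha>1 + \<alpha>1 + q = 0" and root2: "\<alpha>2 * \<alpha>2 + \<alpha>2 + q = 0"
    proof -
      have \<alpha>2: "\<alpha>2 = - 1 - \<alpha>1"
        using sum by (metis add_diff_cancel_left')
      show "\<alpha>1 * \<alpha>1 + \<alpha>1 + q = 0" "\<alpha>2 * \<alpha>2 + \<alpha>2 + q = 0"
        unfolding prod[symmetric] \<alpha>2 by (simp_all add: algebra_simps)
    qed
    note std = coordinatized_direct_sum[OF R_power coordinatized_direct_sum[OF
        coordinatized_power[OF coordinatized_R_mod_omega[OF q root1] op_zero(3)]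
        coordinatized_power[OF coordinatized_R_mod_omega[OF q root2] op_zero(3)]]]
    let ?N = "\<lambda>r s t. direct_sum (module_power (regular_module (R_ring p)) r)
      (direct_sum (module_power (R_mod_omega p \<alpha>1) s) (module_power (R_mod_omega p \<alpha>2) t))"
    have iso_iff: "module_isomorphic (R_ring p) M (?N r s t) \<longleftrightarrow>
      (\<exists>\<Phi>. lattice_iso (split_index r s t) (split_op q \<alpha>1 \<alpha>2) B v \<Phi>)" for r s t
      using module_isomorphic_imp_lattice_iso[OF \<psi> std] lattice_iso_imp_module_isomorphic[OF \<psi> std]
        lattice_iso_sym v_closed split_op_closed by metis
    obtain r s t \<Phi> where rst: "lattice_iso (split_index r s t) (split_op q \<alpha>1 \<alpha>2) B v \<Phi>"
      using decomposition_split[OF sum prod unit] by blast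
    show "\<exists>!(r, s, t). module_isomorphic (R_ring p) M (?N r s t)"
    proof (rule ex1I[of _ "(r, s, t)"])
      show "case (r, s, t) of (r, s, t) \<Rightarrow> module_isomorphic (R_ring p) M (?N r s t)"
        using rst by (auto simp: iso_iff)
      show "x = (r, s, t)" if "case x of (r, s, t) \<Rightarrow> module_isomorphic (R_ring p) M (?N r s t)" for x
        using that split_ranks_unique[OF _ rst neq] by (auto simp: iso_iff)
    qed
  }
qed

end
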